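(* Let $R$ be a skew-invertible Hecke symmetry, let $(\mathcal{D}(R^{-1}),\mathcal{M}(R))$ be the associated quantum double and $\hat L=MD$. Then for every integer $k\ge1$ the following identity (quantum Wick formula) of matrices in $(\mathrm{Mat}_N)^{\otimes(k+1)}$ with entries in the quantum double holds: $$:\!\hat L_{\overline{1\to k}}\!:\,\hat L_{\overline{k+1}}\;=\;:\!\hat L_{\overline{1\to k+1}}\!:\;+\;:\!\hat L_{\overline{1\to k}}\!:\,\frac{I_{k+1}-J_{k+1}^{-1}}{q-q^{-1}},$$ where $:\ :$ denotes the quantum normal ordering.
   Context: **Hecke symmetry.** $V$ is a complex vector space of dimension $N$. $I$ is the identity operator on $V$ or the $N\times N$ unit matrix, and $P$ is the flip on $V^{\otimes 2}$. A Hecke symmetry is $R\in\mathrm{End}(V^{\otimes 2})$ satisfying $(R\otimes I)(I\otimes R)(R\otimes I)=(I\otimes R)(R\otimes I)(I\otimes R)$ and $(qI\otimes I-R)(q^{-1}I\otimes I+R)=0$. Here $q\in\mathbb{C}\setminus\{0,\pm1\}$ is generic: $q^n\neq1$ for all positive integers $n$. Standing assumptions: $R$ is skew-invertible, i.e. there is $\Psi\in\mathrm{End}(V^{\otimes2})$ with $\mathrm{Tr}_2R_{12}\Psi_{23}=\mathrm{Tr}_2\Psi_{12}R_{23}=P_{13}$; and $R$ is taken from a family having a limit as $q\to1$ which is an involutive symmetry ($R^2=I\otimes I$ in the limit). **Matrix notation.** $R_i=I^{\otimes(i-1)}\otimes R\otimes I^{\otimes(k-i-1)}$ acts on $V^{\otimes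 k}$, with $k$ sufficiently large. For an $N\times N$ matrix $X$ (possibly with noncommuting entries, row index lower and column index upper) put $X_{\overline1}=X_1=X\otimes I^{\otimes(k-1)}$, $X_{\overline{r+1}}=R_rX_{\overline r}R_r^{-1}$, and $X_{\overline{1\to n}}=X_{\overline1}X_{\overline2}\cdots X_{\overline n}$. $I_r$ denotes the identity matrix in the tensor product. $J_1$ is the identity and $J_r=R_{r-1}J_{r-1}R_{r-1}$ for $r\ge2$ (images of the Jucys-Murphy elements). **Algebras.** $\mathcal{M}(R)$ is the unital associative algebra generated by the entries of $M=\|m_i^j\|$ with relations $R_1M_1R_1M_1=M_1R_1M_1R_1$. $\mathcal{D}(R^{-1})$ is the unital associative algebra generated by the entries of $D=\|\partial_i^j\|$ with relations $R_1^{-1}D_1R_1^{-1}D_1=D_1R_1^{-1}D_1R_1^{-1}$. The quantum double $(\mathcal{D}(R^{-1}),\mathcal{M}(R))$ is the algebra formed by these two algebras together with the permutation relations $D_1R_1M_1R_1=R_1M_1R_1^{-1}D_1+R_1$. The entries of $\hat L=MD$ are $\hat l_i^j=\sum_km_i^k\partial_k^j$. **Normal ordering.** It is defined by the rule $:\!D_1M_{\overline2}\!:\,=M_{\overline2}D_1R_1^{-2}$. More generally, the normal ordered form $:w:$ of an expression $w$ in $M$ and $D$ (with $\hat L$ written as $MD$) is obtained by applying inside the colons the homogeneous permutation relations $D_1R_1M_1=R_1M_1R_1^{-1}D_1R_1^{-1}$ (the permutation relations of the double with the constant term dropped), together with the defining relations of $\mathcal{M}(R)$ and $\mathcal{D}(R^{-1})$,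 until all entries of $D$ are to the right of all entries of $M$; the resulting ordered expression is then regarded as an element of the quantum double. *)

theory Defs
  imports
    "HOL-Analysis.Analysis"
    "HOL-Library.Poly_Mapping"
    "HOL-Algebra.QuotRing"
    "HOL-Algebra.Algebraic_Closure_Type"
begin

section \<open>Matrices over tensor powers\<close>

text \<open>
  \<open>V\<close> is \<open>\<complex>\<^sup>N\<close> with its basis indexed by a finite type \<open>'n\<close>. The basis of \<open>V\<^sup>\<otimes>\<^sup>n\<close>
  is indexed by the lists of length \<open>n\<close> over \<open>'n\<close>, and a matrix on \<open>V\<^sup>\<otimes>\<^sup>n\<close> is a function of
  a row index and a column index. Only its values on lists of length \<open>n\<close> are relevant,
  so such matrices are compared with \<open>meq n\<close>.
\<close>

type_synonym ('n, 'a) tmat = "'n list \<Rightarrow> 'n list \<Rightarrow> 'a"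

type_synonym 'n op2 = "complex ^ ('n \<times> 'n) ^ ('n \<times> 'n)"

definition meq :: "nat \<Rightarrow> ('n, 'a) tmat \<Rightarrow> ('n, 'a) tmat \<Rightarrow> bool" where
  "meq n A B \<longleftrightarrow> (\<forall>I J. length I = n \<longrightarrow> length J = n \<longrightarrow> A I J = B I J)"

definition mid :: "('n, 'a::zero_neq_one) tmat" where
  "mid I J = (if I = J then 1 else 0)"

definition mmul :: "nat \<Rightarrow> ('n, 'a::semiring_0) tmat \<Rightarrow> ('n, 'a) tmat \<Rightarrow> ('n, 'a) tmat" where
  "mmul n A B = (\<lambda>I J. \<Sum>K | length K = n. A I K * B K J)"

text \<open>The values of the inverse on lists of length \<open>n\<close> are unique if \<open>A\<close> is invertible.\<close>

definition minv :: "nat \<Rightarrow> ('n, complex) tmat \<Rightarrow> ('n, complex) tmat" where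
  "minv n A = (SOME B. meq n (mmul n A B) mid \<and> meq n (mmul n B A) mid)"

text \<open>
  \<open>opn n i A\<close> is \<open>I\<^sup>\<otimes>\<^sup>(\<^sup>i\<^sup>-\<^sup>1\<^sup>) \<otimes> A \<otimes> I\<^sup>\<otimes>\<^sup>(\<^sup>n\<^sup>-\<^sup>i\<^sup>-\<^sup>1\<^sup>)\<close>. Tensor factors are numbered from 1,
  list positions from 0.
\<close>

definition opn :: "nat \<Rightarrow> nat \<Rightarrow> 'n::finite op2 \<Rightarrow> ('n, complex) tmat" where
  "opn n i A = (\<lambda>I J.
     if \<forall>p<n. p \<noteq> i - 1 \<and> p \<noteq> i \<longrightarrow> I ! p = J ! p
     then A $ (I ! (i - 1), I ! i) $ (J ! (i - 1), J ! i) else 0)"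

definition emb1 :: "'a::zero ^ 'n ^ 'n \<Rightarrow> ('n::finite, 'a) tmat" where
  "emb1 A = (\<lambda>I J. if tl I = tl J then A $ hd I $ hd J else 0)"

section \<open>Skew-invertible Hecke symmetries\<close>

definition flip :: "'n::finite op2" where
  "flip = (\<chi> a b. if fst a = snd b \<and> snd a = fst b then 1 else 0)"

definition braid_relation :: "'n::finite op2 \<Rightarrow> bool" where
  "braid_relation R \<longleftrightarrow>
     meq 3 (mmul 3 (mmul 3 (opn 3 1 R) (opn 3 2 R)) (opn 3 1 R))
           (mmul 3 (mmul 3 (opn 3 2 R) (opn 3 1 R)) (opn 3 2 R))"

text \<open>The scalar matrix \<open>c I \<otimes> I\<close> is \<^term>\<open>mat c\<close>.\<close>

definition hecke_symmetry :: "complex \<Rightarrow> 'n::finite op2 \<Rightarrow> bool" where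
  "hecke_symmetry q R \<longleftrightarrow>
     q \<notin> {0, 1, -1} \<and> (\<forall>n>0. q ^ n \<noteq> 1) \<and>
     braid_relation R \<and> (mat q - R) ** (mat (inverse q) + R) = 0"

definition involutive_symmetry :: "'n::finite op2 \<Rightarrow> bool" where
  "involutive_symmetry R \<longleftrightarrow> braid_relation R \<and> R ** R = mat 1"

text \<open>
  A family of Hecke symmetries, indexed by a set of parameters accumulating at \<open>1\<close>, with an
  involutive symmetry as its limit. No regularity is required away from \<open>1\<close>.
\<close>

definition hecke_family :: "complex set \<Rightarrow> (complex \<Rightarrow> 'n::finite op2) \<Rightarrow> 'n op2 \<Rightarrow> bool" where
  "hecke_family Q F R0 \<longleftrightarrow>
     1 islimpt Q \<and> (\<forall>p\<in>Q. hecke_symmetry p (F p)) \<and>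
     (F \<longlongrightarrow> R0) (at 1 within Q) \<and> involutive_symmetry R0"

text \<open>Partial trace over the second factor of \<open>V\<^sup>\<otimes>\<^sup>3\<close>; the result acts on factors 1 and 3.\<close>

definition ptrace2 :: "('n::finite, complex) tmat \<Rightarrow> 'n op2" where
  "ptrace2 A = (\<chi> a c. \<Sum>b\<in>UNIV. A [fst a, b, snd a] [fst c, b, snd c])"

definition skew_invertible :: "'n::finite op2 \<Rightarrow> bool" where
  "skew_invertible R \<longleftrightarrow> (\<exists>\<Psi> :: 'n op2.
     ptrace2 (mmul 3 (opn 3 1 R) (opn 3 2 \<Psi>)) = flip \<and>
     ptrace2 (mmul 3 (opn 3 1 \<Psi>) (opn 3 2 R)) = flip)"

text \<open>\<open>jm n R r\<close> is \<open>J\<^sub>r\<close> on \<open>V\<^sup>\<otimes>\<^sup>n\<close>; the value at \<open>r = 0\<close> is not used.\<close>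

fun jm :: "nat \<Rightarrow> 'n::finite op2 \<Rightarrow> nat \<Rightarrow> ('n, complex) tmat" where
  "jm n R 0 = mid"
| "jm n R (Suc 0) = mid"
| "jm n R (Suc (Suc r)) =
     mmul n (mmul n (opn n (Suc r) R) (jm n R (Suc r))) (opn n (Suc r) R)"

section \<open>The free algebra on the entries of \<open>M\<close> and \<open>D\<close>\<close>

text \<open>
  The free algebra is the monoid algebra over \<open>\<complex>\<close> of the free monoid on the generators. The
  convolution product of \<^typ>\<open>'w \<Rightarrow>\<^sub>0 complex\<close> needs the monoid to be written additively.
  The generators \<open>GenM i j\<close>, \<open>GenD i j\<close> stand for \<open>m\<^sub>i\<^sup>j\<close>, \<open>\<partial>\<^sub>i\<^sup>j\<close>.
\<close>

datatype 'n gen = GenM 'n 'n | GenD 'n 'n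

datatype 'n gen_word = GWord (letters: "'n gen list")

instantiation gen_word :: (type) monoid_add
begin

definition zero_gen_word :: "'a gen_word" where
  "zero_gen_word = GWord []"

definition plus_gen_word :: "'a gen_word \<Rightarrow> 'a gen_word \<Rightarrow> 'a gen_word" where
  "plus_gen_word u v = GWord (letters u @ letters v)"

instance
  by standard (simp_all add: zero_gen_word_def plus_gen_word_def)

end

type_synonym 'n free_alg = "'n gen_word \<Rightarrow>\<^sub>0 complex"

definition gen_elem :: "'n gen \<Rightarrow> 'n free_alg" where
  "gen_elem g = Poly_Mapping.single (GWord [g]) 1"

definition cmat :: "('n, complex) tmat \<Rightarrow> ('n, 'n free_alg) tmat" where
  "cmat C = (\<lambda>I J. Poly_Mapping.single 0 (C I J))"

definition Mmat :: "'n free_alg ^ 'n::finite ^ 'n" where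
  "Mmat = (\<chi> i j. gen_elem (GenM i j))"

definition Dmat :: "'n free_alg ^ 'n::finite ^ 'n" where
  "Dmat = (\<chi> i j. gen_elem (GenD i j))"

definition Lmat :: "'n free_alg ^ 'n::finite ^ 'n" where
  "Lmat = Mmat ** Dmat"

text \<open>
  \<open>bar n R A r\<close> is \<open>A\<close> with overlined index \<open>r \<ge> 1\<close> (the value at \<open>r = 0\<close> is not used), and
  \<open>barprod n R A k\<close> is the product of these matrices for \<open>r = 1, \<dots>, k\<close>.
\<close>

fun bar :: "nat \<Rightarrow> 'n::finite op2 \<Rightarrow> 'n free_alg ^ 'n ^ 'n \<Rightarrow> nat \<Rightarrow> ('n, 'n free_alg) tmat" where
  "bar n R A 0 = mid"
| "bar n R A (Suc 0) = emb1 A"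
| "bar n R A (Suc (Suc r)) =
     mmul n (mmul n (cmat (opn n (Suc r) R)) (bar n R A (Suc r)))
            (cmat (minv n (opn n (Suc r) R)))"

primrec barprod :: "nat \<Rightarrow> 'n::finite op2 \<Rightarrow> 'n free_alg ^ 'n ^ 'n \<Rightarrow> nat \<Rightarrow> ('n, 'n free_alg) tmat" where
  "barprod n R A 0 = mid"
| "barprod n R A (Suc k) = mmul n (barprod n R A k) (bar n R A (Suc k))"

section \<open>The quantum double\<close>

definition mprod :: "('n, 'a::semiring_1) tmat list \<Rightarrow> ('n, 'a) tmat" where
  "mprod As = foldr (mmul 2) As mid"

definition entries :: "('n, 'n free_alg) tmat \<Rightarrow> 'n free_alg set" where
  "entries A = {A I J | I J. length I = 2 \<and> length J = 2}"

text \<open>A matrix relation is represented by the set of entries of the difference of its two sides.\<close>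

definition rels_M :: "'n::finite op2 \<Rightarrow> 'n free_alg set" where
  "rels_M R = (let R1 = cmat (opn 2 1 R); M1 = emb1 Mmat in
     entries (\<lambda>I J. mprod [R1, M1, R1, M1] I J - mprod [M1, R1, M1, R1] I J))"

definition rels_D :: "'n::finite op2 \<Rightarrow> 'n free_alg set" where
  "rels_D R = (let R1' = cmat (minv 2 (opn 2 1 R)); D1 = emb1 Dmat in
     entries (\<lambda>I J. mprod [R1', D1, R1', D1] I J - mprod [D1, R1', D1, R1'] I J))"

definition rels_perm :: "'n::finite op2 \<Rightarrow> 'n free_alg set" where
  "rels_perm R = (let R1 = cmat (opn 2 1 R); R1' = cmat (minv 2 (opn 2 1 R));
       M1 = emb1 Mmat; D1 = emb1 Dmat in
     entries (\<lambda>I J. mprod [D1, R1, M1, R1] I J - (mprod [R1, M1, R1', D1] I J + R1 I J)))"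

definition rels_perm_hom :: "'n::finite op2 \<Rightarrow> 'n free_alg set" where
  "rels_perm_hom R = (let R1 = cmat (opn 2 1 R); R1' = cmat (minv 2 (opn 2 1 R));
       M1 = emb1 Mmat; D1 = emb1 Dmat in
     entries (\<lambda>I J. mprod [D1, R1, M1] I J - mprod [R1, M1, R1', D1, R1'] I J))"

abbreviation free_ring :: "'n free_alg ring" where
  "free_ring \<equiv> ring_of_type_algebra"

definition double_ideal :: "'n::finite op2 \<Rightarrow> 'n free_alg set" where
  "double_ideal R = Idl\<^bsub>free_ring\<^esub> (rels_M R \<union> rels_D R \<union> rels_perm R)"

definition hom_ideal :: "'n::finite op2 \<Rightarrow> 'n free_alg set" where
  "hom_ideal R = Idl\<^bsub>free_ring\<^esub> (rels_M R \<union> rels_D R \<union> rels_perm_hom R)"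

definition quantum_double :: "'n::finite op2 \<Rightarrow> 'n free_alg set ring" where
  "quantum_double R = free_ring Quot double_ideal R"

definition in_double :: "'n::finite op2 \<Rightarrow> 'n free_alg \<Rightarrow> 'n free_alg set" where
  "in_double R x = double_ideal R +>\<^bsub>free_ring\<^esub> x"

definition in_double_mat :: "'n::finite op2 \<Rightarrow> ('n, 'n free_alg) tmat \<Rightarrow> ('n, 'n free_alg set) tmat" where
  "in_double_mat R A = (\<lambda>I J. in_double R (A I J))"

definition dmul :: "'n::finite op2 \<Rightarrow> nat \<Rightarrow> ('n, 'n free_alg set) tmat \<Rightarrow>
    ('n, 'n free_alg set) tmat \<Rightarrow> ('n, 'n free_alg set) tmat" where
  "dmul R n A B = (\<lambda>I J. \<Oplus>\<^bsub>quantum_double R\<^esub>K\<in>{K. length K = n}.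
      A I K \<otimes>\<^bsub>quantum_double R\<^esub> B K J)"

definition dadd :: "'n::finite op2 \<Rightarrow> ('n, 'n free_alg set) tmat \<Rightarrow>
    ('n, 'n free_alg set) tmat \<Rightarrow> ('n, 'n free_alg set) tmat" where
  "dadd R A B = (\<lambda>I J. A I J \<oplus>\<^bsub>quantum_double R\<^esub> B I J)"

section \<open>Normal ordering\<close>

text \<open>
  An expression \<open>w\<close> is rewritten modulo the relations of \<open>\<M>(R)\<close> and \<open>\<D>(R\<^sup>-\<^sup>1)\<close> and the
  homogeneous permutation relations into an expression \<open>u\<close> in which all entries of \<open>M\<close>
  precede all entries of \<open>D\<close>; then \<open>u\<close> is read in the quantum double.
\<close>

definition ordered_expr :: "'n free_alg \<Rightarrow> bool" where
  "ordered_expr u \<longleftrightarrow> (\<forall>v \<in> Poly_Mapping.keys u. \<exists>ms ds.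
     letters v = map (\<lambda>(i, j). GenM i j) ms @ map (\<lambda>(i, j). GenD i j) ds)"

definition is_normal_ordering :: "'n::finite op2 \<Rightarrow> 'n free_alg \<Rightarrow> 'n free_alg set \<Rightarrow> bool" where
  "is_normal_ordering R w x \<longleftrightarrow>
     (\<exists>u. ordered_expr u \<and> w - u \<in> hom_ideal R \<and> x = in_double R u)"

text \<open>
  For a skew-invertible Hecke symmetry every \<open>w\<close> has exactly one normal ordered form.
  The definition does not presuppose this.
\<close>

definition normal_ordering :: "'n::finite op2 \<Rightarrow> 'n free_alg \<Rightarrow> 'n free_alg set" where
  "normal_ordering R w = (THE x. is_normal_ordering R w x)"

definition normal_mat :: "'n::finite op2 \<Rightarrow> ('n, 'n free_alg) tmat \<Rightarrow> ('n, 'n free_alg set) tmat" where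
  "normal_mat R A = (\<lambda>I J. normal_ordering R (A I J))"

end

theory Submission
  imports Defs
begin

text \<open>
  Put \<open>\<Delta>\<^sub>1 = D\<^sub>1\<close> and \<open>\<Delta>\<^bsub>k+1\<^esub> = R\<^sub>k\<^sup>-\<^sup>1 \<Delta>\<^sub>k R\<^sub>k\<^sup>-\<^sup>1\<close>, so that \<open>\<Delta>\<^sub>k = J\<^sub>k\<^sup>-\<^sup>1 D\<^sub>k\<close> with \<open>D\<^sub>k\<close> the overlined
  matrix. In the quantum double, by induction on \<open>k\<close>,
  \<open>\<Delta>\<^sub>1 \<dots> \<Delta>\<^sub>k M\<^bsub>k+1\<^esub> = M\<^bsub>k+1\<^esub> \<Delta>\<^sub>1 \<dots> \<Delta>\<^sub>k J\<^bsub>k+1\<^esub>\<^sup>-\<^sup>1 + G\<^sub>k\<close> with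
  \<open>G\<^sub>k D\<^bsub>k+1\<^esub> = \<Delta>\<^sub>1 \<dots> \<Delta>\<^sub>k (1 - J\<^bsub>k+1\<^esub>\<^sup>-\<^sup>1) / (q - q\<^sup>-\<^sup>1)\<close>, and \<open>G\<^sub>k\<close> is absent if the permutation relations
  are homogeneous. Hence \<open>M\<^sub>1 \<dots> M\<^sub>k \<Delta>\<^sub>1 \<dots> \<Delta>\<^sub>k\<close> is a normal form of \<open>L\<^sub>1 \<dots> L\<^sub>k\<close>, and multiplying it by
  \<open>L\<^bsub>k+1\<^esub> = M\<^bsub>k+1\<^esub> D\<^bsub>k+1\<^esub>\<close> gives the Wick formula.

  Normal forms are unique: skew-invertibility solves the homogeneous permutation relations for the
  products \<open>\<partial>\<^sub>i\<^sup>a m\<^sub>b\<^sup>j\<close>, which defines a linear normal ordering map \<open>N\<close> on the free algebra that fixes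
  ordered elements and vanishes on these relations. By the braid relation, the relations of \<open>\<M>(R)\<close>
  can be moved to the left past \<open>D\<close>, and those of \<open>\<D>(R\<^sup>-\<^sup>1)\<close> to the right past \<open>M\<close>. Therefore \<open>N\<close>
  maps the homogeneous ideal into the ideal generated by these two sets of relations.
\<close>

section \<open>Braid representations and the permutation relations\<close>

text \<open>Normal ordering rewrites modulo \<open>hom_ideal R\<close>, while the formula is an
  identity modulo \<open>double_ideal R\<close>. The homogeneous permutation relations are not among
  the relations of the double, so a congruence for the first ideal does not simply carry over.
  \<open>N\<close> bridges the two: if ordered u and v are congruent modulo
  \<open>hom_ideal R\<close>, then \<open>N\<close> fixes u - v, annihilates the permutation
  relations in it and leaves relations of M and of D alone, which hold in the double.
  Skew-invertibility has two parts: it defines \<open>N\<close>, and it strips the auxiliary factors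
  R with which D is moved past a relation of M.

  The computations with strands take place in an abstract ring with a central element
  \<open>e\<close> in front of the constant term, so that one induction serves the homogeneous case
  \<open>e = 0\<close> and the double \<open>e = 1\<close>. G_k is controlled through its product
  with the overlined D, where the fraction appears as the division-free recursion \<open>C\<close>:
  the constant term of each exchange contributes one inverse of R. The Hecke condition supplies this
  inverse as R - (q - 1/q) and identifies \<open>C\<close> with the fraction.\<close>

definition two_sided_ideal :: "'a::ring_1 set \<Rightarrow> bool" where
  "two_sided_ideal K \<longleftrightarrow> 0 \<in> K \<and> (\<forall>x\<in>K. \<forall>y\<in>K. x + y \<in> K) \<and> (\<forall>x\<in>K. \<forall>a. a * x \<in> K \<and> x * a \<in> K)"

lemma two_sided_idealD:
  assumes "two_sided_ideal K"
  shows "0 \<in> K" "x \<in> K \<Longrightarrow> y \<in> K \<Longrightarrow> x + y \<in> K" "x \<in> K \<Longrightarrow> a * x \<in> K" "x \<in> K \<Longrightarrow> x * a \<in> K"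
  using assms unfolding two_sided_ideal_def by blast+

lemma two_sided_ideal_diff:
  assumes "two_sided_ideal K" "x \<in> K" "y \<in> K"
  shows "x - y \<in> K"
  using two_sided_idealD(2)[OF assms(1,2) two_sided_idealD(3)[OF assms(1,3), of "- 1"]] by simp

lemma two_sided_ideal_sum:
  assumes "two_sided_ideal K" "\<And>i. i \<in> A \<Longrightarrow> f i \<in> K"
  shows "sum f A \<in> K"
  using assms(2) by (induction A rule: infinite_finite_induct) (auto intro: two_sided_idealD[OF assms(1)])

text \<open>Computing modulo an ideal instead of in the quotient keeps all elements in a type-class
  ring, where rewriting with the ring laws is available. The quotient is entered only at the
  end.\<close>

locale ring_congruence =
  fixes K :: "'a::ring_1 set"
  assumes ideal: "two_sided_ideal K"
begin

definition cong :: "'a \<Rightarrow> 'a \<Rightarrow> bool" (infix "\<doteq>" 50) where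
  "x \<doteq> y \<longleftrightarrow> x - y \<in> K"

lemma cong_refl [simp, intro]: "x \<doteq> x"
  using two_sided_idealD[OF ideal] by (simp add: cong_def)

lemma cong_trans [trans]: "x \<doteq> y \<Longrightarrow> y \<doteq> z \<Longrightarrow> x \<doteq> z"
  unfolding cong_def using two_sided_idealD(2)[OF ideal, of "x - y" "y - z"] by simp

lemma cong_eq_trans [trans]: "x \<doteq> y \<Longrightarrow> y = z \<Longrightarrow> x \<doteq> z"
  and eq_cong_trans [trans]: "x = y \<Longrightarrow> y \<doteq> z \<Longrightarrow> x \<doteq> z"
  by simp_all

lemma cong_add: "x \<doteq> x' \<Longrightarrow> y \<doteq> y' \<Longrightarrow> x + y \<doteq> x' + y'"
  unfolding cong_def using two_sided_idealD(2)[OF ideal, of "x - x'" "y - y'"]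
  by (simp add: algebra_simps)

lemma cong_diff: "x \<doteq> x' \<Longrightarrow> y \<doteq> y' \<Longrightarrow> x - y \<doteq> x' - y'"
  unfolding cong_def using two_sided_ideal_diff[OF ideal, of "x - x'" "y - y'"]
  by (simp add: algebra_simps)

lemma cong_mult: "x \<doteq> x' \<Longrightarrow> y \<doteq> y' \<Longrightarrow> x * y \<doteq> x' * y'"
  unfolding cong_def
  using two_sided_idealD(2)[OF ideal two_sided_idealD(4)[OF ideal, of "x - x'" y]
      two_sided_idealD(3)[OF ideal, of "y - y'" x']]
  by (simp add: algebra_simps)

lemmas cong_intros = cong_add cong_diff cong_mult cong_refl

end

text \<open>Products are normalised to right-nested form. These lemmas extend an identity between
  words to a rewrite rule that also fires inside a longer right-nested word.\<close>

lemma mult_assoc_rule: "a * b = c \<Longrightarrow> a * (b * x) = c * (x :: 'a::semigroup_mult)"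
  by (simp flip: mult.assoc)

lemma mult_assoc_rule3: "a * b = c * d \<Longrightarrow> a * (b * x) = c * (d * (x :: 'a::semigroup_mult))"
  by (simp flip: mult.assoc)

lemma mult_assoc_rule33:
  "a * (b * c) = d * (e * f) \<Longrightarrow> a * (b * (c * x)) = d * (e * (f * (x :: 'a::semigroup_mult)))"
  by (simp flip: mult.assoc)

text \<open>With (u, v) = (r, s) this gives the overlined matrices, with (s, s) the Delta of the
  overview. For y = 1 the pairs (r, r) and (s, s) give the Jucys-Murphy elements and their
  inverses.\<close>

primrec orbit :: "(nat \<Rightarrow> 'a) \<Rightarrow> (nat \<Rightarrow> 'a) \<Rightarrow> 'a \<Rightarrow> nat \<Rightarrow> 'a::monoid_mult" where
  "orbit u v y 0 = y"
| "orbit u v y (Suc i) = u i * orbit u v y i * v i"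

text \<open>Strand indices start at 0: \<open>r i\<close> stands for \<open>R\<^bsub>i+1\<^esub>\<close> and \<open>s i\<close> for its inverse.\<close>

locale braid_rep =
  fixes n :: nat and r s :: "nat \<Rightarrow> 'a::ring_1"
  assumes rs: "Suc i < n \<Longrightarrow> r i * s i = 1"
    and sr: "Suc i < n \<Longrightarrow> s i * r i = 1"
    and braid: "Suc (Suc i) < n \<Longrightarrow> r i * (r (Suc i) * r i) = r (Suc i) * (r i * r (Suc i))"
    and far: "Suc i < j \<Longrightarrow> Suc j < n \<Longrightarrow> r i * r j = r j * r i"
begin

lemmas rs' = mult_assoc_rule[OF rs, simplified]
lemmas sr' = mult_assoc_rule[OF sr, simplified]

lemma commute_inverse:
  assumes "Suc i < n" "r i * x = x * r i"
  shows "s i * x = x * s i"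
proof -
  have "s i * x = s i * (x * r i) * s i" using assms(1) by (simp add: mult.assoc rs)
  also have "\<dots> = x * s i" using assms(1) by (simp add: mult.assoc sr' flip: assms(2))
  finally show ?thesis .
qed

lemma far_rs: "Suc i < j \<Longrightarrow> Suc j < n \<Longrightarrow> r i * s j = s j * r i"
  using commute_inverse[of j "r i"] far[of i j] by simp

lemma far_sr: "Suc i < j \<Longrightarrow> Suc j < n \<Longrightarrow> s i * r j = r j * s i"
  using commute_inverse[of i "r j"] far[of i j] by simp

lemmas braid' = mult_assoc_rule33[OF braid]

lemma braid_rss:
  assumes "Suc (Suc i) < n"
  shows "r i * (s (Suc i) * s i) = s (Suc i) * (s i * r (Suc i))"
proof -
  have "s (Suc i) * (s i * r (Suc i)) = s (Suc i) * (s i * (r (Suc i) * (r i * (r (Suc i) * (s (Suc i) * s i)))))"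
    using assms by (simp add: rs rs')
  also have "\<dots> = r i * (s (Suc i) * s i)"
    using assms by (simp add: sr' flip: braid')
  finally show ?thesis by simp
qed

lemma braid_srr:
  assumes "Suc (Suc i) < n"
  shows "s i * (r (Suc i) * r i) = r (Suc i) * (r i * s (Suc i))"
proof -
  have "r (Suc i) * (r i * s (Suc i)) = s i * (r i * (r (Suc i) * (r i * s (Suc i))))"
    using assms by (simp add: sr')
  also have "\<dots> = s i * (r (Suc i) * r i)"
    using assms by (simp add: braid' rs)
  finally show ?thesis by simp
qed

lemma braid_rss':
  assumes "Suc (Suc i) < n"
  shows "r (Suc i) * (s i * s (Suc i)) = s i * (s (Suc i) * r i)"
proof -
  have "s i * (s (Suc i) * r i) = s i * (s (Suc i) * (r i * (r (Suc i) * (r i * (s i * s (Suc i))))))"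
    using assms by (simp add: rs rs')
  also have "\<dots> = r (Suc i) * (s i * s (Suc i))"
    using assms by (simp add: sr' braid')
  finally show ?thesis by simp
qed

lemma braid_s:
  assumes "Suc (Suc i) < n"
  shows "s i * (s (Suc i) * s i) = s (Suc i) * (s i * s (Suc i))"
proof -
  have "s (Suc i) * (s i * s (Suc i)) = s i * (r i * (s (Suc i) * (s i * s (Suc i))))"
    using assms by (simp add: sr')
  also have "\<dots> = s i * (s (Suc i) * s i)"
    using assms by (simp add: mult_assoc_rule33[OF braid_rss] rs)
  finally show ?thesis by simp
qed

lemma orbit_commute_above:
  assumes "u = r \<or> u = s" "v = r \<or> v = s" "i < j" "Suc j < n" "r j * y = y * r j"
  shows "r j * orbit u v y i = orbit u v y i * r j"
  using \<open>i < j\<close>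
proof (induction i)
  case (Suc i)
  have u: "r j * u i = u i * r j" and v: "r j * v i = v i * r j"
    using assms(1,2,4) Suc.prems by (auto simp: far[of i j] far_sr[of i j])
  have o: "r j * orbit u v y i = orbit u v y i * r j"
    using Suc by simp
  show ?case
    by (simp only: orbit.simps mult.assoc mult_assoc_rule3[OF u] mult_assoc_rule3[OF o] v)
qed (use assms(5) in simp)

text \<open>At the layers j and j + 1 of the orbit, the braid relation or a mixed form with inverses
  turns \<open>r j\<close> into \<open>r (Suc j)\<close>, which commutes with the inner orbit, and
  then back on the right. All later layers commute with \<open>r j\<close> by distance.\<close>

lemma orbit_commute_below:
  assumes "u = r \<or> u = s" "v = r \<or> v = s" "Suc j < i" "i < n"
    and y: "\<And>j. 0 < j \<Longrightarrow> Suc j < n \<Longrightarrow> r j * y = y * r j"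
  shows "r j * orbit u v y i = orbit u v y i * r j"
  using assms(3,4)
proof (induction i)
  case (Suc i)
  show ?case
  proof (cases "i = Suc j")
    case True
    have n: "Suc (Suc j) < n" using True Suc.prems by simp
    have u: "r j * (u (Suc j) * u j) = u (Suc j) * (u j * r (Suc j))"
      using assms(1) braid[OF n] braid_rss[OF n] by auto
    have v: "v j * (v (Suc j) * r j) = r (Suc j) * (v j * v (Suc j))"
      using assms(2) braid[OF n] braid_rss'[OF n] by auto
    have o: "r (Suc j) * orbit u v y j = orbit u v y j * r (Suc j)"
      using assms(1,2) n y by (intro orbit_commute_above) auto
    show ?thesis
      unfolding True by (simp only: orbit.simps mult.assoc mult_assoc_rule33[OF u] mult_assoc_rule3[OF o] v)
  next
    case False
    have u: "r j * u i = u i * r j" and v: "r j * v i = v i * r j"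
      using assms(1,2) Suc.prems False by (auto simp: far[of j i] far_rs[of j i])
    have o: "r j * orbit u v y i = orbit u v y i * r j"
      using Suc False by simp
    show ?thesis
      by (simp only: orbit.simps mult.assoc mult_assoc_rule3[OF u] mult_assoc_rule3[OF o] v)
  qed
qed simp

text \<open>\<open>J i\<close> is the Jucys-Murphy element \<open>J\<^bsub>i+1\<^esub>\<close>, and \<open>C i\<close> is
  \<open>(1 - J\<^bsub>i+1\<^esub>\<^bsup>-1\<^esup>) / (q - q\<^bsup>-1\<^esup>)\<close>, see \<open>C_eq\<close>.\<close>

definition J :: "nat \<Rightarrow> 'a" where "J = orbit r r 1"
definition Ji :: "nat \<Rightarrow> 'a" where "Ji = orbit s s 1"

primrec C :: "nat \<Rightarrow> 'a" where
  "C 0 = 0"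
| "C (Suc i) = s i + s i * C i * s i"

lemma J_Suc: "J (Suc i) = r i * J i * r i" and Ji_Suc: "Ji (Suc i) = s i * Ji i * s i"
  and J_0 [simp]: "J 0 = 1" and Ji_0 [simp]: "Ji 0 = 1"
  by (simp_all add: J_def Ji_def)

lemma J_Ji: "i < n \<Longrightarrow> J i * Ji i = 1"
  by (induction i) (simp_all add: J_Suc Ji_Suc mult.assoc rs' rs mult_assoc_rule[where c = 1])

lemma Ji_J: "i < n \<Longrightarrow> Ji i * J i = 1"
  by (induction i) (simp_all add: J_Suc Ji_Suc mult.assoc sr' sr mult_assoc_rule[where c = 1])

text \<open>\<open>c\<close> stands for the scalar q - 1/q, kept on the left so that no division
  occurs in the ring. The induction step is 1 - s^2 + s (1 - Ji) s = 1 - s Ji s.\<close>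

lemma C_eq:
  assumes c: "\<And>x. c * x = x * c" and hecke: "\<And>i. Suc i < n \<Longrightarrow> c * s i = 1 - s i * s i"
  shows "i < n \<Longrightarrow> c * C i = 1 - Ji i"
proof (induction i)
  case (Suc i)
  have "c * (s i * C i * s i) = s i * (c * C i) * s i"
    using mult_assoc_rule3[OF c[of "s i"]] by (simp add: mult.assoc)
  then show ?case
    using Suc hecke[of i] by (simp add: Ji_Suc algebra_simps)
qed simp

text \<open>All three elements are polynomials in the \<open>r j\<close> and \<open>s j\<close> with
  j < i.\<close>

lemma commute_JC:
  assumes "\<And>j. j < i \<Longrightarrow> r j * x = x * r j" "i < n"
  shows "J i * x = x * J i" "Ji i * x = x * Ji i" "C i * x = x * C i"
proof -
  have "J i * x = x * J i \<and> Ji i * x = x * Ji i \<and> C i * x = x * C i"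
    using assms
  proof (induction i)
    case (Suc i)
    have r: "r i * x = x * r i" using Suc.prems by simp
    have s: "s i * x = x * s i" using Suc.prems r commute_inverse by simp
    from Suc have *: "J i * x = x * J i" "Ji i * x = x * Ji i" "C i * x = x * C i" by simp_all
    show ?case
      by (simp add: J_Suc Ji_Suc distrib_left distrib_right mult.assoc r s
          mult_assoc_rule3[OF r] mult_assoc_rule3[OF s] *[THEN mult_assoc_rule3])
  qed simp
  then show "J i * x = x * J i" "Ji i * x = x * Ji i" "C i * x = x * C i" by auto
qed

end

section \<open>Permutation relations of M and D along the strands\<close>

locale perm_rep = braid_rep n r s + ring_congruence K
  for n :: nat and r s :: "nat \<Rightarrow> 'a::ring_1" and K :: "'a set" +
  fixes m d e :: 'a
  assumes rm: "0 < i \<Longrightarrow> Suc i < n \<Longrightarrow> r i * m = m * r i"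
    and rd: "0 < i \<Longrightarrow> Suc i < n \<Longrightarrow> r i * d = d * r i"
    and e_central: "e * x = x * e"
    and perm: "1 < n \<Longrightarrow> d * r 0 * m * r 0 \<doteq> r 0 * m * s 0 * d + e * r 0"
begin

text \<open>\<open>mb i\<close> and \<open>db i\<close> are M and D with overlined index i + 1, and
  \<open>dd i\<close> is the Delta of the overview with index i + 1.\<close>

definition mb :: "nat \<Rightarrow> 'a" where "mb = orbit r s m"
definition db :: "nat \<Rightarrow> 'a" where "db = orbit r s d"
definition dd :: "nat \<Rightarrow> 'a" where "dd = orbit s s d"

lemma mb_Suc: "mb (Suc i) = r i * mb i * s i" and db_Suc: "db (Suc i) = r i * db i * s i"
  and dd_Suc: "dd (Suc i) = s i * dd i * s i"
  and mb_0: "mb 0 = m" and db_0: "db 0 = d" and dd_0: "dd 0 = d"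
  by (simp_all add: mb_def db_def dd_def)

lemma r_mb: "Suc j < i \<Longrightarrow> i < n \<Longrightarrow> r j * mb i = mb i * r j"
  and r_dd: "Suc j < i \<Longrightarrow> i < n \<Longrightarrow> r j * dd i = dd i * r j"
  unfolding mb_def dd_def by (rule orbit_commute_below; auto simp: rm rd)+

lemma r_db': "i < j \<Longrightarrow> Suc j < n \<Longrightarrow> r j * db i = db i * r j"
  and r_dd': "i < j \<Longrightarrow> Suc j < n \<Longrightarrow> r j * dd i = dd i * r j"
  unfolding db_def dd_def by (rule orbit_commute_above; auto simp: rd)+

lemma s_mb: "Suc j < i \<Longrightarrow> i < n \<Longrightarrow> s j * mb i = mb i * s j"
  and s_dd': "i < j \<Longrightarrow> Suc j < n \<Longrightarrow> s j * dd i = dd i * s j"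
  using r_mb r_dd' by (auto intro: commute_inverse)

lemma dd_eq: "i < n \<Longrightarrow> dd i = Ji i * db i"
  by (induction i) (simp_all add: dd_Suc db_Suc Ji_Suc dd_0 db_0 mult.assoc sr')

lemma db_eq: "i < n \<Longrightarrow> db i = J i * dd i"
  by (simp add: dd_eq mult_assoc_rule[OF J_Ji])

text \<open>Conjugation by \<open>r i * r (Suc i)\<close> raises strand indices by one: here for M,
  and in \<open>db_Suc_conj\<close> and \<open>s_Suc_conj\<close> for D and \<open>s\<close>. For M
  the reason is that \<open>mb (Suc (Suc i))\<close> commutes with \<open>r i\<close>.\<close>

lemma mb_Suc_conj:
  assumes "Suc (Suc i) < n"
  shows "mb (Suc (Suc i)) = r i * (r (Suc i) * (mb (Suc i) * (s (Suc i) * s i)))"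
proof -
  have "mb (Suc (Suc i)) = r i * mb (Suc (Suc i)) * s i"
    using assms r_mb[of i "Suc (Suc i)"] by (simp add: mult.assoc rs)
  then show ?thesis using mb_Suc[of "Suc i"] by (simp add: mult.assoc)
qed

lemma db_Suc_conj:
  assumes "Suc (Suc i) < n"
  shows "db (Suc i) = r i * (r (Suc i) * (db i * (s (Suc i) * s i)))"
proof -
  have "r (Suc i) * (db i * (s (Suc i) * s i)) = db i * s i"
    using assms mult_assoc_rule3[OF r_db'[of i "Suc i"]] by (simp add: rs')
  then show ?thesis by (simp add: db_Suc mult.assoc)
qed

lemma s_Suc_conj:
  assumes "Suc (Suc i) < n"
  shows "s (Suc i) = r i * (r (Suc i) * (s i * (s (Suc i) * s i)))"
  using assms by (simp add: braid_s rs')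

text \<open>For i = 0 this is \<open>perm\<close> multiplied by \<open>s 0 * s 0\<close> on the
  right, that is the normal ordering rule with its constant term. Higher indices follow by the
  conjugation that raises indices.\<close>

lemma perm_mb:
  assumes "Suc i < n"
  shows "db i * mb (Suc i) \<doteq> mb (Suc i) * db i * s i * s i + e * s i"
  using assms
proof (induction i)
  case 0
  have "db 0 * mb 1 = d * r 0 * m * r 0 * s 0 * s 0"
    using 0 by (simp add: mb_Suc mb_0 db_0 mult.assoc rs')
  also have "\<dots> \<doteq> (r 0 * m * s 0 * d + e * r 0) * s 0 * s 0"
    using 0 by (intro cong_intros perm) simp
  also have "\<dots> = mb 1 * db 0 * s 0 * s 0 + e * s 0"
    using 0 by (simp add: mb_Suc mb_0 db_0 algebra_simps rs')
  finally show ?case by simp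
next
  case (Suc i)
  define g h where gh: "g = r i * r (Suc i)" "h = s (Suc i) * s i"
  have hg: "h * (g * x) = x" for x
    using Suc.prems by (simp add: gh mult.assoc sr')
  have conj: "mb (Suc (Suc i)) = g * (mb (Suc i) * h)" "db (Suc i) = g * (db i * h)"
    "s (Suc i) = g * (s i * h)"
    using mb_Suc_conj[OF Suc.prems] db_Suc_conj[OF Suc.prems] s_Suc_conj[OF Suc.prems]
    by (simp_all add: gh mult.assoc)
  have e: "x * (e * y) = e * (x * y)" for x y
    using mult_assoc_rule3[OF e_central, of x y] by simp
  have "db (Suc i) * mb (Suc (Suc i)) = g * ((db i * mb (Suc i)) * h)"
    unfolding conj by (simp add: mult.assoc hg)
  also have "\<dots> \<doteq> g * ((mb (Suc i) * db i * s i * s i + e * s i) * h)"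
    using Suc by (intro cong_intros) simp
  also have "\<dots> = mb (Suc (Suc i)) * db (Suc i) * s (Suc i) * s (Suc i) + e * s (Suc i)"
    unfolding conj by (simp add: distrib_left distrib_right mult.assoc hg e)
  finally show ?case .
qed

text \<open>The products \<open>MM k\<close> and \<open>DD k\<close> make up the normal ordered form of \<open>L\<^sub>1 \<dots> L\<^sub>k\<close>.\<close>

primrec MM :: "nat \<Rightarrow> 'a" where
  "MM 0 = 1"
| "MM (Suc k) = MM k * mb k"

primrec DD :: "nat \<Rightarrow> 'a" where
  "DD 0 = 1"
| "DD (Suc k) = DD k * dd k"

lemma r_DD: "k \<le> j \<Longrightarrow> Suc j < n \<Longrightarrow> r j * DD k = DD k * r j"
proof (induction k)
  case (Suc k)
  then have a: "r j * DD k = DD k * r j" and b: "r j * dd k = dd k * r j"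
    using r_dd' by auto
  show ?case by (simp add: mult.assoc mult_assoc_rule3[OF a] b)
qed simp

end

section \<open>Reflection equation for Delta and the exchange of M with products of Delta\<close>

locale double_rep = perm_rep +
  assumes dd_rel: "1 < n \<Longrightarrow> s 0 * d * s 0 * d \<doteq> d * s 0 * d * s 0"
begin

text \<open>Put a = \<open>s i\<close> and b = \<open>s (Suc i)\<close>. Since b commutes with
  \<open>dd i\<close>, braid moves bring both sides for \<open>Suc i\<close> to the form a b X b a,
  where X is the respective side for i.\<close>

lemma dd_reflection:
  assumes "Suc i < n"
  shows "s i * dd i * s i * dd i \<doteq> dd i * s i * dd i * s i"
  using assms
proof (induction i)
  case 0
  then show ?case by (simp add: dd_rel dd_0)
next
  case (Suc i)
  define a b x where ab: "a = s i" "b = s (Suc i)" "x = dd i"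
  have bx: "b * x = x * b" and bab: "b * (a * b) = a * (b * a)"
    using Suc.prems s_dd'[of i "Suc i"] braid_s[of i] by (simp_all add: ab)
  have "s (Suc i) * dd (Suc i) * s (Suc i) * dd (Suc i) = b * (a * (x * (a * (b * (a * (x * a))))))"
    by (simp add: dd_Suc ab mult.assoc)
  also have "\<dots> = b * (a * (x * (b * (a * (b * (x * a))))))"
    by (simp only: mult_assoc_rule33[OF bab])
  also have "\<dots> = b * (a * (b * (x * (a * (x * (b * a))))))"
    by (simp only: mult_assoc_rule3[OF bx])
  also have "\<dots> = a * (b * (a * (x * (a * (x * (b * a))))))"
    by (simp only: mult_assoc_rule33[OF bab])
  also have "\<dots> = a * b * (s i * dd i * s i * dd i) * (b * a)"
    by (simp add: ab mult.assoc)
  also have "\<dots> \<doteq> a * b * (dd i * s i * dd i * s i) * (b * a)"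
    using Suc.prems by (intro cong_mult[OF cong_mult] Suc.IH cong_refl) simp
  also have "\<dots> = a * (b * (x * (a * (x * (a * (b * a))))))"
    by (simp add: ab mult.assoc)
  also have "\<dots> = a * (b * (x * (a * (x * (b * (a * b))))))"
    by (simp only: bab)
  also have "\<dots> = a * (x * (b * (a * (b * (x * (a * b))))))"
    by (simp only: mult_assoc_rule3[OF bx])
  also have "\<dots> = a * (x * (a * (b * (a * (x * (a * b))))))"
    by (simp only: mult_assoc_rule33[OF bab])
  also have "\<dots> = dd (Suc i) * s (Suc i) * dd (Suc i) * s (Suc i)"
    by (simp add: dd_Suc ab mult.assoc)
  finally show ?case .
qed

text \<open>In the induction step M is exchanged with the last Delta by \<open>perm_mb\<close>, and
  then, being a conjugate of \<open>mb k\<close>, with the earlier ones. G stays existential: the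
  factor \<open>db k\<close> is the D of L = M D, so its product with G is what the Wick formula
  uses.\<close>

lemma DD_mb:
  assumes "k < n"
  shows "\<exists>G. DD k * mb k \<doteq> mb k * DD k * Ji k + e * G \<and> G * db k \<doteq> DD k * C k"
  using assms
proof (induction k)
  case 0
  show ?case by (rule exI[of _ 0]) simp
next
  case (Suc k)
  then obtain G where G: "DD k * mb k \<doteq> mb k * DD k * Ji k + e * G" "G * db k \<doteq> DD k * C k"
    by auto
  note n = Suc.prems
  have e: "x * (e * y) = e * (x * y)" for x y
    using mult_assoc_rule3[OF e_central, of x y] by simp
  have JiM: "Ji k * mb (Suc k) = mb (Suc k) * Ji k" and JiD: "Ji k * dd (Suc k) = dd (Suc k) * Ji k"
    and JD: "J k * dd (Suc k) = dd (Suc k) * J k" and CD: "C k * dd (Suc k) = dd (Suc k) * C k"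
    using n by (auto intro!: commute_JC r_mb r_dd)
  have rDD: "r k * DD k = DD k * r k"
    using n r_DD by simp
  have rdd: "r k * dd (Suc k) = dd k * s k"
    using n by (simp add: dd_Suc mult.assoc rs')
  \<comment> \<open>The old remainder is carried past the last Delta; the second summand is the
    constant term created by the exchange with that Delta itself.\<close>
  define G' where "G' = r k * G * dd (Suc k) * s k + DD k * Ji k * s k"
  have 1: "dd k * mb (Suc k) \<doteq> mb (Suc k) * dd k * s k * s k + e * Ji k * s k"
  proof -
    have "dd k * mb (Suc k) = Ji k * (db k * mb (Suc k))"
      using n by (simp add: dd_eq mult.assoc)
    also have "\<dots> \<doteq> Ji k * (mb (Suc k) * db k * s k * s k + e * s k)"
      using n by (intro cong_intros perm_mb)
    also have "\<dots> = mb (Suc k) * dd k * s k * s k + e * Ji k * s k"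
      using n by (simp add: dd_eq distrib_left mult.assoc mult_assoc_rule3[OF JiM] e)
    finally show ?thesis .
  qed
  \<comment> \<open>The factors left behind by the two exchanges combine into the inverse
    Jucys-Murphy element of the next index.\<close>
  have lead: "r k * (Ji k * (s k * (dd k * (s k * s k)))) = dd k * Ji (Suc k)"
  proof -
    have "r k * (Ji k * (s k * (dd k * (s k * s k)))) = r k * ((Ji k * dd (Suc k)) * s k)"
      by (simp add: dd_Suc mult.assoc)
    also have "\<dots> = (r k * dd (Suc k)) * (Ji k * s k)"
      by (simp add: JiD mult.assoc)
    finally show ?thesis by (simp add: rdd Ji_Suc mult.assoc)
  qed
  have "DD (Suc k) * mb (Suc k) = DD k * (dd k * mb (Suc k))"
    by (simp add: mult.assoc)
  also have "\<dots> \<doteq> DD k * (mb (Suc k) * dd k * s k * s k + e * Ji k * s k)"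
    by (intro cong_intros 1)
  also have "\<dots> = r k * (DD k * mb k) * s k * dd k * s k * s k + e * (DD k * Ji k * s k)"
    by (simp add: mb_Suc distrib_left mult.assoc mult_assoc_rule3[OF rDD] e)
  also have "\<dots> \<doteq> r k * (mb k * DD k * Ji k + e * G) * s k * dd k * s k * s k + e * (DD k * Ji k * s k)"
    by (intro cong_intros G)
  also have "\<dots> = r k * mb k * DD k * (Ji k * (s k * (dd k * (s k * s k)))) + e * G'"
    by (simp add: G'_def dd_Suc distrib_left distrib_right mult.assoc e)
  also have "r k * mb k * DD k * (Ji k * (s k * (dd k * (s k * s k)))) =
      mb (Suc k) * DD k * (r k * (Ji k * (s k * (dd k * (s k * s k)))))"
    using n by (simp add: mb_Suc mult.assoc mult_assoc_rule3[OF rDD, symmetric] sr')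
  also have "\<dots> = mb (Suc k) * DD (Suc k) * Ji (Suc k)"
    by (simp add: lead mult.assoc)
  finally have main: "DD (Suc k) * mb (Suc k) \<doteq> mb (Suc k) * DD (Suc k) * Ji (Suc k) + e * G'" .
  \<comment> \<open>The hypothesis evaluates G only directly in front of \<open>db k\<close>, so
    \<open>dd (Suc k)\<close> has to be moved out from between them. Here the relations of D enter,
    through the reflection equation.\<close>
  have comm: "dd (Suc k) * db k \<doteq> db k * dd (Suc k)"
  proof -
    have "dd (Suc k) * db k = J k * (s k * dd k * s k * dd k)"
      using n mult_assoc_rule3[OF JD, of "dd k"] by (simp add: db_eq dd_Suc mult.assoc)
    also have "\<dots> \<doteq> J k * (dd k * s k * dd k * s k)"
      using n by (intro cong_intros dd_reflection)
    also have "\<dots> = db k * dd (Suc k)"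
      using n by (simp add: db_eq dd_Suc mult.assoc)
    finally show ?thesis .
  qed
  have "G' * db (Suc k) = r k * G * (dd (Suc k) * db k) * s k + DD (Suc k) * s k"
    using n by (simp add: G'_def db_Suc dd_eq distrib_right mult.assoc sr')
  also have "\<dots> \<doteq> r k * G * (db k * dd (Suc k)) * s k + DD (Suc k) * s k"
    by (intro cong_intros comm)
  also have "\<dots> = r k * (G * db k) * dd (Suc k) * s k + DD (Suc k) * s k"
    by (simp add: mult.assoc)
  also have "\<dots> \<doteq> r k * (DD k * C k) * dd (Suc k) * s k + DD (Suc k) * s k"
    by (intro cong_intros G)
  also have "\<dots> = DD k * (r k * dd (Suc k)) * C k * s k + DD (Suc k) * s k"
    by (simp add: mult.assoc mult_assoc_rule3[OF rDD] mult_assoc_rule3[OF CD])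
  also have "\<dots> = DD (Suc k) * C (Suc k)"
    by (simp add: rdd distrib_left mult.assoc)
  finally have "G' * db (Suc k) \<doteq> DD (Suc k) * C (Suc k)" .
  with main show ?case by blast
qed

text \<open>The factor \<open>Ji k\<close> left by the exchange turns \<open>db k\<close> into
  \<open>dd k\<close>; this is why Delta and not the overlined D forms the ordered product.\<close>

lemma product_normal_form:
  assumes "e = 0" "Suc k \<le> n"
  shows "MM k * DD k * (mb k * db k) \<doteq> MM (Suc k) * DD (Suc k)"
proof -
  obtain G where "DD k * mb k \<doteq> mb k * DD k * Ji k + e * G"
    using DD_mb[of k] assms by auto
  then have "MM k * (DD k * mb k) * db k \<doteq> MM k * (mb k * DD k * Ji k) * db k"
    using assms by (auto intro: cong_mult[OF cong_mult])
  then show ?thesis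
    using assms by (simp add: mult.assoc dd_eq)
qed

lemma wick:
  assumes "e = 1" "Suc k \<le> n"
  shows "MM k * DD k * (mb k * db k) \<doteq> MM (Suc k) * DD (Suc k) + MM k * DD k * C k"
proof -
  obtain G where G: "DD k * mb k \<doteq> mb k * DD k * Ji k + e * G" "G * db k \<doteq> DD k * C k"
    using DD_mb[of k] assms by auto
  have "MM k * DD k * (mb k * db k) = MM k * (DD k * mb k) * db k"
    by (simp add: mult.assoc)
  also have "\<dots> \<doteq> MM k * (mb k * DD k * Ji k + e * G) * db k"
    by (intro cong_intros G)
  also have "\<dots> = MM (Suc k) * DD (Suc k) + MM k * (G * db k)"
    using assms by (simp add: mult.assoc distrib_left distrib_right dd_eq)
  also have "\<dots> \<doteq> MM (Suc k) * DD (Suc k) + MM k * (DD k * C k)"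
    by (intro cong_intros G)
  finally show ?thesis by (simp add: mult.assoc)
qed

end

text \<open>\<open>rho\<close> and \<open>tau\<close> are the relations of \<open>\<M>(R)\<close> and \<open>\<D>(R\<^sup>-\<^sup>1)\<close>. The third strand is needed to move
  \<open>D\<close> or \<open>M\<close> past a relation on two strands.\<close>

locale hom_perm_rep = perm_rep +
  assumes n3: "n = 3" and e0: "e = 0"
begin

abbreviation (input) "rho \<equiv> r 0 * m * r 0 * m - m * r 0 * m * r 0"
abbreviation (input) "tau \<equiv> s 0 * d * s 0 * d - d * s 0 * d * s 0"

lemma r1: "r 1 * m = m * r 1" "r 1 * d = d * r 1" "s 1 * m = m * s 1" "s 1 * d = d * s 1"
  using rm[of 1] rd[of 1] commute_inverse[of 1] n3 by simp_all

lemmas r1' = r1[THEN mult_assoc_rule3]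

lemma inv01: "r 0 * s 0 = 1" "s 0 * r 0 = 1" "r 1 * s 1 = 1" "s 1 * r 1 = 1"
  using rs[of 0] rs[of 1] sr[of 0] sr[of 1] n3 by simp_all

lemmas inv01' = inv01[THEN mult_assoc_rule, simplified mult_1_left]

lemma braid01:
  "r 0 * (r 1 * r 0) = r 1 * (r 0 * r 1)"
  "s 0 * (s 1 * s 0) = s 1 * (s 0 * s 1)"
  "r 1 * (r 0 * s 1) = s 0 * (r 1 * r 0)"
  "r 1 * (s 0 * s 1) = s 0 * (s 1 * r 0)"
  "r 0 * (s 1 * s 0) = s 1 * (s 0 * r 1)"
  using braid[of 0] braid_s[of 0] braid_srr[of 0] braid_rss'[of 0] braid_rss[of 0] n3 by simp_all

lemmas braid01' = braid01[THEN mult_assoc_rule33]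

lemma mb12: "mb 1 = r 0 * (m * s 0)" "mb 2 = r 1 * (r 0 * (m * (s 0 * s 1)))"
  by (simp_all add: mb_Suc mb_0 numeral_2_eq_2 mult.assoc)

lemma s0_mb2: "s 0 * mb 2 = mb 2 * s 0"
  using s_mb[of 0 2] n3 by simp

lemma d_mb1: "d * mb 1 \<doteq> mb 1 * d * s 0 * s 0"
  using perm_mb[of 0] n3 by (simp add: db_0 e0)

text \<open>\<open>mb 2\<close> is \<open>mb 1\<close> conjugated by \<open>r 1\<close>, which
  commutes with d. The scalar factor is \<open>s 1 * s 1\<close> conjugated by
  \<open>s 0\<close>.\<close>

lemma d_mb2: "d * mb 2 \<doteq> mb 2 * d * (s 0 * s 1 * s 1 * r 0)"
proof -
  have mb2: "mb 2 = r 1 * (mb 1 * s 1)"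
    by (simp only: mb12 mult.assoc)
  have "d * mb 2 = r 1 * (d * mb 1) * s 1"
    by (simp only: mb2 mult.assoc r1')
  also have "\<dots> \<doteq> r 1 * (mb 1 * d * s 0 * s 0) * s 1"
    by (intro cong_mult[OF cong_mult] cong_refl d_mb1)
  also have "\<dots> = mb 2 * d * (r 1 * s 0 * s 0 * s 1)"
    by (simp only: mb2 mult.assoc r1' inv01')
  \<comment> \<open>After inserting \<open>s 1 * r 1\<close> in the middle, the braid relation
    applies to both halves.\<close>
  also have "r 1 * s 0 * s 0 * s 1 = r 1 * (s 0 * (s 1 * (r 1 * (s 0 * s 1))))"
    by (simp only: mult.assoc inv01')
  also have "\<dots> = s 0 * s 1 * s 1 * r 0"
    by (simp only: mult.assoc braid01' inv01' braid01 inv01)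
  finally show ?thesis .
qed

text \<open>In the first identity the braid lets the first strand encircle the other two, hence it
  commutes with their crossing. In the second, both sides reduce to
  \<open>s 1 * (s 0 * (s 0 * s 1))\<close>.\<close>

lemma s01_commute: "r 1 * (s 0 * (s 1 * (s 1 * s 0))) = s 0 * (s 1 * (s 1 * (s 0 * r 1)))"
  "r 0 * (s 1 * (s 1 * (s 0 * (s 1 * s 1)))) = s 1 * (s 1 * (s 0 * (s 1 * (s 1 * r 0))))"
proof -
  have "s 0 * (s 1 * (s 1 * (s 0 * r 1))) = s 0 * (s 1 * (r 0 * (s 1 * s 0)))"
    by (simp only: braid01)
  also have "\<dots> = r 1 * (s 0 * (s 1 * (s 1 * s 0)))"
    by (simp only: braid01')
  finally show "r 1 * (s 0 * (s 1 * (s 1 * s 0))) = s 0 * (s 1 * (s 1 * (s 0 * r 1)))" by simp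
  have "s 1 * (s 1 * (s 0 * (s 1 * (s 1 * r 0)))) = s 1 * (s 0 * (s 1 * (s 0 * (s 1 * r 0))))"
    by (simp only: braid01'[symmetric])
  also have "\<dots> = s 1 * (s 0 * (s 0 * s 1))"
    by (simp only: braid01(4)[symmetric] inv01')
  finally have 1: "s 1 * (s 1 * (s 0 * (s 1 * (s 1 * r 0)))) = s 1 * (s 0 * (s 0 * s 1))" .
  have "r 0 * (s 1 * (s 1 * (s 0 * (s 1 * s 1)))) = r 0 * (s 1 * (s 0 * (s 1 * (s 0 * s 1))))"
    by (simp only: braid01'(2)[symmetric])
  also have "\<dots> = s 1 * (s 0 * (s 0 * s 1))"
    by (simp only: braid01'(5) inv01')
  also note 1[symmetric]
  finally show "r 0 * (s 1 * (s 1 * (s 0 * (s 1 * s 1)))) = s 1 * (s 1 * (s 0 * (s 1 * (s 1 * r 0))))" .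
qed

text \<open>Multiplied by \<open>r 0 * r 1\<close>, rho becomes, up to an invertible right factor,
  the commutator of \<open>r 1\<close> with \<open>mb 1 * mb 2\<close>. Moving d past this product
  costs the factor z, and z commutes with \<open>r 1\<close>.\<close>

lemma d_rho: "\<exists>w. d * r 0 * r 1 * rho \<doteq> r 0 * r 1 * rho * w"
proof -
  define z where "z = s 0 * (s 1 * (s 1 * s 0))"
  define rho' where "rho' = r 1 * mb 1 * mb 2 - mb 1 * mb 2 * r 1"
  have z: "z * r 1 = r 1 * z"
    using s01_commute(1) by (simp only: z_def mult.assoc)
  have g1: "r 0 * (r 1 * (r 0 * (m * (r 0 * (m * (s 0 * (s 1 * s 0))))))) = r 1 * mb 1 * mb 2"
  proof -
    have "r 0 * (r 1 * (r 0 * (m * (r 0 * (m * (s 0 * (s 1 * s 0))))))) =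
        r 1 * (r 0 * (r 1 * (m * (r 0 * (m * (s 1 * (s 0 * s 1)))))))"
      by (simp only: braid01'(1) braid01(2))
    also have "\<dots> = r 1 * (r 0 * (m * (r 1 * (r 0 * (s 1 * (m * (s 0 * s 1)))))))"
      by (simp only: r1'(1) r1'(3)[symmetric])
    finally show ?thesis
      by (simp only: mb12 mult.assoc braid01'(3))
  qed
  have g2: "r 0 * (r 1 * (m * (r 0 * (m * (r 0 * (s 0 * (s 1 * s 0))))))) = mb 1 * mb 2 * r 1"
  proof -
    have "r 0 * (r 1 * (m * (r 0 * (m * (r 0 * (s 0 * (s 1 * s 0))))))) =
        r 0 * (m * (r 1 * (r 0 * (s 1 * (m * s 0)))))"
      by (simp only: r1'(1) r1'(3)[symmetric] inv01')
    also have "\<dots> = r 0 * (m * (s 0 * (r 1 * (r 0 * (m * s 0)))))"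
      by (simp only: braid01'(3))
    finally show ?thesis
      by (simp only: mb12 mult.assoc inv01 mult_1_right)
  qed
  have rho': "r 0 * r 1 * rho * (s 0 * (s 1 * s 0)) = rho'"
    using g1 g2 by (simp only: rho'_def left_diff_distrib right_diff_distrib mult.assoc)
  have 1: "d * (mb 1 * mb 2) \<doteq> mb 1 * mb 2 * d * z"
  proof -
    have "d * (mb 1 * mb 2) = (d * mb 1) * mb 2"
      by (simp only: mult.assoc)
    also have "\<dots> \<doteq> (mb 1 * d * s 0 * s 0) * mb 2"
      by (intro cong_mult cong_refl d_mb1)
    also have "\<dots> = mb 1 * (d * mb 2) * (s 0 * s 0)"
      by (simp only: mult.assoc s0_mb2 mult_assoc_rule3[OF s0_mb2])
    also have "\<dots> \<doteq> mb 1 * (mb 2 * d * (s 0 * s 1 * s 1 * r 0)) * (s 0 * s 0)"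
      by (intro cong_mult[OF cong_mult] cong_refl d_mb2)
    also have "\<dots> = mb 1 * mb 2 * d * z"
      by (simp only: z_def mult.assoc inv01')
    finally show ?thesis .
  qed
  have "d * rho' = r 1 * (d * (mb 1 * mb 2)) - d * (mb 1 * mb 2) * r 1"
    by (simp only: rho'_def right_diff_distrib mult.assoc r1')
  also have "\<dots> \<doteq> r 1 * (mb 1 * mb 2 * d * z) - (mb 1 * mb 2 * d * z) * r 1"
    by (intro cong_diff cong_mult cong_refl 1)
  also have "\<dots> = rho' * (d * z)"
    by (simp only: rho'_def left_diff_distrib mult.assoc r1' z)
  finally have 2: "d * rho' \<doteq> rho' * (d * z)" .
  have "d * rho' * (r 0 * (r 1 * r 0)) = d * r 0 * r 1 * rho"
    by (simp only: rho'[symmetric] mult.assoc inv01 inv01' mult_1_right)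
  moreover have "d * rho' * (r 0 * (r 1 * r 0)) \<doteq> rho' * (d * z) * (r 0 * (r 1 * r 0))"
    by (intro cong_mult cong_refl 2)
  moreover have "rho' * (d * z) * (r 0 * (r 1 * r 0)) =
      r 0 * r 1 * rho * (s 0 * (s 1 * s 0) * (d * z) * (r 0 * (r 1 * r 0)))"
    by (simp only: rho'[symmetric] mult.assoc)
  ultimately show ?thesis by metis
qed

text \<open>The mirror image of \<open>d_rho\<close>, where \<open>r 1 * r 0 * m\<close> is
  \<open>mb 2\<close> up to an invertible right factor. The right factor of the result is kept
  explicit because \<open>rel_D_M\<close> relies on its being free of d and m.\<close>

lemma tau_m: "tau * r 1 * r 0 * m \<doteq>
  mb 2 * tau * (s 1 * (s 1 * (s 0 * (s 1 * (s 1 * (r 0 * (r 1 * r 0)))))))"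
proof -
  have 1: "d * s 0 * d * s 0 * mb 2 \<doteq> mb 2 * (d * s 0 * d * s 0) * (r 0 * (s 1 * (s 1 * (s 0 * (s 1 * s 1)))))"
  proof -
    have "d * s 0 * d * s 0 * mb 2 = d * s 0 * (d * mb 2) * s 0"
      by (simp add: mult.assoc s0_mb2)
    also have "\<dots> \<doteq> d * s 0 * (mb 2 * d * (s 0 * s 1 * s 1 * r 0)) * s 0"
      by (intro cong_mult[OF cong_mult] cong_refl d_mb2)
    also have "\<dots> = (d * mb 2) * (s 0 * (d * (s 0 * (s 1 * s 1))))"
      by (simp only: mult.assoc mult_assoc_rule3[OF s0_mb2] inv01 mult_1_right)
    also have "\<dots> \<doteq> (mb 2 * d * (s 0 * s 1 * s 1 * r 0)) * (s 0 * (d * (s 0 * (s 1 * s 1))))"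
      by (intro cong_mult cong_refl d_mb2)
    also have "\<dots> = mb 2 * (d * s 0 * d * s 0) * (r 0 * (s 1 * (s 1 * (s 0 * (s 1 * s 1)))))"
      by (simp only: mult.assoc inv01' r1')
    finally show ?thesis .
  qed
  have 2: "s 0 * d * s 0 * d * mb 2 \<doteq> mb 2 * (s 0 * d * s 0 * d) * (s 1 * (s 1 * (s 0 * (s 1 * (s 1 * r 0)))))"
  proof -
    have "s 0 * d * s 0 * d * mb 2 = s 0 * d * s 0 * (d * mb 2)"
      by (simp add: mult.assoc)
    also have "\<dots> \<doteq> s 0 * d * s 0 * (mb 2 * d * (s 0 * s 1 * s 1 * r 0))"
      by (intro cong_mult cong_refl d_mb2)
    also have "\<dots> = s 0 * (d * mb 2) * (s 0 * (d * (s 0 * (s 1 * (s 1 * r 0)))))"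
      by (simp only: mult.assoc mult_assoc_rule3[OF s0_mb2])
    also have "\<dots> \<doteq> s 0 * (mb 2 * d * (s 0 * s 1 * s 1 * r 0)) * (s 0 * (d * (s 0 * (s 1 * (s 1 * r 0)))))"
      by (intro cong_mult[OF cong_mult] cong_refl d_mb2)
    also have "\<dots> = mb 2 * (s 0 * d * s 0 * d) * (s 1 * (s 1 * (s 0 * (s 1 * (s 1 * r 0)))))"
      by (simp only: mult.assoc inv01' r1' mult_assoc_rule3[OF s0_mb2])
    finally show ?thesis .
  qed
  define w where "w = s 1 * (s 1 * (s 0 * (s 1 * (s 1 * r 0))))"
  have "tau * mb 2 \<doteq> mb 2 * tau * w"
    using cong_diff[OF 2 1[unfolded s01_commute(2)]]
    by (simp only: left_diff_distrib right_diff_distrib mult.assoc w_def)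
  then have "tau * mb 2 * (r 1 * r 0) \<doteq> mb 2 * tau * w * (r 1 * r 0)"
    by (rule cong_mult[OF _ cong_refl])
  moreover have "tau * mb 2 * (r 1 * r 0) = tau * r 1 * r 0 * m"
    by (simp only: mb12 mult.assoc inv01' inv01 mult_1_right)
  ultimately show ?thesis
    by (simp only: w_def mult.assoc)
qed

end

section \<open>The ring of block diagonal matrices indexed by words\<close>

text \<open>The matrices on all tensor powers are collected in one type, so that they form a ring in the
  sense of type classes; \<open>blk n A\<close> and \<open>ub n A\<close> extend a matrix on the \<open>n\<close>-th tensor power by
  zero and by the identity, respectively.\<close>

typedef (overloaded) ('n, 'a::zero) bmat =
  "{A :: 'n list \<Rightarrow> 'n list \<Rightarrow> 'a. \<forall>I J. length I \<noteq> length J \<longrightarrow> A I J = 0}"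
  morphisms ent Bmat
  by (rule exI[of _ "\<lambda>I J. 0"]) simp

setup_lifting type_definition_bmat

lemma bmat_eqI: "(\<And>I J. length I = length J \<Longrightarrow> ent A I J = ent B I J) \<Longrightarrow> A = B"
  by transfer (metis (full_types) ext)

lemma finite_words [simp]: "finite {K :: 'n::finite list. length K = n}"
  using finite_lists_length_eq[of "UNIV :: 'n set" n] by simp

instantiation bmat :: (finite, ring_1) ring_1
begin

lift_definition zero_bmat :: "('a, 'b) bmat" is "\<lambda>I J. 0" by simp
lift_definition one_bmat :: "('a, 'b) bmat" is "\<lambda>I J. if I = J then 1 else 0" by auto
lift_definition plus_bmat :: "('a, 'b) bmat \<Rightarrow> ('a, 'b) bmat \<Rightarrow> ('a, 'b) bmat"
  is "\<lambda>A B I J. A I J + B I J" by simp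
lift_definition minus_bmat :: "('a, 'b) bmat \<Rightarrow> ('a, 'b) bmat \<Rightarrow> ('a, 'b) bmat"
  is "\<lambda>A B I J. A I J - B I J" by simp
lift_definition uminus_bmat :: "('a, 'b) bmat \<Rightarrow> ('a, 'b) bmat"
  is "\<lambda>A I J. - A I J" by simp
lift_definition times_bmat :: "('a, 'b) bmat \<Rightarrow> ('a, 'b) bmat \<Rightarrow> ('a, 'b) bmat"
  is "\<lambda>A B I J. \<Sum>K | length K = length I. A I K * B K J"
  by (auto intro!: sum.neutral)

instance
proof
  fix A B C :: "('a, 'b) bmat"
  show "A * B * C = A * (B * C)"
  proof (rule bmat_eqI)
    fix I J :: "'a list"
    let ?K = "{K :: 'a list. length K = length I}"
    have "ent (A * B * C) I J = (\<Sum>K\<in>?K. \<Sum>L\<in>?K. ent A I L * ent B L K * ent C K J)"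
      by (simp add: times_bmat.rep_eq sum_distrib_right)
    also have "\<dots> = (\<Sum>L\<in>?K. \<Sum>K\<in>?K. ent A I L * (ent B L K * ent C K J))"
      by (subst sum.swap) (simp add: mult.assoc)
    also have "\<dots> = ent (A * (B * C)) I J"
      by (simp add: times_bmat.rep_eq sum_distrib_left)
    finally show "ent (A * B * C) I J = ent (A * (B * C)) I J" .
  qed
  show "1 * A = A"
  proof (rule bmat_eqI)
    fix I J :: "'a list"
    have "ent (1 * A) I J = (\<Sum>K | length K = length I. if K = I then ent A K J else 0)"
      unfolding times_bmat.rep_eq one_bmat.rep_eq by (rule sum.cong) auto
    then show "ent (1 * A) I J = ent A I J" by (simp add: sum.delta)
  qed
  show "A * 1 = A"
  proof (rule bmat_eqI)
    fix I J :: "'a list" assume "length I = length J"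
    moreover have "ent (A * 1) I J = (\<Sum>K | length K = length I. if K = J then ent A I K else 0)"
      unfolding times_bmat.rep_eq one_bmat.rep_eq by (rule sum.cong) auto
    ultimately show "ent (A * 1) I J = ent A I J" by (simp add: sum.delta)
  qed
  show "(0 :: ('a, 'b) bmat) \<noteq> 1"
  proof
    assume "(0 :: ('a, 'b) bmat) = 1"
    then have "ent (0 :: ('a, 'b) bmat) [] [] = ent (1 :: ('a, 'b) bmat) [] []" by simp
    then show False by (simp add: zero_bmat.rep_eq one_bmat.rep_eq)
  qed
qed (transfer; simp add: algebra_simps sum.distrib fun_eq_iff)+

end

lemmas ent_simps [simp] = zero_bmat.rep_eq one_bmat.rep_eq plus_bmat.rep_eq minus_bmat.rep_eq
  uminus_bmat.rep_eq

lemma ent_mult: "ent (A * B) I J = (\<Sum>K | length K = length I. ent A I K * ent B K J)"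
  by (simp add: times_bmat.rep_eq)

lift_definition blk :: "nat \<Rightarrow> ('n, 'a::zero) tmat \<Rightarrow> ('n, 'a) bmat"
  is "\<lambda>n A I J. if length I = n \<and> length J = n then A I J else 0" by auto

lift_definition ub :: "nat \<Rightarrow> ('n, 'a::zero_neq_one) tmat \<Rightarrow> ('n, 'a) bmat"
  is "\<lambda>n A I J. if length I = n \<and> length J = n then A I J else if I = J then 1 else 0" by auto

lemma ent_blk [simp]: "length I = n \<Longrightarrow> length J = n \<Longrightarrow> ent (blk n A) I J = A I J"
  and ent_ub [simp]: "length I = n \<Longrightarrow> length J = n \<Longrightarrow> ent (ub n A) I J = A I J"
  by (simp_all add: blk.rep_eq ub.rep_eq)

lemma ent_neq: "length I \<noteq> length J \<Longrightarrow> ent A I J = 0"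
  by transfer simp

lemma blk_cong: "meq n A B \<Longrightarrow> blk n A = blk n B"
  by transfer (auto simp: meq_def fun_eq_iff)

lemma ub_cong: "meq n A B \<Longrightarrow> ub n A = ub n B"
  by transfer (auto simp: meq_def fun_eq_iff)

lemma ub_mid [simp]: "ub n mid = 1"
  by transfer (auto simp: mid_def fun_eq_iff)

lemma ent_mult_1 [simp]:
  fixes A :: "('n::finite, 'a::ring_1) bmat"
  shows "(\<Sum>K | length K = length J. (if I = K then 1 else 0) * ent A K J) = ent A I J"
    "(\<Sum>K | length K = length I. ent A I K * (if K = J then 1 else 0)) = ent A I J"
proof -
  have "(\<Sum>K | length K = length J. (if I = K then 1 else 0) * ent A K J) =
      (\<Sum>K | length K = length J. if K = I then ent A K J else 0)"
    by (rule sum.cong) auto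
  then show "(\<Sum>K | length K = length J. (if I = K then 1 else 0) * ent A K J) = ent A I J"
    by (auto simp: sum.delta ent_neq)
  show "(\<Sum>K | length K = length I. ent A I K * (if K = J then 1 else 0)) = ent A I J"
    using ent_mult[of A 1 I J] by simp
qed

text \<open>\<open>ub\<close> preserves units and inverses, \<open>blk\<close> preserves sums. Mixed
  products agree with pure ones as soon as one factor is a \<open>blk\<close>, since this
  annihilates all other blocks.\<close>

lemma ub_mult_blk: "ub n A * blk n B = blk n (mmul n A B)"
  and blk_mult_ub: "blk n A * ub n B = blk n (mmul n A B)"
  and blk_mult_blk: "blk n A * blk n B = blk n (mmul n A B)"
  and ub_mult_ub: "ub n A * ub n B = ub n (mmul n A B)"
  for A B :: "('n::finite, 'a::ring_1) tmat"
proof -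
  show "ub n A * blk n B = blk n (mmul n A B)"
    by (rule bmat_eqI) (auto simp: ent_mult mmul_def blk.rep_eq ub.rep_eq)
  show "blk n A * ub n B = blk n (mmul n A B)"
    by (rule bmat_eqI) (auto simp: ent_mult mmul_def blk.rep_eq ub.rep_eq)
  show "blk n A * blk n B = blk n (mmul n A B)"
    by (rule bmat_eqI) (auto simp: ent_mult mmul_def blk.rep_eq ub.rep_eq)
  show "ub n A * ub n B = ub n (mmul n A B)"
  proof (rule bmat_eqI)
    fix I J :: "'n list" assume l: "length I = length J"
    show "ent (ub n A * ub n B) I J = ent (ub n (mmul n A B)) I J"
    proof (cases "length I = n")
      case True
      then show ?thesis using l by (auto simp: ent_mult mmul_def ub.rep_eq)
    next
      case False
      then have "ent (ub n A * ub n B) I J = ent (1 * 1 :: ('n, 'a) bmat) I J"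
        unfolding ent_mult using l by (intro sum.cong) (auto simp: ub.rep_eq)
      then show ?thesis using l False by (simp add: ub.rep_eq)
    qed
  qed
qed

text \<open>Only the n-th block is tested, so that congruence modulo this ideal ignores the default
  values of \<open>blk\<close> and \<open>ub\<close> elsewhere.\<close>

definition block_ideal :: "nat \<Rightarrow> 'a::ring_1 set \<Rightarrow> ('n::finite, 'a) bmat set" where
  "block_ideal n P = {A. \<forall>I J. length I = n \<longrightarrow> length J = n \<longrightarrow> ent A I J \<in> P}"

lemma two_sided_ideal_block:
  assumes "two_sided_ideal P"
  shows "two_sided_ideal (block_ideal n P :: ('n::finite, 'a::ring_1) bmat set)"
  unfolding two_sided_ideal_def[of "block_ideal n P :: ('n::finite, 'a) bmat set"]
  by (auto simp: block_ideal_def ent_mult intro!: two_sided_ideal_sum[OF assms] intro: two_sided_idealD[OF assms])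

lemma meq_refl [simp]: "meq n A A"
  and meq_sym: "meq n A B \<Longrightarrow> meq n B A"
  and meq_trans [trans]: "meq n A B \<Longrightarrow> meq n B C \<Longrightarrow> meq n A C"
  by (simp_all add: meq_def)

lemma mmul_cong: "meq n A A' \<Longrightarrow> meq n B B' \<Longrightarrow> meq n (mmul n A B) (mmul n A' B')"
  unfolding meq_def mmul_def by (auto intro: sum.cong)

lemma meq_iff_ub: "meq n A B \<longleftrightarrow> ub n A = ub n B"
proof
  assume "ub n A = ub n B"
  then have "ent (ub n A) I J = ent (ub n B) I J" for I J by simp
  then show "meq n A B" by (simp add: meq_def ub.rep_eq split: if_splits) metis
qed (rule ub_cong)

lemma mmul_mid: "meq n (mmul n mid A) A" "meq n (mmul n A mid) A"
  for A :: "('n::finite, 'a::ring_1) tmat"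
  by (simp_all add: meq_iff_ub flip: ub_mult_ub)

text \<open>\<open>minv\<close> selects some inverse; the usual cancellation in the ring of block
  matrices shows that its n-th block is determined.\<close>

lemma meq_minv:
  fixes A B :: "('n::finite, complex) tmat"
  assumes "meq n (mmul n A B) mid" "meq n (mmul n B A) mid"
  shows "meq n (minv n A) B"
proof -
  have "meq n (mmul n A (minv n A)) mid \<and> meq n (mmul n (minv n A) A) mid"
    unfolding minv_def by (rule someI[of _ B]) (use assms in simp)
  then have 1: "ub n (minv n A) * ub n A = 1" and 2: "ub n A * ub n B = 1"
    using assms by (simp_all add: meq_iff_ub flip: ub_mult_ub)
  have "ub n (minv n A) = ub n (minv n A) * (ub n A * ub n B)" by (simp add: 2)
  also have "\<dots> = ub n B" by (simp add: 1 flip: mult.assoc)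
  finally show ?thesis by (simp add: meq_iff_ub)
qed

section \<open>Operators on consecutive tensor factors\<close>

text \<open>S on the factors p + 1, ..., p + m and the identity on the others. It subsumes
  \<open>opn\<close> and \<open>emb1\<close>, so that relations on two or three factors can be
  transported to larger tensor powers.\<close>

definition place :: "nat \<Rightarrow> nat \<Rightarrow> ('n, 'a::zero) tmat \<Rightarrow> ('n, 'a) tmat" where
  "place p m S I J = (if take p I = take p J \<and> drop (p + m) I = drop (p + m) J
     then S (take m (drop p I)) (take m (drop p J)) else 0)"

lemma split3: "p + m \<le> length I \<Longrightarrow> I = take p I @ take m (drop p I) @ drop (p + m) I"
  by (metis append_take_drop_id drop_drop add.commute)

lemma place_mid: "p + m \<le> n \<Longrightarrow> meq n (place p m mid) mid"
  unfolding meq_def place_def mid_def by (metis split3)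

lemma place_cong: "p + m \<le> n \<Longrightarrow> meq m S T \<Longrightarrow> meq n (place p m S) (place p m T)"
  unfolding meq_def place_def by auto

lemma place_mmul:
  fixes S T :: "('n::finite, 'a::semiring_0) tmat"
  assumes "p + m \<le> n"
  shows "meq n (mmul n (place p m S) (place p m T)) (place p m (mmul m S T))"
  unfolding meq_def
proof (intro allI impI)
  fix I J :: "'n list" assume l: "length I = n" "length J = n"
  \<comment> \<open>The intermediate words that contribute agree with I outside the window of length
    m; \<open>?g\<close> parametrises them.\<close>
  let ?g = "\<lambda>K. take p I @ K @ drop (p + m) I"
  have inj: "inj_on ?g {K. length K = m}" by (auto simp: inj_on_def)
  have "mmul n (place p m S) (place p m T) I J =
      (\<Sum>K\<in>?g ` {K. length K = m}. place p m S I K * place p m T K J)"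
    unfolding mmul_def
  proof (rule sum.mono_neutral_right)
    show "?g ` {K. length K = m} \<subseteq> {K. length K = n}" using l assms by auto
    show "\<forall>K\<in>{K. length K = n} - ?g ` {K. length K = m}. place p m S I K * place p m T K J = 0"
    proof
      fix K assume K: "K \<in> {K. length K = n} - ?g ` {K. length K = m}"
      have "take p I \<noteq> take p K \<or> drop (p + m) I \<noteq> drop (p + m) K"
      proof (rule ccontr)
        assume "\<not> ?thesis"
        then have "K = ?g (take m (drop p K))"
          using split3[of p m K] K assms by simp
        then show False using K assms by auto
      qed
      then show "place p m S I K * place p m T K J = 0" by (auto simp: place_def)
    qed
  qed simp
  also have "\<dots> = (\<Sum>K | length K = m. place p m S I (?g K) * place p m T (?g K) J)"
    by (simp add: sum.reindex[OF inj])
  also have "\<dots> = place p m (mmul m S T) I J"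
  proof -
    have g: "take p (?g K) = take p I" "drop (p + m) (?g K) = drop (p + m) I"
      "take m (drop p (?g K)) = K" if "length K = m" for K
      using l assms that by simp_all
    have "place p m S I (?g K) = S (take m (drop p I)) K"
      "place p m T (?g K) J = (if take p I = take p J \<and> drop (p + m) I = drop (p + m) J
        then T K (take m (drop p J)) else 0)" if "length K = m" for K
      unfolding place_def g[OF that] by simp_all
    then have "(\<Sum>K | length K = m. place p m S I (?g K) * place p m T (?g K) J) =
        (\<Sum>K | length K = m. S (take m (drop p I)) K *
          (if take p I = take p J \<and> drop (p + m) I = drop (p + m) J
           then T K (take m (drop p J)) else 0))"
      by (intro sum.cong) auto
    also have "\<dots> = place p m (mmul m S T) I J"
      by (auto simp: place_def mmul_def intro: sum.neutral)
    finally show ?thesis .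
  qed
  finally show "mmul n (place p m S) (place p m T) I J = place p m (mmul m S T) I J" .
qed

lemma place_commute:
  fixes S T :: "('n::finite, 'a::semiring_0) tmat"
  assumes "p + m \<le> p'" "p' + m' \<le> n" and comm: "\<And>I J I' J'. S I J * T I' J' = T I' J' * S I J"
  shows "meq n (mmul n (place p m S) (place p' m' T)) (mmul n (place p' m' T) (place p m S))"
  unfolding meq_def
proof (intro allI impI)
  fix I J :: "'n list" assume l: "length I = n" "length J = n"
  \<comment> \<open>For disjoint windows a single intermediate word contributes to each product: the
    cut at p + m separates the part on which the first operator has acted from the part still to be
    changed.\<close>
  let ?K = "take (p + m) J @ drop (p + m) I" and ?L = "take (p + m) I @ drop (p + m) J"
  have one: "sum f {K. length K = n} = f L"
    if "length L = n" "\<And>K. length K = n \<Longrightarrow> K \<noteq> L \<Longrightarrow> f K = 0" for f :: "'n list \<Rightarrow> 'a" and L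
    using that by (subst sum.mono_neutral_right[of _ "{L}"]) auto
  have "mmul n (place p m S) (place p' m' T) I J = place p m S I ?K * place p' m' T ?K J"
    unfolding mmul_def
  proof (rule one)
    fix K :: "'n list" assume K: "length K = n" "K \<noteq> ?K"
    show "place p m S I K * place p' m' T K J = 0"
    proof (rule ccontr)
      assume "\<not> ?thesis"
      then have "drop (p + m) K = drop (p + m) I" "take p' K = take p' J"
        by (auto simp: place_def split: if_splits)
      then have "take (p + m) K = take (p + m) J" "drop (p + m) K = drop (p + m) I"
        using assms(1) by (metis min.absorb1 take_take)+
      then show False using K by (metis append_take_drop_id)
    qed
  qed (use l assms in simp)
  also have "\<dots> = place p' m' T I ?L * place p m S ?L J"
  proof -
    have 1: "take p ?K = take p J" "drop (p + m) ?K = drop (p + m) I"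
      "take m (drop p ?K) = take m (drop p J)"
      using l assms by (simp_all add: take_drop)
    have 2: "take p ?L = take p I" "drop (p + m) ?L = drop (p + m) J"
      "take m (drop p ?L) = take m (drop p I)"
      using l assms by (simp_all add: take_drop)
    have 3: "drop (p' + m') ?K = drop (p' + m') I" "take m' (drop p' ?K) = take m' (drop p' I)"
      "drop (p' + m') ?L = drop (p' + m') J" "take m' (drop p' ?L) = take m' (drop p' J)"
      using l assms by simp_all
    have t: "take p' K = take (p + m) K @ take (p' - (p + m)) (drop (p + m) K)" for K :: "'n list"
      using take_add[of "p + m" "p' - (p + m)" K] assms(1) by simp
    have 4: "take p' I = take p' ?L \<longleftrightarrow> take (p' - (p + m)) (drop (p + m) I) = take (p' - (p + m)) (drop (p + m) J)"
      "take p' ?K = take p' J \<longleftrightarrow> take (p' - (p + m)) (drop (p + m) I) = take (p' - (p + m)) (drop (p + m) J)"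
      unfolding t[of I] t[of J] t[of ?K] t[of ?L] using l assms by auto
    show ?thesis
      unfolding place_def 1 2 3 4 by (auto simp: comm)
  qed
  also have "\<dots> = mmul n (place p' m' T) (place p m S) I J"
    unfolding mmul_def
  proof (rule one[symmetric])
    fix K :: "'n list" assume K: "length K = n" "K \<noteq> ?L"
    show "place p' m' T I K * place p m S K J = 0"
    proof (rule ccontr)
      assume "\<not> ?thesis"
      then have "drop (p + m) K = drop (p + m) J" "take p' I = take p' K"
        by (auto simp: place_def split: if_splits)
      then have "take (p + m) K = take (p + m) I" "drop (p + m) K = drop (p + m) J"
        using assms(1) by (metis min.absorb1 take_take)+
      then show False using K by (metis append_take_drop_id)
    qed
  qed (use l assms in simp)
  finally show "mmul n (place p m S) (place p' m' T) I J = mmul n (place p' m' T) (place p m S) I J" .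
qed

lemma place_opn:
  assumes "0 < i" "i < m" "p + m \<le> n"
  shows "meq n (opn n (p + i) A) (place p m (opn m i A))"
  unfolding meq_def
proof (intro allI impI)
  fix I J :: "'a list" assume l: "length I = n" "length J = n"
  have "(\<forall>j<n. j \<noteq> p + i - 1 \<and> j \<noteq> p + i \<longrightarrow> I ! j = J ! j) \<longleftrightarrow>
      take p I = take p J \<and> drop (p + m) I = drop (p + m) J \<and>
      (\<forall>j<m. j \<noteq> i - 1 \<and> j \<noteq> i \<longrightarrow> take m (drop p I) ! j = take m (drop p J) ! j)" (is "?l \<longleftrightarrow> ?r")
  proof
    assume ?l
    then show ?r using l assms by (auto simp: list_eq_iff_nth_eq)
  next
    assume r: ?r
    show ?l
    proof (intro allI impI)
      fix j assume j: "j < n" "j \<noteq> p + i - 1 \<and> j \<noteq> p + i"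
      consider "j < p" | "p \<le> j" "j < p + m" | "p + m \<le> j" by linarith
      then show "I ! j = J ! j"
      proof cases
        case 1
        then show ?thesis using r by (metis nth_take)
      next
        case 2
        then have "j - p < m" "j - p \<noteq> i - 1" "j - p \<noteq> i"
          using j assms(1) by arith+
        then have "take m (drop p I) ! (j - p) = take m (drop p J) ! (j - p)"
          using r by blast
        then show ?thesis using 2 l assms by simp
      next
        case 3
        then have "drop (p + m) I ! (j - (p + m)) = drop (p + m) J ! (j - (p + m))"
          using r by simp
        then show ?thesis using 3 l j by simp
      qed
    qed
  qed
  then show "opn n (p + i) A I J = place p m (opn m i A) I J"
    using l assms by (auto simp: opn_def place_def)
qed

lemma place_emb1:
  assumes "0 < m" "m \<le> n"
  shows "meq n (emb1 A) (place 0 m (emb1 A))"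
  unfolding meq_def
proof (intro allI impI)
  fix I J :: "'a list" assume l: "length I = n" "length J = n"
  obtain a I' b J' m' where *: "I = a # I'" "J = b # J'" "m = Suc m'"
    using l assms by (cases I; cases J; cases m) auto
  have "I' = J' \<longleftrightarrow> drop m' I' = drop m' J' \<and> take m' I' = take m' J'"
    by (metis append_take_drop_id)
  then show "emb1 A I J = place 0 m (emb1 A) I J"
    by (auto simp: * emb1_def place_def)
qed

lemma sum_words_Suc:
  "(\<Sum>K | length K = Suc n. f K) = (\<Sum>x\<in>UNIV. \<Sum>K | length K = n. f ((x :: 'n::finite) # K))"
proof -
  have "{K :: 'n list. length K = Suc n} = (\<lambda>(x, K). x # K) ` (UNIV \<times> {K. length K = n})"
    by (auto simp: length_Suc_conv)
  then have "(\<Sum>K | length K = Suc n. f K) = (\<Sum>(x, K)\<in>UNIV \<times> {K. length K = n}. f (x # K))"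
    by (simp add: sum.reindex inj_on_def case_prod_unfold)
  then show ?thesis by (simp add: sum.cartesian_product)
qed

lemma sum_words_2: "(\<Sum>K | length K = 2. f K) = (\<Sum>x\<in>UNIV. \<Sum>y\<in>UNIV. f [x, y :: 'n::finite])"
  and sum_words_3: "(\<Sum>K | length K = 3. f K) = (\<Sum>x\<in>UNIV. \<Sum>y\<in>UNIV. \<Sum>z\<in>UNIV. f [x, y, z :: 'n::finite])"
  by (simp_all add: sum_words_Suc numeral_2_eq_2 numeral_3_eq_3)

lemma length_2_conv: "length I = 2 \<longleftrightarrow> (\<exists>x y. I = [x, y])"
  and length_3_conv: "length I = 3 \<longleftrightarrow> (\<exists>x y z. I = [x, y, z])"
  by (auto simp: numeral_2_eq_2 numeral_3_eq_3 length_Suc_conv)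

lemma opn_2_entry: "opn 2 (Suc 0) A [a, b] [c, d] = A $ (a, b) $ (c, d)"
  by (auto simp: opn_def)

lemma opn_mmul: "meq 2 (mmul 2 (opn 2 1 A) (opn 2 1 B)) (opn 2 1 (A ** B))"
  unfolding meq_def
proof (intro allI impI)
  fix I J :: "'a list" assume "length I = 2" "length J = 2"
  then obtain a b c d where [simp]: "I = [a, b]" "J = [c, d]" by (auto simp: length_2_conv)
  have "(\<Sum>x\<in>UNIV. A $ (a, b) $ x * B $ x $ (c, d)) =
      (\<Sum>x\<in>UNIV. \<Sum>y\<in>UNIV. A $ (a, b) $ (x, y) * B $ (x, y) $ (c, d))"
    by (simp add: sum.cartesian_product)
  then show "mmul 2 (opn 2 1 A) (opn 2 1 B) I J = opn 2 1 (A ** B) I J"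
    by (simp add: mmul_def sum_words_2 opn_2_entry matrix_matrix_mult_def)
qed

lemma opn_mat_1: "meq 2 (opn 2 1 (mat 1)) mid"
  unfolding meq_def
proof (intro allI impI)
  fix I J :: "'a list" assume "length I = 2" "length J = 2"
  then obtain a b c d where "I = [a, b]" "J = [c, d]" by (auto simp: length_2_conv)
  then show "opn 2 1 (mat 1) I J = mid I J"
    by (simp add: opn_2_entry mid_def mat_def)
qed

section \<open>Normal ordering in the free algebra\<close>

lemma ring_type_algebra: "ring (ring_of_type_algebra :: 'a::ring_1 ring)"
proof -
  have "\<exists>y. x + y = 0" for x :: 'a
    by (rule exI[of _ "- x"]) simp
  then show ?thesis
    unfolding ring_of_type_algebra_def
    by unfold_locales (auto simp: algebra_simps Units_def add_eq_0_iff)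
qed

lemma type_algebra_simps [simp]:
  "carrier ring_of_type_algebra = UNIV"
  "x \<otimes>\<^bsub>ring_of_type_algebra\<^esub> y = x * y" "x \<oplus>\<^bsub>ring_of_type_algebra\<^esub> y = x + y"
  "\<one>\<^bsub>ring_of_type_algebra\<^esub> = 1" "\<zero>\<^bsub>ring_of_type_algebra\<^esub> = 0"
  by (simp_all add: ring_of_type_algebra_def)

lemma two_sided_ideal_iff_ideal:
  fixes K :: "'a::ring_1 set"
  shows "two_sided_ideal K \<longleftrightarrow> ideal K ring_of_type_algebra"
proof
  interpret R: ring "ring_of_type_algebra :: 'a ring" by (rule ring_type_algebra)
  show "ideal K ring_of_type_algebra" if K: "two_sided_ideal K"
  proof (rule idealI[OF ring_type_algebra])
    have minus: "- x \<in> K" if "x \<in> K" for x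
      using two_sided_idealD(3)[OF K that, of "- 1"] by simp
    show "subgroup K (add_monoid (ring_of_type_algebra :: 'a ring))"
    proof (rule R.add.subgroupI)
      fix x assume x: "x \<in> K"
      have "\<ominus>\<^bsub>ring_of_type_algebra\<^esub> x = - x"
        by (rule R.minus_equality) simp_all
      then show "\<ominus>\<^bsub>ring_of_type_algebra\<^esub> x \<in> K"
        using minus[OF x] by simp
    qed (use two_sided_idealD[OF K] in auto)
  qed (use two_sided_idealD[OF K] in auto)
  show "two_sided_ideal K" if "ideal K ring_of_type_algebra"
  proof -
    interpret ideal K "ring_of_type_algebra :: 'a ring" by fact
    show ?thesis
      unfolding two_sided_ideal_def
      using a_closed zero_closed I_l_closed I_r_closed by auto
  qed
qed

lemma two_sided_ideal_genideal: "two_sided_ideal (Idl\<^bsub>ring_of_type_algebra\<^esub> S)"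
  using ring.genideal_ideal[OF ring_type_algebra, of S] by (simp add: two_sided_ideal_iff_ideal)

lemma subset_genideal: "S \<subseteq> Idl\<^bsub>ring_of_type_algebra\<^esub> S"
  using ring.genideal_self[OF ring_type_algebra, of S] by simp

lemma genideal_least: "two_sided_ideal K \<Longrightarrow> S \<subseteq> K \<Longrightarrow> Idl\<^bsub>ring_of_type_algebra\<^esub> S \<subseteq> K"
  using ring.genideal_minimal[OF ring_type_algebra] by (simp add: two_sided_ideal_iff_ideal)

section \<open>Scalars, words and linear maps on the free algebra\<close>

definition cst :: "complex \<Rightarrow> 'n free_alg" where
  "cst c = Poly_Mapping.single 0 c"

definition wd :: "'n gen list \<Rightarrow> 'n free_alg" where
  "wd w = Poly_Mapping.single (GWord w) 1"

lemma cst_simps [simp]: "cst 0 = 0" "cst 1 = 1"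
  by (simp_all add: cst_def)

lemma cst_add: "cst (a + b) = cst a + cst b" and cst_diff: "cst (a - b) = cst a - cst b"
  and cst_mult: "cst (a * b) = cst a * cst b"
  by (simp_all add: cst_def single_add single_diff mult_single)

lemma cst_sum: "cst (sum f A) = (\<Sum>x\<in>A. cst (f x))"
  by (induction A rule: infinite_finite_induct) (simp_all add: cst_add)

lemma wd_Nil: "wd [] = 1"
  by (simp add: wd_def flip: zero_gen_word_def)

lemma wd_append: "wd (v @ w) = wd v * wd w"
  by (simp add: wd_def mult_single plus_gen_word_def)

lemma wd_Cons: "wd (g # w) = gen_elem g * wd w"
  using wd_append[of "[g]" w] by (simp add: wd_def gen_elem_def)

lemma single_eq_wd: "Poly_Mapping.single w c = cst c * wd (letters w)"
  by (simp add: cst_def wd_def mult_single)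

lemma free_alg_induct [case_names word add]:
  assumes "\<And>c w. P (cst c * wd w)" "\<And>x y. P x \<Longrightarrow> P y \<Longrightarrow> P (x + y)"
  shows "P x"
proof -
  have "x = (\<Sum>w\<in>Poly_Mapping.keys x. Poly_Mapping.single w (Poly_Mapping.lookup x w))"
    by (rule poly_mapping_eqI) (simp add: lookup_sum lookup_single when_def not_in_keys_iff_lookup_eq_zero)
  moreover have "P (\<Sum>w\<in>A. Poly_Mapping.single w (Poly_Mapping.lookup x w))" for A
    using assms(1)[of 0 "[]"] assms
    by (induction A rule: infinite_finite_induct) (simp_all add: single_eq_wd)
  ultimately show ?thesis by metis
qed

lemma cst_central: "cst c * x = x * cst c" for x :: "'a free_alg"
proof (induction x rule: free_alg_induct)
  case (word d w)
  have "cst c * wd w = wd w * cst c"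
    by (simp add: cst_def wd_def mult_single)
  moreover have "cst c * cst d = (cst d * cst c :: 'a free_alg)"
    by (simp add: mult.commute flip: cst_mult)
  ultimately show ?case
    by (metis mult.assoc)
qed (simp add: algebra_simps)

lemma cst_left_commute: "x * (cst c * y) = cst c * (x * y)"
  by (metis cst_central mult.assoc)

lemma cst_gen: "gen_elem g * (cst c * y) = cst c * (gen_elem g * y)"
  and cst_swap: "cst b * (cst c * y) = cst c * (cst b * y)"
  by (rule cst_left_commute)+

definition lin :: "('n gen list \<Rightarrow> 'n free_alg) \<Rightarrow> 'n free_alg \<Rightarrow> 'n free_alg" where
  "lin f x = (\<Sum>w\<in>Poly_Mapping.keys x. cst (Poly_Mapping.lookup x w) * f (letters w))"

lemma lin_superset:
  assumes "finite A" "Poly_Mapping.keys x \<subseteq> A"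
  shows "lin f x = (\<Sum>w\<in>A. cst (Poly_Mapping.lookup x w) * f (letters w))"
  unfolding lin_def by (rule sum.mono_neutral_left) (use assms in \<open>auto simp: in_keys_iff\<close>)

lemma lin_add: "lin f (x + y) = lin f x + lin f y"
proof -
  let ?A = "Poly_Mapping.keys x \<union> Poly_Mapping.keys y"
  have "Poly_Mapping.keys (x + y) \<subseteq> ?A" by (rule keys_add)
  then show ?thesis
    by (simp add: lin_superset[of ?A] lookup_add cst_add distrib_right sum.distrib)
qed

lemma lin_zero [simp]: "lin f 0 = 0"
  by (simp add: lin_def)

lemma lin_word: "lin f (cst c * wd w) = cst c * f w"
  by (simp add: lin_def cst_def wd_def mult_single)

lemma lin_wd: "lin f (wd w) = f w"
  using lin_word[of f 1 w] by simp

lemma lin_cst: "lin f (cst c * x) = cst c * lin f x"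
proof (induction x rule: free_alg_induct)
  case (word d w)
  then show ?case using lin_word[of f "c * d" w] by (simp add: lin_word cst_mult mult.assoc)
qed (simp add: lin_add distrib_left)

lemma lin_diff: "lin f (x - y) = lin f x - lin f y" for x :: "'a free_alg"
proof -
  have m: "cst (- 1) = (- 1 :: 'a free_alg)"
    using cst_diff[of 0 1] by simp
  have "lin f (x + cst (- 1) * y) = lin f x + cst (- 1) * lin f y"
    by (simp only: lin_add lin_cst)
  then show ?thesis by (simp add: m)
qed

lemma lin_sum: "lin f (sum g A) = (\<Sum>x\<in>A. lin f (g x))"
  by (induction A rule: infinite_finite_induct) (simp_all add: lin_add)

lemma free_alg_expand: "x = lin wd x"
  by (induction x rule: free_alg_induct) (simp_all add: lin_word lin_add)

abbreviation (input) "gM i j \<equiv> gen_elem (GenM i j)"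
abbreviation (input) "gD i j \<equiv> gen_elem (GenD i j)"

text \<open>Quadratic exchange rules: \<open>\<partial>\<^sub>i\<^sup>a m\<^sub>b\<^sup>j\<close> is replaced by the sum over \<open>t \<in> T\<close> of
  \<open>cf i a b j t\<close> times the product of the entries \<open>mi t\<close> of \<open>M\<close> and \<open>di t\<close> of \<open>D\<close>.\<close>

locale exchange =
  fixes T :: "'t set" and cf :: "'n \<Rightarrow> 'n \<Rightarrow> 'n \<Rightarrow> 'n \<Rightarrow> 't \<Rightarrow> complex"
    and mi di :: "'t \<Rightarrow> 'n \<times> 'n"
begin

abbreviation "Mt t \<equiv> gM (fst (mi t)) (snd (mi t))"

text \<open>The letter D moves right through letters of M and stops in front of the first D. For an
  ordered word the result is ordered.\<close>

primrec push :: "'n gen list \<Rightarrow> 'n \<Rightarrow> 'n \<Rightarrow> 'n free_alg" where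
  "push [] i a = gD i a"
| "push (g # w) i a = (case g of
      GenD u v \<Rightarrow> gD i a * wd (g # w)
    | GenM b j \<Rightarrow> \<Sum>t\<in>T. cst (cf i a b j t) * (Mt t * push w (fst (di t)) (snd (di t))))"

definition Ld :: "'n \<Rightarrow> 'n \<Rightarrow> 'n free_alg \<Rightarrow> 'n free_alg" where
  "Ld i a = lin (\<lambda>w. push w i a)"

text \<open>Words are processed from right to left, so each D is pushed into an already normalised
  tail.\<close>

primrec norm :: "'n gen list \<Rightarrow> 'n free_alg" where
  "norm [] = 1"
| "norm (g # w) = (case g of GenM b j \<Rightarrow> gM b j * norm w | GenD i a \<Rightarrow> Ld i a (norm w))"

definition N :: "'n free_alg \<Rightarrow> 'n free_alg" where
  "N = lin norm"

lemma Ld_add: "Ld i a (x + y) = Ld i a x + Ld i a y" and Ld_cst: "Ld i a (cst c * x) = cst c * Ld i a x"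
  and Ld_zero [simp]: "Ld i a 0 = 0"
  by (simp_all add: Ld_def lin_add lin_cst)

lemma N_add: "N (x + y) = N x + N y" and N_diff: "N (x - y) = N x - N y"
  and N_cst: "N (cst c * x) = cst c * N x" and N_zero [simp]: "N 0 = 0"
  and N_sum: "N (sum g A) = (\<Sum>x\<in>A. N (g x))"
  by (simp_all add: N_def lin_add lin_diff lin_cst lin_sum)

lemma Ld_M: "Ld i a (gM b j * x) =
    (\<Sum>t\<in>T. cst (cf i a b j t) * (Mt t * Ld (fst (di t)) (snd (di t)) x))"
proof (induction x rule: free_alg_induct)
  case (word c w)
  have "gM b j * (cst c * wd w) = cst c * wd (GenM b j # w)"
    by (simp add: cst_left_commute wd_Cons)
  then show ?case
    by (simp add: Ld_def lin_word sum_distrib_left cst_gen cst_swap)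
qed (simp add: distrib_left Ld_add sum.distrib)

lemma N_M: "N (gM b j * x) = gM b j * N x"
proof (induction x rule: free_alg_induct)
  case (word c w)
  have "gM b j * (cst c * wd w) = cst c * wd (GenM b j # w)"
    by (simp add: cst_left_commute wd_Cons)
  then show ?case
    by (simp add: N_def lin_word cst_gen cst_swap)
qed (simp add: distrib_left N_add)

lemma N_D: "N (gD i a * x) = Ld i a (N x)"
proof (induction x rule: free_alg_induct)
  case (word c w)
  have "gD i a * (cst c * wd w) = cst c * wd (GenD i a # w)"
    by (simp add: cst_left_commute wd_Cons)
  then show ?case
    by (simp add: N_def lin_word Ld_cst)
qed (simp add: distrib_left N_add Ld_add)

text \<open>A trailing D is never crossed by another letter. Hence \<open>N\<close> commutes with
  right multiplication by D, which is used later on \<open>ZD\<close>.\<close>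

lemma push_append_D: "push (w @ [GenD u v]) i a = push w i a * gD u v"
proof (induction w arbitrary: i a)
  case (Cons g w)
  then show ?case
    by (cases g) (simp_all add: wd_Cons wd_append wd_Nil sum_distrib_right mult.assoc)
qed (simp add: wd_Cons wd_Nil)

lemma Ld_right_D: "Ld i a (x * gD u v) = Ld i a x * gD u v"
proof (induction x rule: free_alg_induct)
  case (word c w)
  have "cst c * wd w * gD u v = cst c * wd (w @ [GenD u v])"
    by (simp add: wd_append wd_Cons wd_Nil mult.assoc)
  then show ?case
    by (simp add: Ld_def lin_word push_append_D mult.assoc)
qed (simp add: distrib_right Ld_add)

lemma norm_append_D: "norm (w @ [GenD u v]) = norm w * gD u v"
proof (induction w)
  case Nil
  show ?case by (simp add: Ld_def lin_wd flip: wd_Nil) (simp add: wd_Nil)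
next
  case (Cons g w)
  then show ?case by (cases g) (simp_all add: Ld_right_D mult.assoc)
qed

lemma N_right_D: "N (x * gD u v) = N x * gD u v"
proof (induction x rule: free_alg_induct)
  case (word c w)
  have "cst c * wd w * gD u v = cst c * wd (w @ [GenD u v])"
    by (simp add: wd_append wd_Cons wd_Nil mult.assoc)
  then show ?case
    by (simp add: N_def lin_word norm_append_D mult.assoc)
qed (simp add: distrib_right N_add)

lemma norm_ordered:
  "norm (map (\<lambda>(i, j). GenM i j) ms @ map (\<lambda>(i, j). GenD i j) ds) =
   wd (map (\<lambda>(i, j). GenM i j) ms @ map (\<lambda>(i, j). GenD i j) ds)"
proof (induction ms)
  case Nil
  show ?case
  proof (induction ds)
    case (Cons p ds)
    have "push (map (\<lambda>(i, j). GenD i j) ds) i a = gD i a * wd (map (\<lambda>(i, j). GenD i j) ds)" for i a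
      by (cases ds) (auto simp: wd_Nil)
    with Cons show ?case by (auto simp: Ld_def lin_wd wd_Cons split: prod.split)
  qed (simp add: wd_Nil)
qed (auto simp: wd_Cons split: prod.split)

lemma N_ordered:
  assumes "ordered_expr u"
  shows "N u = u"
proof -
  have "norm (letters w) = wd (letters w)" if w: "w \<in> Poly_Mapping.keys u" for w
  proof -
    obtain ms ds where "letters w = map (\<lambda>(i, j). GenM i j) ms @ map (\<lambda>(i, j). GenD i j) ds"
      using assms w unfolding ordered_expr_def by blast
    then show ?thesis by (simp add: norm_ordered)
  qed
  then have "N u = lin wd u"
    by (simp add: N_def lin_def)
  then show ?thesis
    using free_alg_expand[of u] by simp
qed

text \<open>By \<open>N_M\<close> and \<open>N_D\<close>, the value of \<open>N\<close> on a product
  depends on the right factor x only through \<open>N x\<close>.\<close>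

lemma N_left_zero: "N x = 0 \<Longrightarrow> N (y * x) = 0"
proof (induction y rule: free_alg_induct)
  case (word c w)
  have "N (wd w * x) = 0"
  proof (induction w)
    case Nil
    show ?case using word by (simp add: wd_Nil)
  next
    case (Cons g w)
    then show ?case by (cases g) (simp_all add: wd_Cons mult.assoc N_M N_D)
  qed
  then show ?case by (simp add: mult.assoc N_cst)
qed (simp add: distrib_right N_add)

text \<open>The set \<open>?K\<close> is a two-sided ideal: stability on the right is built into its
  definition, stability on the left is \<open>N_left_zero\<close>.\<close>

lemma N_genideal_zero:
  assumes "\<And>r y. r \<in> S \<Longrightarrow> N (r * y) = 0" "x \<in> Idl\<^bsub>ring_of_type_algebra\<^esub> S"
  shows "N x = 0"
proof -
  let ?K = "{x. \<forall>y. N (x * y) = 0}"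
  have "two_sided_ideal ?K"
    unfolding two_sided_ideal_def
    by (auto simp: distrib_right N_add mult.assoc N_left_zero)
  then have "Idl\<^bsub>ring_of_type_algebra\<^esub> S \<subseteq> ?K"
    using assms(1) by (intro genideal_least) auto
  then have "N (x * 1) = 0" using assms(2) by blast
  then show ?thesis by simp
qed

end

section \<open>The matrices of the quantum double\<close>

lift_definition cbm :: "('n, complex) bmat \<Rightarrow> ('n, 'n free_alg) bmat" is "\<lambda>A I J. cst (A I J)"
  by simp

lemma ent_cbm [simp]: "ent (cbm A) I J = cst (ent A I J)"
  by (simp add: cbm.rep_eq)

lemma cbm_mult: "cbm (A * B) = cbm A * cbm B" and cbm_add: "cbm (A + B) = cbm A + cbm B"
  and cbm_0 [simp]: "cbm 0 = 0" and cbm_1 [simp]: "cbm 1 = 1"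
  for A B :: "('n::finite, complex) bmat"
  by (rule bmat_eqI; simp add: ent_mult cst_sum cst_mult cst_add)+

lemma cbm_ub: "cbm (ub n A) = ub n (cmat A)"
  by (rule bmat_eqI) (auto simp: ub.rep_eq cmat_def cst_def single_zero simp flip: single_one)

lemma place_cmat: "place p m (cmat A) = cmat (place p m A)"
  by (simp add: place_def cmat_def fun_eq_iff)

lemma cmat_cong: "meq n A B \<Longrightarrow> meq n (cmat A) (cmat B)"
  by (simp add: meq_def cmat_def)

section \<open>Braid operators and defining relations on arbitrary tensor powers\<close>

locale braiding =
  fixes R Ri Psi :: "'n::finite op2"
  assumes braid_relation: "braid_relation R"
    and R_Ri: "R ** Ri = mat 1" and Ri_R: "Ri ** R = mat 1"
    and skew1: "ptrace2 (mmul 3 (opn 3 1 R) (opn 3 2 Psi)) = flip"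
    and skew2: "ptrace2 (mmul 3 (opn 3 1 Psi) (opn 3 2 R)) = flip"
begin

definition rc :: "nat \<Rightarrow> nat \<Rightarrow> ('n, complex) bmat" where "rc n i = ub n (opn n (Suc i) R)"
definition sc :: "nat \<Rightarrow> nat \<Rightarrow> ('n, complex) bmat" where "sc n i = ub n (opn n (Suc i) Ri)"

definition rf :: "nat \<Rightarrow> nat \<Rightarrow> ('n, 'n free_alg) bmat" where "rf n i = cbm (rc n i)"
definition sf :: "nat \<Rightarrow> nat \<Rightarrow> ('n, 'n free_alg) bmat" where "sf n i = cbm (sc n i)"

definition mf :: "nat \<Rightarrow> ('n, 'n free_alg) bmat" where "mf n = blk n (emb1 Mmat)"
definition df :: "nat \<Rightarrow> ('n, 'n free_alg) bmat" where "df n = blk n (emb1 Dmat)"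

lemma opn_inverse:
  fixes A B :: "'n op2"
  assumes "Suc i < n" "A ** B = mat 1"
  shows "meq n (mmul n (opn n (Suc i) A) (opn n (Suc i) B)) mid"
proof -
  have p: "meq n (opn n (Suc i) C) (place i 2 (opn 2 1 C))" for C :: "'n op2"
    using place_opn[of 1 2 i n C] assms by simp
  have "meq n (mmul n (opn n (Suc i) A) (opn n (Suc i) B))
      (mmul n (place i 2 (opn 2 1 A)) (place i 2 (opn 2 1 B)))"
    by (intro mmul_cong p)
  also have "meq n \<dots> (place i 2 (mmul 2 (opn 2 1 A) (opn 2 1 B)))"
    using assms by (intro place_mmul) simp
  also have "meq n \<dots> (place i 2 mid)"
    using assms opn_mmul[of A B] opn_mat_1 by (intro place_cong) (auto intro: meq_trans)
  also have "meq n \<dots> mid"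
    using assms by (intro place_mid) simp
  finally show ?thesis .
qed

lemma braid_rep_c: "braid_rep n (rc n) (sc n)"
proof
  fix i assume "Suc i < n"
  then show "rc n i * sc n i = 1" "sc n i * rc n i = 1"
    using ub_cong[OF opn_inverse[OF _ R_Ri]] ub_cong[OF opn_inverse[OF _ Ri_R]]
    by (simp_all add: rc_def sc_def ub_mult_ub)
next
  fix i assume i: "Suc (Suc i) < n"
  define a b where "a = opn 3 1 R" and "b = opn 3 2 R"
  have 1: "rc n i = ub n (place i 3 a)"
    using ub_cong[OF place_opn[of 1 3 i n R]] i by (simp add: rc_def a_def)
  have 2: "rc n (Suc i) = ub n (place i 3 b)"
    using ub_cong[OF place_opn[of 2 3 i n R]] i by (simp add: rc_def b_def)
  have m: "ub n (place i 3 A) * ub n (place i 3 B) = ub n (place i 3 (mmul 3 A B))"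
    for A B :: "('n, complex) tmat"
    using ub_cong[OF place_mmul[of i 3 n A B]] i by (simp add: ub_mult_ub)
  have "meq 3 (mmul 3 (mmul 3 a b) a) (mmul 3 (mmul 3 b a) b)"
    using braid_relation by (simp add: braid_relation_def a_def b_def)
  then have "ub n (place i 3 (mmul 3 (mmul 3 a b) a)) = ub n (place i 3 (mmul 3 (mmul 3 b a) b))"
    using i by (intro ub_cong place_cong) auto
  then show "rc n i * (rc n (Suc i) * rc n i) = rc n (Suc i) * (rc n i * rc n (Suc i))"
    unfolding 1 2 unfolding mult.assoc[symmetric] unfolding m .
next
  fix i j assume ij: "Suc i < j" "Suc j < n"
  have "rc n i = ub n (place i 2 (opn 2 1 R))" "rc n j = ub n (place j 2 (opn 2 1 R))"
    using ub_cong[OF place_opn[of 1 2 i n R]] ub_cong[OF place_opn[of 1 2 j n R]] ij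
    by (simp_all add: rc_def)
  then show "rc n i * rc n j = rc n j * rc n i"
    using ub_cong[OF place_commute[of i 2 j 2 n "opn 2 1 R" "opn 2 1 R"]] ij
    by (simp add: ub_mult_ub)
qed

lemma braid_rep_f: "braid_rep n (rf n) (sf n)"
proof -
  interpret braid_rep n "rc n" "sc n" by (rule braid_rep_c)
  show ?thesis
    by standard (simp_all only: rf_def sf_def cbm_mult[symmetric] rs sr cbm_1 braid,
      metis far)
qed

lemma opn_emb1_commute:
  fixes A :: "'n free_alg ^ 'n ^ 'n"
  assumes "0 < i" "Suc i < n"
  shows "rf n i * blk n (emb1 A) = blk n (emb1 A) * rf n i"
proof -
  let ?r = "place i 2 (cmat (opn 2 1 R))" and ?a = "place 0 1 (emb1 A)"
  have 1: "rf n i = ub n ?r"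
    using ub_cong[OF cmat_cong[OF place_opn[of 1 2 i n R]]] assms
    by (simp add: rf_def rc_def cbm_ub place_cmat)
  have 2: "blk n (emb1 A) = blk n ?a"
    using blk_cong[OF place_emb1[of 1 n A]] assms by simp
  have "emb1 A I J * cmat C I' J' = cmat C I' J' * emb1 A I J" for C I J I' J'
    unfolding cmat_def cst_def[symmetric] by (rule cst_central[symmetric])
  then have "meq n (mmul n ?a ?r) (mmul n ?r ?a)"
    using assms by (intro place_commute) auto
  then show ?thesis
    unfolding 1 2 ub_mult_blk blk_mult_ub by (rule blk_cong[OF meq_sym])
qed

text \<open>Moves a relation on two factors to the first two of n factors, with zero on all other
  blocks so that sums and differences are preserved.\<close>

definition lf :: "nat \<Rightarrow> ('n, 'n free_alg) tmat \<Rightarrow> ('n, 'n free_alg) bmat" where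
  "lf n A = blk n (place 0 2 A)"

lemma lf_diff: "lf n (\<lambda>I J. A I J - B I J) = lf n A - lf n B"
  and lf_add: "lf n (\<lambda>I J. A I J + B I J) = lf n A + lf n B"
  by (rule bmat_eqI; simp add: lf_def blk.rep_eq place_def)+

lemma lf_cong: "2 \<le> n \<Longrightarrow> meq 2 A B \<Longrightarrow> lf n A = lf n B"
  unfolding lf_def by (intro blk_cong place_cong) auto

lemma lf_mmul: "2 \<le> n \<Longrightarrow> lf n (mmul 2 A B) = lf n A * lf n B"
  unfolding lf_def blk_mult_blk by (intro blk_cong[OF meq_sym] place_mmul) auto

lemma lf_emb1: "2 \<le> n \<Longrightarrow> lf n (emb1 Mmat) = mf n" "2 \<le> n \<Longrightarrow> lf n (emb1 Dmat) = df n"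
  unfolding lf_def mf_def df_def by (intro blk_cong[OF meq_sym] place_emb1; simp)+

lemma lf_R: "2 \<le> n \<Longrightarrow> lf n (cmat (opn 2 1 R)) = blk n (cmat (opn n 1 R))"
  unfolding lf_def place_cmat
  by (intro blk_cong[OF meq_sym] cmat_cong) (use place_opn[of 1 2 0 n R] in simp)

lemma minv_R: "Suc i < n \<Longrightarrow> meq n (minv n (opn n (Suc i) R)) (opn n (Suc i) Ri)"
  by (intro meq_minv opn_inverse R_Ri Ri_R)

lemma lf_Ri: "2 \<le> n \<Longrightarrow> lf n (cmat (minv 2 (opn 2 1 R))) = blk n (cmat (opn n 1 Ri))"
proof -
  assume n: "2 \<le> n"
  have "lf n (cmat (minv 2 (opn 2 1 R))) = lf n (cmat (opn 2 1 Ri))"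
    using n minv_R[of 0 2] by (intro lf_cong cmat_cong) auto
  also have "\<dots> = blk n (cmat (opn n 1 Ri))"
    unfolding lf_def place_cmat
    by (intro blk_cong[OF meq_sym] cmat_cong) (use place_opn[of 1 2 0 n Ri] n in simp)
  finally show ?thesis .
qed

lemma blk_absorb:
  fixes A B :: "('n, 'n free_alg) tmat"
  shows "blk n A * blk n B = ub n A * blk n B" "blk n A * (blk n B * x) = ub n A * (blk n B * x)"
    "blk n B * blk n A = blk n B * ub n A" "blk n B * (blk n A * x) = blk n B * (ub n A * x)"
  by (simp_all add: blk_mult_blk ub_mult_blk blk_mult_ub flip: mult.assoc)

lemma rf_0: "rf n 0 = ub n (cmat (opn n 1 R))" and sf_0: "sf n 0 = ub n (cmat (opn n 1 Ri))"
  by (simp_all add: rf_def sf_def rc_def sc_def cbm_ub)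

lemma lf_R_absorb:
  assumes "2 \<le> n"
  shows "lf n (cmat (opn 2 1 R)) * mf n = rf n 0 * mf n"
    "lf n (cmat (opn 2 1 R)) * (mf n * x) = rf n 0 * (mf n * x)"
    "mf n * lf n (cmat (opn 2 1 R)) = mf n * rf n 0"
    "mf n * (lf n (cmat (opn 2 1 R)) * x) = mf n * (rf n 0 * x)"
    "df n * (lf n (cmat (opn 2 1 R)) * x) = df n * (rf n 0 * x)"
    "lf n (cmat (minv 2 (opn 2 1 R))) * df n = sf n 0 * df n"
    "lf n (cmat (minv 2 (opn 2 1 R))) * (df n * x) = sf n 0 * (df n * x)"
    "df n * lf n (cmat (minv 2 (opn 2 1 R))) = df n * sf n 0"
    "df n * (lf n (cmat (minv 2 (opn 2 1 R))) * x) = df n * (sf n 0 * x)"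
    "mf n * (lf n (cmat (minv 2 (opn 2 1 R))) * x) = mf n * (sf n 0 * x)"
  unfolding rf_0 sf_0 lf_R[OF assms] lf_Ri[OF assms] mf_def df_def
  by (rule blk_absorb)+

lemma lf_mprod:
  assumes "2 \<le> n"
  shows "lf n (mprod [A]) = lf n A" "lf n (mprod (A # B # As)) = lf n A * lf n (mprod (B # As))"
  using assms by (auto simp: mprod_def lf_mmul[symmetric] intro: lf_cong mmul_mid)

abbreviation (input) "R1 \<equiv> cmat (opn 2 1 R)"
abbreviation (input) "R1' \<equiv> cmat (minv 2 (opn 2 1 R))"
abbreviation (input) "M1 \<equiv> emb1 (Mmat :: 'n free_alg ^ 'n ^ 'n)"
abbreviation (input) "D1 \<equiv> emb1 (Dmat :: 'n free_alg ^ 'n ^ 'n)"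

definition EM :: "('n, 'n free_alg) tmat" where
  "EM = (\<lambda>I J. mprod [R1, M1, R1, M1] I J - mprod [M1, R1, M1, R1] I J)"
definition ED :: "('n, 'n free_alg) tmat" where
  "ED = (\<lambda>I J. mprod [R1', D1, R1', D1] I J - mprod [D1, R1', D1, R1'] I J)"
definition EP :: "('n, 'n free_alg) tmat" where
  "EP = (\<lambda>I J. mprod [D1, R1, M1, R1] I J - (mprod [R1, M1, R1', D1] I J + R1 I J))"
definition EH :: "('n, 'n free_alg) tmat" where
  "EH = (\<lambda>I J. mprod [D1, R1, M1] I J - mprod [R1, M1, R1', D1, R1'] I J)"

lemma rels_entries: "rels_M R = entries EM" "rels_D R = entries ED" "rels_perm R = entries EP"
  "rels_perm_hom R = entries EH"
  unfolding rels_M_def rels_D_def rels_perm_def rels_perm_hom_def EM_def ED_def EP_def EH_def Let_def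
  by (rule refl)+

lemma lf_rels:
  assumes n: "2 \<le> n"
  shows "lf n EM = rf n 0 * mf n * rf n 0 * mf n - mf n * rf n 0 * mf n * rf n 0"
    and "lf n ED = sf n 0 * df n * sf n 0 * df n - df n * sf n 0 * df n * sf n 0"
    and "lf n EP = df n * rf n 0 * mf n * rf n 0 - (rf n 0 * mf n * sf n 0 * df n + lf n R1)"
    and "lf n EH = df n * rf n 0 * mf n - rf n 0 * mf n * sf n 0 * df n * sf n 0"
  unfolding EM_def ED_def EP_def EH_def lf_diff lf_add lf_mprod[OF n] lf_emb1[OF n]
    lf_R_absorb[OF n] mult.assoc by (rule refl)+

lemma ent_lf: "length I = n \<Longrightarrow> length J = n \<Longrightarrow>
    ent (lf n A) I J = (if drop 2 I = drop 2 J then A (take 2 I) (take 2 J) else 0)"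
  by (simp add: lf_def place_def flip: numeral_2_eq_2)

lemma lf_block_ideal:
  assumes "two_sided_ideal P" "entries A \<subseteq> P" "2 \<le> n"
  shows "lf n A \<in> block_ideal n P"
proof -
  have "A (take 2 I) (take 2 J) \<in> P" if "length I = n" "length J = n" for I J
  proof -
    have "length (take 2 I) = 2" "length (take 2 J) = 2"
      using that assms(3) by simp_all
    then show ?thesis using assms(2) unfolding entries_def by blast
  qed
  then show ?thesis
    using two_sided_idealD(1)[OF assms(1)] by (simp add: block_ideal_def ent_lf)
qed

lemma perm_rep_double:
  assumes "two_sided_ideal P" "rels_perm R \<subseteq> P"
  shows "perm_rep n (rf n) (sf n) (block_ideal n P) (mf n) (df n) 1"
proof (rule perm_rep.intro[OF braid_rep_f])
  show "ring_congruence (block_ideal n P :: ('n, 'n free_alg) bmat set)"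
    by (rule ring_congruence.intro[OF two_sided_ideal_block[OF assms(1)]])
  then interpret ring_congruence "block_ideal n P :: ('n, 'n free_alg) bmat set" .
  show "perm_rep_axioms n (rf n) (sf n) (block_ideal n P) (mf n) (df n) 1"
  proof
    show "rf n i * mf n = mf n * rf n i" "rf n i * df n = df n * rf n i"
      if "0 < i" "Suc i < n" for i
      unfolding mf_def df_def using opn_emb1_commute[OF that] by auto
    assume n: "1 < n"
    have "cong (df n * rf n 0 * mf n * rf n 0) (rf n 0 * mf n * sf n 0 * df n + lf n R1)"
      using lf_block_ideal[OF assms[unfolded rels_entries], of n] n
      by (simp only: cong_def lf_rels)
    also have "cong \<dots> (rf n 0 * mf n * sf n 0 * df n + 1 * rf n 0)"
    proof (intro cong_add cong_refl)
      \<comment> \<open>The two sides differ only off the n-th block, where \<open>lf\<close> is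
        zero and \<open>rf\<close> is the identity.\<close>
      show "cong (lf n R1) (1 * rf n 0)"
        unfolding cong_def using n two_sided_idealD(1)[OF assms(1)]
        by (simp add: lf_R[simplified] rf_0[simplified] block_ideal_def)
    qed
    finally show "cong (df n * rf n 0 * mf n * rf n 0) (rf n 0 * mf n * sf n 0 * df n + 1 * rf n 0)" .
  qed simp
qed

lemma perm_rep_hom:
  assumes "two_sided_ideal P" "rels_perm_hom R \<subseteq> P"
  shows "perm_rep n (rf n) (sf n) (block_ideal n P) (mf n) (df n) 0"
proof (rule perm_rep.intro[OF braid_rep_f])
  show "ring_congruence (block_ideal n P :: ('n, 'n free_alg) bmat set)"
    by (rule ring_congruence.intro[OF two_sided_ideal_block[OF assms(1)]])
  then interpret ring_congruence "block_ideal n P :: ('n, 'n free_alg) bmat set" .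
  interpret braid_rep n "rf n" "sf n" by (rule braid_rep_f)
  show "perm_rep_axioms n (rf n) (sf n) (block_ideal n P) (mf n) (df n) 0"
  proof
    show "rf n i * mf n = mf n * rf n i" "rf n i * df n = df n * rf n i"
      if "0 < i" "Suc i < n" for i
      unfolding mf_def df_def using opn_emb1_commute[OF that] by auto
    assume n: "1 < n"
    have "cong (df n * rf n 0 * mf n) (rf n 0 * mf n * sf n 0 * df n * sf n 0)"
      using lf_block_ideal[OF assms[unfolded rels_entries], of n] n
      by (simp only: cong_def lf_rels)
    then have "cong (df n * rf n 0 * mf n * rf n 0) (rf n 0 * mf n * sf n 0 * df n * sf n 0 * rf n 0)"
      by (rule cong_mult[OF _ cong_refl])
    then show "cong (df n * rf n 0 * mf n * rf n 0) (rf n 0 * mf n * sf n 0 * df n + 0 * rf n 0)"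
      using n by (simp add: mult.assoc sr)
  qed simp_all
qed

lemma double_rep_double:
  assumes "two_sided_ideal P" "rels_perm R \<subseteq> P" "rels_D R \<subseteq> P"
  shows "double_rep n (rf n) (sf n) (block_ideal n P) (mf n) (df n) 1"
    (is "double_rep _ _ _ ?K _ _ _")
proof -
  interpret perm_rep n "rf n" "sf n" ?K "mf n" "df n" 1
    by (rule perm_rep_double[OF assms(1,2)])
  show ?thesis
    by standard (use lf_block_ideal[OF assms(1,3)[unfolded rels_entries], of n] lf_rels(2)[of n]
      in \<open>simp add: cong_def\<close>)
qed

lemma double_rep_hom:
  assumes "two_sided_ideal P" "rels_perm_hom R \<subseteq> P" "rels_D R \<subseteq> P"
  shows "double_rep n (rf n) (sf n) (block_ideal n P) (mf n) (df n) 0"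
    (is "double_rep _ _ _ ?K _ _ _")
proof -
  interpret perm_rep n "rf n" "sf n" ?K "mf n" "df n" 0
    by (rule perm_rep_hom[OF assms(1,2)])
  show ?thesis
    by standard (use lf_block_ideal[OF assms(1,3)[unfolded rels_entries], of n] lf_rels(2)[of n]
      in \<open>simp add: cong_def\<close>)
qed

lemma hom_perm_rep_3:
  assumes "two_sided_ideal P" "rels_perm_hom R \<subseteq> P"
  shows "hom_perm_rep 3 (rf 3) (sf 3) (block_ideal 3 P) (mf 3) (df 3) 0"
  by (intro hom_perm_rep.intro perm_rep_hom assms hom_perm_rep_axioms.intro) simp_all

section \<open>Entries of products on three tensor factors\<close>

lemma sum_words_single:
  fixes f :: "'n list \<Rightarrow> 'b::comm_monoid_add"
  assumes "\<And>K. length K = n \<Longrightarrow> K \<notin> g ` A \<Longrightarrow> f K = 0"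
    and "inj_on g A" "g ` A \<subseteq> {K. length K = n}"
  shows "(\<Sum>K | length K = n. f K) = (\<Sum>a\<in>A. f (g a))"
  by (subst sum.mono_neutral_right[of _ "g ` A"]) (use assms in \<open>auto simp: sum.reindex\<close>)

lemma length_3_list: "length [x, y, z] = 3"
  by simp

lemma ent_df_mult:
  assumes "length J = 3"
  shows "ent (df 3 * A) [x, y, z] J = (\<Sum>a\<in>UNIV. gD x a * ent A [a, y, z] J)"
proof -
  have "ent (df 3 * A) [x, y, z] J = (\<Sum>K | length K = 3. ent (df 3) [x, y, z] K * ent A K J)"
    unfolding ent_mult length_3_list ..
  also have "\<dots> = (\<Sum>a\<in>UNIV. ent (df 3) [x, y, z] [a, y, z] * ent A [a, y, z] J)"
    by (rule sum_words_single[where g = "\<lambda>a. [a, y, z]"])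
      (auto simp: df_def emb1_def length_3_conv inj_on_def)
  finally show ?thesis
    by (simp add: df_def emb1_def Dmat_def)
qed

lemma ent_mult_mf:
  assumes "length I = 3"
  shows "ent (A * mf 3) I [x, y, z] = (\<Sum>a\<in>UNIV. ent A I [a, y, z] * gM a x)"
proof -
  have "ent (A * mf 3) I [x, y, z] = (\<Sum>K | length K = 3. ent A I K * ent (mf 3) K [x, y, z])"
    using assms by (simp add: ent_mult)
  also have "\<dots> = (\<Sum>a\<in>UNIV. ent A I [a, y, z] * ent (mf 3) [a, y, z] [x, y, z])"
    by (rule sum_words_single[where g = "\<lambda>a. [a, y, z]"])
      (auto simp: mf_def emb1_def length_3_conv inj_on_def)
  finally show ?thesis
    by (simp add: mf_def emb1_def Mmat_def)
qed

lemma ent_rf_3: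
  "ent (rf 3 0) [x, y, z] [u, v, w] = (if z = w then cst (R $ (x, y) $ (u, v)) else 0)"
  "ent (rf 3 (Suc 0)) [x, y, z] [u, v, w] = (if x = u then cst (R $ (y, z) $ (v, w)) else 0)"
  by (auto simp: rf_def rc_def opn_def numeral_3_eq_3 less_Suc_eq)

lemma ent_rf_mult:
  assumes "length J = 3"
  shows "ent (rf 3 0 * A) [x, y, z] J = (\<Sum>u\<in>UNIV. \<Sum>v\<in>UNIV. cst (R $ (x, y) $ (u, v)) * ent A [u, v, z] J)"
    "ent (rf 3 (Suc 0) * A) [x, y, z] J = (\<Sum>u\<in>UNIV. \<Sum>v\<in>UNIV. cst (R $ (y, z) $ (u, v)) * ent A [x, u, v] J)"
proof -
  have "ent (rf 3 0 * A) [x, y, z] J =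
      (\<Sum>u\<in>UNIV. \<Sum>v\<in>UNIV. \<Sum>w\<in>UNIV. if w = z then cst (R $ (x, y) $ (u, v)) * ent A [u, v, w] J else 0)"
    unfolding ent_mult length_3_list sum_words_3
    by (intro sum.cong refl) (simp add: ent_rf_3)
  then show "ent (rf 3 0 * A) [x, y, z] J =
      (\<Sum>u\<in>UNIV. \<Sum>v\<in>UNIV. cst (R $ (x, y) $ (u, v)) * ent A [u, v, z] J)"
    by simp
  have "ent (rf 3 (Suc 0) * A) [x, y, z] J =
      (\<Sum>u\<in>UNIV. if u = x then \<Sum>v\<in>UNIV. \<Sum>w\<in>UNIV. cst (R $ (y, z) $ (v, w)) * ent A [u, v, w] J else 0)"
    unfolding ent_mult length_3_list sum_words_3
    by (intro sum.cong refl) (simp add: ent_rf_3)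
  then show "ent (rf 3 (Suc 0) * A) [x, y, z] J =
      (\<Sum>u\<in>UNIV. \<Sum>v\<in>UNIV. cst (R $ (y, z) $ (u, v)) * ent A [x, u, v] J)"
    by simp
qed

lemma ent_mult_rf:
  assumes "length I = 3"
  shows "ent (A * rf 3 0) I [x, y, z] = (\<Sum>u\<in>UNIV. \<Sum>v\<in>UNIV. cst (R $ (u, v) $ (x, y)) * ent A I [u, v, z])"
    "ent (A * rf 3 (Suc 0)) I [x, y, z] = (\<Sum>u\<in>UNIV. \<Sum>v\<in>UNIV. cst (R $ (u, v) $ (y, z)) * ent A I [x, u, v])"
proof -
  have "ent (A * rf 3 0) I [x, y, z] =
      (\<Sum>u\<in>UNIV. \<Sum>v\<in>UNIV. \<Sum>w\<in>UNIV. if w = z then cst (R $ (u, v) $ (x, y)) * ent A I [u, v, w] else 0)"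
    unfolding ent_mult assms sum_words_3
    by (intro sum.cong refl) (simp add: ent_rf_3 cst_central)
  then show "ent (A * rf 3 0) I [x, y, z] =
      (\<Sum>u\<in>UNIV. \<Sum>v\<in>UNIV. cst (R $ (u, v) $ (x, y)) * ent A I [u, v, z])"
    by simp
  have "ent (A * rf 3 (Suc 0)) I [x, y, z] =
      (\<Sum>u\<in>UNIV. if u = x then \<Sum>v\<in>UNIV. \<Sum>w\<in>UNIV. cst (R $ (v, w) $ (y, z)) * ent A I [u, v, w] else 0)"
    unfolding ent_mult assms sum_words_3
    by (intro sum.cong refl) (simp add: ent_rf_3 cst_central)
  then show "ent (A * rf 3 (Suc 0)) I [x, y, z] =
      (\<Sum>u\<in>UNIV. \<Sum>v\<in>UNIV. cst (R $ (u, v) $ (y, z)) * ent A I [x, u, v])"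
    by simp
qed

end

section \<open>Uniqueness of normal forms\<close>

context braiding
begin

section \<open>Linear systems solved by the skew inverse\<close>

lemma opn_3_entry:
  "opn 3 (Suc 0) A [a, b, c] [x, y, z] = (if c = z then A $ (a, b) $ (x, y) else 0)"
  "opn 3 2 A [a, b, c] [x, y, z] = (if a = x then A $ (b, c) $ (y, z) else 0)"
  by (auto simp: opn_def numeral_3_eq_3 numeral_2_eq_2 less_Suc_eq)

text \<open>With the indices regrouped into rows (a, b) and columns (x, v), the trace condition
  makes the matrix of B a right inverse of that of A. \<open>skew1\<close> and \<open>skew2\<close>
  give the two orders for R and Psi.\<close>

lemma skew_entries:
  "(\<Sum>x\<in>UNIV. \<Sum>v\<in>UNIV. A $ (a, x) $ (b, v) * B $ (v, b') $ (x, a')) = (if a = a' \<and> b = b' then 1 else 0)"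
  if "ptrace2 (mmul 3 (opn 3 1 A) (opn 3 2 B)) = flip" for A B :: "'n op2"
proof -
  have "(\<Sum>x\<in>UNIV. \<Sum>v\<in>UNIV. A $ (a, x) $ (b, v) * B $ (v, b') $ (x, a')) =
      (\<Sum>x\<in>UNIV. \<Sum>u\<in>UNIV. if u = b then \<Sum>v\<in>UNIV. \<Sum>w\<in>UNIV.
        if w = b' then A $ (a, x) $ (u, v) * B $ (v, w) $ (x, a') else 0 else 0)"
    by simp
  also have "\<dots> = (\<Sum>x\<in>UNIV. mmul 3 (opn 3 1 A) (opn 3 2 B) [a, x, b'] [b, x, a'])"
    unfolding mmul_def sum_words_3
  proof (intro sum.cong refl)
    fix x u
    have "(\<Sum>v\<in>UNIV. \<Sum>w\<in>UNIV. if w = b' then A $ (a, x) $ (b, v) * B $ (v, w) $ (x, a') else 0) =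
        (\<Sum>v\<in>UNIV. \<Sum>w\<in>UNIV. opn 3 1 A [a, x, b'] [b, v, w] * opn 3 2 B [b, v, w] [b, x, a'])"
      by (intro sum.cong refl) (simp add: opn_3_entry)
    then show "(if u = b then \<Sum>v\<in>UNIV. \<Sum>w\<in>UNIV.
          if w = b' then A $ (a, x) $ (u, v) * B $ (v, w) $ (x, a') else 0 else 0) =
        (\<Sum>v\<in>UNIV. \<Sum>w\<in>UNIV. opn 3 1 A [a, x, b'] [u, v, w] * opn 3 2 B [u, v, w] [b, x, a'])"
      by (cases "u = b") (simp_all add: opn_3_entry)
  qed
  also have "\<dots> = flip $ (a, b') $ (b, a')"
    unfolding that[symmetric] by (simp add: ptrace2_def)
  finally show ?thesis by (auto simp: flip_def)
qed

lemmas skew1' = skew_entries[OF skew1] and skew2' = skew_entries[OF skew2]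

lemma skew_sum:
  fixes a' b' :: 'n and p :: "'n \<Rightarrow> 'n \<Rightarrow> complex"
  assumes "\<And>a b. (\<Sum>k\<in>UNIV. \<Sum>l\<in>UNIV. p k l * r k l a b) = (if a = a' \<and> b = b' then 1 else 0)"
  shows "(\<Sum>k\<in>UNIV. \<Sum>l\<in>UNIV. cst (p k l) * (\<Sum>a\<in>UNIV. \<Sum>b\<in>UNIV. cst (r k l a b) * f a b)) =
    (f a' b' :: 'n free_alg)"
proof -
  have "(\<Sum>k\<in>UNIV. \<Sum>l\<in>UNIV. cst (p k l) * (\<Sum>a\<in>UNIV. \<Sum>b\<in>UNIV. cst (r k l a b) * f a b)) =
      (\<Sum>(k, l)\<in>UNIV. \<Sum>(a, b)\<in>UNIV. cst (p k l * r k l a b) * f a b)"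
    unfolding UNIV_Times_UNIV[symmetric] sum.cartesian_product[symmetric]
    by (simp add: sum_distrib_left cst_mult mult.assoc)
  also have "\<dots> = (\<Sum>(a, b)\<in>UNIV. \<Sum>(k, l)\<in>UNIV. cst (p k l * r k l a b) * f a b)"
    unfolding case_prod_unfold by (rule sum.swap)
  also have "\<dots> = (\<Sum>a\<in>UNIV. \<Sum>b\<in>UNIV. cst (\<Sum>k\<in>UNIV. \<Sum>l\<in>UNIV. p k l * r k l a b) * f a b)"
    unfolding UNIV_Times_UNIV[symmetric] sum.cartesian_product[symmetric]
    by (simp add: sum_distrib_right cst_sum)
  also have "\<dots> = (\<Sum>a\<in>UNIV. \<Sum>b\<in>UNIV. if a = a' then if b = b' then f a b else 0 else 0)"
    unfolding assms by (intro sum.cong refl) simp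
  also have "\<dots> = (\<Sum>a\<in>UNIV. if a = a' then f a b' else 0)"
    by (intro sum.cong refl) simp
  finally show ?thesis by simp
qed

lemma skew_extract:
  fixes f :: "'n \<Rightarrow> 'n \<Rightarrow> 'n free_alg"
  shows "(\<Sum>k\<in>UNIV. \<Sum>l\<in>UNIV. cst (Psi $ (l, b') $ (k, a')) *
     (\<Sum>a\<in>UNIV. \<Sum>b\<in>UNIV. cst (R $ (a, k) $ (b, l)) * f a b)) = f a' b'"
  by (rule skew_sum) (use skew1' in \<open>simp add: mult.commute\<close>)

lemma skew_insert:
  fixes f :: "'n \<Rightarrow> 'n \<Rightarrow> 'n free_alg"
  shows "(\<Sum>a\<in>UNIV. \<Sum>b\<in>UNIV. cst (R $ (a, k') $ (b, l')) *
     (\<Sum>k\<in>UNIV. \<Sum>l\<in>UNIV. cst (Psi $ (l, b) $ (k, a)) * f k l)) = f k' l'"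
proof (rule skew_sum)
  fix k l
  have "(\<Sum>a\<in>UNIV. \<Sum>b\<in>UNIV. R $ (a, k') $ (b, l') * Psi $ (l, b) $ (k, a)) =
      (\<Sum>b\<in>UNIV. \<Sum>a\<in>UNIV. Psi $ (l, b) $ (k, a) * R $ (a, k') $ (b, l'))"
    by (subst sum.swap) (simp add: mult.commute)
  then show "(\<Sum>a\<in>UNIV. \<Sum>b\<in>UNIV. R $ (a, k') $ (b, l') * Psi $ (l, b) $ (k, a)) =
      (if k = k' \<and> l = l' then 1 else 0)"
    using skew2'[of l k k' l'] by auto
qed

text \<open>Summing against Psi strips an R whose indices k and l are free. Z is only a subspace
  because \<open>ZM\<close> and \<open>ZD\<close> are not yet known to be ideals when this is
  applied.\<close>

lemma skew_extract_mem:
  fixes f :: "'n \<Rightarrow> 'n \<Rightarrow> 'n free_alg"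
  assumes "\<And>x y. x \<in> Z \<Longrightarrow> y \<in> Z \<Longrightarrow> x + y \<in> Z" "0 \<in> Z" "\<And>c x. x \<in> Z \<Longrightarrow> cst c * x \<in> Z"
    and "\<And>k l. (\<Sum>a\<in>UNIV. \<Sum>b\<in>UNIV. cst (R $ (a, k) $ (b, l)) * f a b) \<in> Z"
  shows "f a b \<in> Z"
proof -
  have sum: "sum g A \<in> Z" if "\<And>x. g x \<in> Z" for g :: "'n \<Rightarrow> 'n free_alg" and A
    using assms(1,2) that by (induction A rule: infinite_finite_induct) auto
  show ?thesis
    by (subst skew_extract[of b a f, symmetric]) (intro sum assms)
qed

text \<open>t consists of the four intermediate words of the product R_1 M_1 R_1^-1 D_1 R_1^-1.
  \<open>coef\<close> collects its scalar factors, \<open>mi\<close> and \<open>di\<close> record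
  which entries of M and D occur. \<open>cf\<close> contracts these coefficients with the skew
  inverse, which solves the relation \<open>EH\<close> for the products of D with M.\<close>

definition T :: "('n list \<times> 'n list \<times> 'n list \<times> 'n list) set" where
  "T = {K. length K = 2} \<times> {K. length K = 2} \<times> {K. length K = 2} \<times> {K. length K = 2}"

definition coef :: "'n list \<Rightarrow> 'n list \<Rightarrow> 'n list \<times> 'n list \<times> 'n list \<times> 'n list \<Rightarrow> complex" where
  "coef I J = (\<lambda>(K1, K2, K3, K4). opn 2 1 R I K1 * ((if tl K1 = tl K2 then 1 else 0) *
     (minv 2 (opn 2 1 R) K2 K3 * ((if tl K3 = tl K4 then 1 else 0) * minv 2 (opn 2 1 R) K4 J))))"

definition cf :: "'n \<Rightarrow> 'n \<Rightarrow> 'n \<Rightarrow> 'n \<Rightarrow> 'n list \<times> 'n list \<times> 'n list \<times> 'n list \<Rightarrow> complex" where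
  "cf i a b j t = (\<Sum>k\<in>UNIV. \<Sum>l\<in>UNIV. Psi $ (l, b) $ (k, a) * coef [i, k] [j, l] t)"

definition mi :: "'n list \<times> 'n list \<times> 'n list \<times> 'n list \<Rightarrow> 'n \<times> 'n" where
  "mi = (\<lambda>(K1, K2, K3, K4). (hd K1, hd K2))"
definition di :: "'n list \<times> 'n list \<times> 'n list \<times> 'n list \<Rightarrow> 'n \<times> 'n" where
  "di = (\<lambda>(K1, K2, K3, K4). (hd K3, hd K4))"

sublocale exchange T cf mi di .

abbreviation "Dt t \<equiv> gD (fst (di t)) (snd (di t))"

lemma emb1_MD: "emb1 Mmat K L = cst (if tl K = tl L then 1 else 0) * gM (hd K) (hd L)"
  "emb1 Dmat K L = cst (if tl K = tl L then 1 else 0) * gD (hd K) (hd L)"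
  by (simp_all add: emb1_def Mmat_def Dmat_def)

lemma mprod_RMRDR:
  assumes "length I = 2" "length J = 2"
  shows "mprod [R1, M1, R1', D1, R1'] I J = (\<Sum>t\<in>T. cst (coef I J t) * (Mt t * Dt t))"
proof -
  define z where "z = mmul 2 R1' mid"
  have last: "z K J = R1' K J" if "length K = 2" for K
    using mmul_mid(2)[of 2 R1'] that assms by (auto simp: meq_def z_def)
  have "mprod [R1, M1, R1', D1, R1'] I J = mmul 2 R1 (mmul 2 M1 (mmul 2 R1' (mmul 2 D1 z))) I J"
    by (simp add: mprod_def z_def)
  then  have "mprod [R1, M1, R1', D1, R1'] I J = (\<Sum>K1 | length K1 = 2. R1 I K1 * (\<Sum>K2 | length K2 = 2. M1 K1 K2 *
      (\<Sum>K3 | length K3 = 2. R1' K2 K3 * (\<Sum>K4 | length K4 = 2. D1 K3 K4 * R1' K4 J))))"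
    by (simp add: mmul_def last)
  also have "\<dots> = (\<Sum>K1 | length K1 = 2. \<Sum>K2 | length K2 = 2. \<Sum>K3 | length K3 = 2. \<Sum>K4 | length K4 = 2.
      R1 I K1 * (M1 K1 K2 * (R1' K2 K3 * (D1 K3 K4 * R1' K4 J))))"
    by (simp add: sum_distrib_left)
  also have "\<dots> = (\<Sum>K1 | length K1 = 2. \<Sum>K2 | length K2 = 2. \<Sum>K3 | length K3 = 2. \<Sum>K4 | length K4 = 2.
      cst (coef I J (K1, K2, K3, K4)) * (Mt (K1, K2, K3, K4) * Dt (K1, K2, K3, K4)))"
  proof (intro sum.cong refl)
    fix K1 K2 K3 K4 :: "'n list"
    let ?r = "cst (opn 2 1 R I K1)" and ?s = "cst (minv 2 (opn 2 1 R) K2 K3)"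
      and ?t = "cst (minv 2 (opn 2 1 R) K4 J)"
      and ?u = "cst (if tl K1 = tl K2 then 1 else 0)" and ?v = "cst (if tl K3 = tl K4 then 1 else 0)"
      and ?m = "gM (hd K1) (hd K2)" and ?d = "gD (hd K3) (hd K4)"
    have "?r * (?u * ?m * (?s * (?v * ?d * ?t))) = ?r * (?u * (?m * (?s * (?v * (?t * ?d)))))"
      by (simp only: mult.assoc cst_central[of "minv 2 (opn 2 1 R) K4 J" ?d])
    also have "\<dots> = ?r * (?u * (?s * (?v * (?t * (?m * ?d)))))"
      by (simp only: cst_gen)
    finally show "R1 I K1 * (M1 K1 K2 * (R1' K2 K3 * (D1 K3 K4 * R1' K4 J))) =
      cst (coef I J (K1, K2, K3, K4)) * (Mt (K1, K2, K3, K4) * Dt (K1, K2, K3, K4))"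
      by (simp only: emb1_MD cmat_def coef_def mi_def di_def cst_mult prod.case fst_conv snd_conv
          mult.assoc flip: cst_def)
  qed
  finally show ?thesis
    unfolding T_def sum.cartesian_product by (simp add: case_prod_unfold)
qed

lemma mprod_DRM:
  "mprod [D1, R1, M1] [i, k] [j, l] =
    (\<Sum>a\<in>UNIV. \<Sum>b\<in>UNIV. cst (R $ (a, k) $ (b, l)) * (gD i a * gM b j))"
proof -
  define z where "z = mmul 2 M1 mid"
  have last: "z K [j, l] = M1 K [j, l]" if "length K = 2" for K
    using mmul_mid(2)[of 2 M1] that by (auto simp: meq_def z_def)
  have "mprod [D1, R1, M1] [i, k] [j, l] = mmul 2 D1 (mmul 2 R1 z) [i, k] [j, l]"
    by (simp add: mprod_def z_def)
  then  have "mprod [D1, R1, M1] [i, k] [j, l] = (\<Sum>K1 | length K1 = 2. D1 [i, k] K1 *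
      (\<Sum>K2 | length K2 = 2. R1 K1 K2 * M1 K2 [j, l]))"
    by (simp add: mmul_def last)
  also have "\<dots> = (\<Sum>a\<in>UNIV. \<Sum>k'\<in>UNIV. if k' = k then gD i a *
      (\<Sum>b\<in>UNIV. \<Sum>l'\<in>UNIV. if l' = l then cst (R $ (a, k') $ (b, l')) * gM b j else 0) else 0)"
    unfolding sum_words_2
  proof (intro sum.cong refl)
    fix a k'
    have "(\<Sum>b\<in>UNIV. \<Sum>l'\<in>UNIV. if l' = l then cst (R $ (a, k') $ (b, l')) * gM b j else 0) =
        (\<Sum>b\<in>UNIV. \<Sum>l'\<in>UNIV. R1 [a, k'] [b, l'] * M1 [b, l'] [j, l])"
      by (intro sum.cong refl) (simp add: emb1_def Mmat_def cmat_def opn_2_entry cst_def)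
    then show "D1 [i, k] [a, k'] * (\<Sum>b\<in>UNIV. \<Sum>l'\<in>UNIV. R1 [a, k'] [b, l'] * M1 [b, l'] [j, l]) =
        (if k' = k then gD i a *
          (\<Sum>b\<in>UNIV. \<Sum>l'\<in>UNIV. if l' = l then cst (R $ (a, k') $ (b, l')) * gM b j else 0) else 0)"
      by (simp only:) (simp add: emb1_def Dmat_def)
  qed
  also have "\<dots> = (\<Sum>a\<in>UNIV. \<Sum>b\<in>UNIV. cst (R $ (a, k) $ (b, l)) * (gD i a * gM b j))"
    by (simp add: sum_distrib_left cst_gen)
  finally show ?thesis .
qed

lemma EH_entry: "EH [i, k] [j, l] =
    (\<Sum>a\<in>UNIV. \<Sum>b\<in>UNIV. cst (R $ (a, k) $ (b, l)) * (gD i a * gM b j)) -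
    (\<Sum>t\<in>T. cst (coef [i, k] [j, l] t) * (Mt t * Dt t))"
  unfolding EH_def mprod_DRM by (subst mprod_RMRDR) simp_all

lemma cf_sum:
  fixes f :: "_ \<Rightarrow> 'n free_alg"
  shows "(\<Sum>t\<in>T. cst (cf i a b j t) * f t) =
    (\<Sum>k\<in>UNIV. \<Sum>l\<in>UNIV. cst (Psi $ (l, b) $ (k, a)) * (\<Sum>t\<in>T. cst (coef [i, k] [j, l] t) * f t))"
proof -
  have "(\<Sum>t\<in>T. cst (cf i a b j t) * f t) = (\<Sum>t\<in>T. \<Sum>k\<in>UNIV. \<Sum>l\<in>UNIV.
      cst (Psi $ (l, b) $ (k, a)) * (cst (coef [i, k] [j, l] t) * f t))"
    by (simp add: cf_def cst_sum cst_mult sum_distrib_right mult.assoc)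
  also have "\<dots> = (\<Sum>k\<in>UNIV. \<Sum>t\<in>T. \<Sum>l\<in>UNIV.
      cst (Psi $ (l, b) $ (k, a)) * (cst (coef [i, k] [j, l] t) * f t))"
    by (rule sum.swap)
  also have "\<dots> = (\<Sum>k\<in>UNIV. \<Sum>l\<in>UNIV. \<Sum>t\<in>T.
      cst (Psi $ (l, b) $ (k, a)) * (cst (coef [i, k] [j, l] t) * f t))"
    by (intro sum.cong refl sum.swap)
  finally show ?thesis by (simp add: sum_distrib_left)
qed

section \<open>The ideal of the homogeneous permutation relations\<close>

abbreviation (input) "P \<equiv> Idl\<^bsub>ring_of_type_algebra\<^esub> (rels_perm_hom R)"

lemma P_ideal: "two_sided_ideal P"
  by (rule two_sided_ideal_genideal)

lemma EH_mem: "EH [i, k] [j, l] \<in> P"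
  using subset_genideal[of "rels_perm_hom R"] by (force simp: rels_entries entries_def)

text \<open>Contracting \<open>EH\<close> with the skew inverse isolates the product of D with M, by
  \<open>skew1\<close>.\<close>

lemma exchange_mem_P: "gD i a * gM b j - (\<Sum>t\<in>T. cst (cf i a b j t) * (Mt t * Dt t)) \<in> P"
proof -
  have "gD i a * gM b j - (\<Sum>t\<in>T. cst (cf i a b j t) * (Mt t * Dt t)) =
      (\<Sum>k\<in>UNIV. \<Sum>l\<in>UNIV. cst (Psi $ (l, b) $ (k, a)) * EH [i, k] [j, l])"
    unfolding EH_entry cf_sum right_diff_distrib sum_subtractf skew_extract ..
  also have "\<dots> \<in> P"
    by (intro two_sided_ideal_sum two_sided_idealD(3) P_ideal EH_mem)
  finally show ?thesis .
qed

text \<open>Conversely, inserting the exchange rule into the left side of \<open>EH\<close>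
  contracts R with Psi, by \<open>skew2\<close>, and returns the right side.\<close>

lemma N_EH: "N (EH [i, k] [j, l] * y) = 0"
proof -
  define f where "f t = Mt t * Ld (fst (di t)) (snd (di t)) (N y)" for t
  have "N (EH [i, k] [j, l] * y) =
      (\<Sum>a\<in>UNIV. \<Sum>b\<in>UNIV. cst (R $ (a, k) $ (b, l)) * (\<Sum>t\<in>T. cst (cf i a b j t) * f t)) -
      (\<Sum>t\<in>T. cst (coef [i, k] [j, l] t) * f t)"
    by (simp add: EH_entry left_diff_distrib sum_distrib_right mult.assoc N_diff N_sum N_cst N_M N_D Ld_M f_def)
  then show ?thesis
    unfolding cf_sum by (simp add: skew_insert)
qed

lemma N_P: "x \<in> P \<Longrightarrow> N x = 0"
  by (rule N_genideal_zero) (auto simp: rels_entries entries_def length_2_conv N_EH)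

text \<open>\<open>ZM\<close> and \<open>ZD\<close> describe the two-sided ideals generated by \<open>P\<close> and the relations of \<open>\<M>(R)\<close>,
  respectively \<open>\<D>(R\<^sup>-\<^sup>1)\<close>, with only entries of \<open>M\<close> to the left, respectively of \<open>D\<close> to the right, of a
  relation. In this shape the value of \<open>N\<close> is visible.\<close>

inductive_set ZM :: "'n free_alg set" where
  P: "x \<in> P \<Longrightarrow> x \<in> ZM"
| add: "x \<in> ZM \<Longrightarrow> y \<in> ZM \<Longrightarrow> x + y \<in> ZM"
| rel: "x \<in> rels_M R \<Longrightarrow> x * y \<in> ZM"
| mul: "x \<in> ZM \<Longrightarrow> gM i j * x \<in> ZM"

inductive_set ZD :: "'n free_alg set" where
  P: "x \<in> P \<Longrightarrow> x \<in> ZD"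
| add: "x \<in> ZD \<Longrightarrow> y \<in> ZD \<Longrightarrow> x + y \<in> ZD"
| rel: "x \<in> rels_D R \<Longrightarrow> y * x \<in> ZD"
| mul: "x \<in> ZD \<Longrightarrow> x * gD i j \<in> ZD"

lemma ZM_0 [simp]: "0 \<in> ZM" and ZD_0 [simp]: "0 \<in> ZD"
  using two_sided_idealD(1)[OF P_ideal] by (auto intro: ZM.P ZD.P)

lemma ZM_right: "x \<in> ZM \<Longrightarrow> x * y \<in> ZM"
  by (induction rule: ZM.induct)
    (auto simp: distrib_right mult.assoc intro: ZM.intros two_sided_idealD(4)[OF P_ideal])

lemma ZD_left: "x \<in> ZD \<Longrightarrow> y * x \<in> ZD"
proof (induction rule: ZD.induct)
  case (rel x z)
  then show ?case using ZD.rel[of x "y * z"] by (simp add: mult.assoc)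
next
  case (mul x i j)
  then show ?case using ZD.mul[of "y * x"] by (simp add: mult.assoc)
qed (auto simp: distrib_left intro: ZD.intros two_sided_idealD(3)[OF P_ideal])

lemma ZM_cst: "x \<in> ZM \<Longrightarrow> cst c * x \<in> ZM"
  by (simp only: cst_central ZM_right)

lemma ZD_cst: "x \<in> ZD \<Longrightarrow> cst c * x \<in> ZD"
  by (rule ZD_left)

lemma ZM_sum: "(\<And>i. i \<in> A \<Longrightarrow> f i \<in> ZM) \<Longrightarrow> sum f A \<in> ZM"
  by (induction A rule: infinite_finite_induct) (auto intro: ZM.add)

lemma ZD_sum: "(\<And>i. i \<in> A \<Longrightarrow> f i \<in> ZD) \<Longrightarrow> sum f A \<in> ZD"
  by (induction A rule: infinite_finite_induct) (auto intro: ZD.add)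

lemma EM_ZM: "length I = 2 \<Longrightarrow> length J = 2 \<Longrightarrow> EM I J \<in> ZM"
  using ZM.rel[of "EM I J" 1] by (auto simp: rels_entries entries_def)

lemma ED_ZD: "length I = 2 \<Longrightarrow> length J = 2 \<Longrightarrow> ED I J \<in> ZD"
  using ZD.rel[of "ED I J" 1] by (auto simp: rels_entries entries_def)

section \<open>Moving a generator past the relations of the other algebra\<close>

lemma sum_swap4:
  "(\<Sum>a\<in>A. \<Sum>b\<in>B. \<Sum>u\<in>U. \<Sum>v\<in>V. h a b u v) =
   (\<Sum>u\<in>U. \<Sum>v\<in>V. \<Sum>a\<in>A. \<Sum>b\<in>B. (h a b u v :: 'b::comm_monoid_add))"
proof -
  have "(\<Sum>a\<in>A. \<Sum>b\<in>B. \<Sum>u\<in>U. \<Sum>v\<in>V. h a b u v) = (\<Sum>a\<in>A. \<Sum>u\<in>U. \<Sum>b\<in>B. \<Sum>v\<in>V. h a b u v)"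
    by (rule sum.cong[OF refl], rule sum.swap)
  also have "\<dots> = (\<Sum>u\<in>U. \<Sum>a\<in>A. \<Sum>v\<in>V. \<Sum>b\<in>B. h a b u v)"
    by (subst sum.swap, rule sum.cong[OF refl], rule sum.cong[OF refl], rule sum.swap)
  also have "\<dots> = (\<Sum>u\<in>U. \<Sum>v\<in>V. \<Sum>a\<in>A. \<Sum>b\<in>B. h a b u v)"
    by (rule sum.cong[OF refl], rule sum.swap)
  finally show ?thesis .
qed

text \<open>\<open>d_rho\<close> moves D past the relation only in the presence of
  \<open>r 0 * r 1\<close>, which mixes the indices. The outer indices of these factors are free, so
  skew-invertibility removes first \<open>r 1\<close> and then \<open>r 0\<close>.\<close>

lemma D_rel_M: "gD i a * EM [b, c] [j, l] \<in> ZM"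
proof -
  interpret ring_congruence "block_ideal 3 P :: ('n, 'n free_alg) bmat set"
    by (rule ring_congruence.intro[OF two_sided_ideal_block[OF P_ideal]])
  obtain w where w: "df 3 * rf 3 0 * rf 3 1 * lf 3 EM - rf 3 0 * rf 3 1 * lf 3 EM * w \<in> block_ideal 3 P"
    using hom_perm_rep.d_rho[OF hom_perm_rep_3[OF P_ideal subset_genideal]] lf_rels(1)[of 3]
    by (auto simp: cong_def)
  have mem: "ent (df 3 * (rf 3 0 * (rf 3 (Suc 0) * lf 3 EM))) I J \<in> ZM"
    if IJ: "length I = 3" "length J = 3" for I J
  proof -
    have EM: "ent (lf 3 EM) I J \<in> ZM" if "length I = 3" for I J
      using that by (cases "length J = 3") (auto simp: ent_lf ent_neq intro: EM_ZM)
    have r: "ent (rf 3 i * A) I J \<in> ZM" if "\<And>I J. length I = 3 \<Longrightarrow> ent A I J \<in> ZM" "length I = 3"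
      for i A I J
      unfolding ent_mult rf_def ent_cbm by (intro ZM_sum ZM_cst that(1)) (use that(2) in simp)
    have "ent (rf 3 0 * (rf 3 (Suc 0) * lf 3 EM)) I K \<in> ZM" for K
      using IJ by (intro r EM)
    then have "ent (rf 3 0 * (rf 3 (Suc 0) * lf 3 EM) * w) I J \<in> ZM"
      unfolding ent_mult[of _ w] by (intro ZM_sum ZM_right)
    moreover have "ent (df 3 * (rf 3 0 * (rf 3 (Suc 0) * lf 3 EM))) I J -
        ent (rf 3 0 * (rf 3 (Suc 0) * lf 3 EM) * w) I J \<in> ZM"
      using w IJ by (auto simp: block_ideal_def mult.assoc intro: ZM.P)
    ultimately show ?thesis
      using ZM.add by fastforce
  qed
  have split: "ent (df 3 * (rf 3 0 * (rf 3 (Suc 0) * lf 3 EM))) [i, y, z] [j, l, k] =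
    (\<Sum>u\<in>UNIV. \<Sum>v\<in>UNIV. cst (R $ (u, z) $ (v, k)) *
      (\<Sum>a\<in>UNIV. \<Sum>b\<in>UNIV. cst (R $ (a, y) $ (b, u)) * (gD i a * EM [b, v] [j, l])))" for y z k
  proof -
    have "(\<Sum>v\<in>UNIV. \<Sum>w\<in>UNIV. cst (R $ (u, z) $ (v, w)) * ent (lf 3 EM) [b, v, w] [j, l, k]) =
        (\<Sum>v\<in>UNIV. \<Sum>w\<in>UNIV. if w = k then cst (R $ (u, z) $ (v, w)) * EM [b, v] [j, l] else 0)" for u b
      by (intro sum.cong refl) (simp add: ent_lf)
    then have "ent (df 3 * (rf 3 0 * (rf 3 (Suc 0) * lf 3 EM))) [i, y, z] [j, l, k] =
      (\<Sum>a\<in>UNIV. gD i a * (\<Sum>b\<in>UNIV. \<Sum>u\<in>UNIV. cst (R $ (a, y) $ (b, u)) *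
        (\<Sum>v\<in>UNIV. cst (R $ (u, z) $ (v, k)) * EM [b, v] [j, l])))"
      by (simp add: ent_df_mult ent_rf_mult)
    also have "\<dots> = (\<Sum>a\<in>UNIV. \<Sum>b\<in>UNIV. \<Sum>u\<in>UNIV. \<Sum>v\<in>UNIV.
        cst (R $ (u, z) $ (v, k)) * (cst (R $ (a, y) $ (b, u)) * (gD i a * EM [b, v] [j, l])))"
      by (simp add: sum_distrib_left cst_gen cst_swap)
    also have "\<dots> = (\<Sum>u\<in>UNIV. \<Sum>v\<in>UNIV. \<Sum>a\<in>UNIV. \<Sum>b\<in>UNIV.
        cst (R $ (u, z) $ (v, k)) * (cst (R $ (a, y) $ (b, u)) * (gD i a * EM [b, v] [j, l])))"
      by (rule sum_swap4)
    finally show ?thesis by (simp add: sum_distrib_left)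
  qed
  note ex = skew_extract_mem[where Z = ZM, OF ZM.add ZM_0 ZM_cst]
  have 1: "(\<Sum>a\<in>UNIV. \<Sum>b\<in>UNIV. cst (R $ (a, y) $ (b, u)) * (gD i a * EM [b, v] [j, l])) \<in> ZM" for y u v
    by (rule ex[where f = "\<lambda>u v. \<Sum>a\<in>UNIV. \<Sum>b\<in>UNIV. cst (R $ (a, y) $ (b, u)) * (gD i a * EM [b, v] [j, l])"])
      (simp_all add: split[symmetric] mem)
  show ?thesis
    by (rule ex[where f = "\<lambda>a b. gD i a * EM [b, c] [j, l]"]) (simp_all add: 1)
qed

lemma ZD_right_cst: "x \<in> ZD \<Longrightarrow> x * cst c \<in> ZD"
  by (simp only: cst_central[symmetric] ZD_cst)

lemma rel_D_M: "ED [i, a] [b, c] * gM j l \<in> ZD"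
proof -
  interpret ring_congruence "block_ideal 3 P :: ('n, 'n free_alg) bmat set"
    by (rule ring_congruence.intro[OF two_sided_ideal_block[OF P_ideal]])
  \<comment> \<open>All factors to the right of the relation are complex matrices. This matters
    because \<open>ZD\<close> is not yet known to be stable under right multiplication by M, but it
    is stable under scalars.\<close>
  define w where "w = sc 3 1 * (sc 3 1 * (sc 3 0 * (sc 3 1 * (sc 3 1 * (rc 3 0 * (rc 3 1 * rc 3 0))))))"
  obtain x where w: "lf 3 ED * rf 3 1 * rf 3 0 * mf 3 - x * lf 3 ED * cbm w \<in> block_ideal 3 P"
    using hom_perm_rep.tau_m[OF hom_perm_rep_3[OF P_ideal subset_genideal]] lf_rels(2)[of 3]
    by (auto simp: cong_def w_def cbm_mult rf_def sf_def)
  have mem: "ent (lf 3 ED * rf 3 (Suc 0) * rf 3 0 * mf 3) I J \<in> ZD"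
    if IJ: "length I = 3" "length J = 3" for I J
  proof -
    have ED: "ent (lf 3 ED) I J \<in> ZD" if "length J = 3" for I J
      using that by (cases "length I = 3") (auto simp: ent_lf ent_neq intro: ED_ZD)
    have "ent (x * lf 3 ED) I K \<in> ZD" if "length K = 3" for K
      unfolding ent_mult[of x] using that by (intro ZD_sum ZD_left ED)
    then have "ent (x * lf 3 ED * cbm w) I J \<in> ZD"
      unfolding ent_mult[of _ "cbm w"] using IJ by (intro ZD_sum) (simp add: ZD_right_cst)
    moreover have "ent (lf 3 ED * rf 3 (Suc 0) * rf 3 0 * mf 3) I J - ent (x * lf 3 ED * cbm w) I J \<in> ZD"
      using w IJ by (auto simp: block_ideal_def intro: ZD.P)
    ultimately show ?thesis
      using ZD.add by fastforce
  qed
  have split: "ent (lf 3 ED * rf 3 (Suc 0) * rf 3 0 * mf 3) [i, a, k] [l, y, z] =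
    (\<Sum>p\<in>UNIV. \<Sum>v\<in>UNIV. cst (R $ (p, k) $ (v, z)) *
      (\<Sum>u\<in>UNIV. \<Sum>e\<in>UNIV. cst (R $ (u, v) $ (e, y)) * (ED [i, a] [u, p] * gM e l)))" for y z k
  proof -
    have "(\<Sum>p\<in>UNIV. \<Sum>w\<in>UNIV. cst (R $ (p, w) $ (v, z)) * ent (lf 3 ED) [i, a, k] [u, p, w]) =
        (\<Sum>p\<in>UNIV. \<Sum>w\<in>UNIV. if w = k then cst (R $ (p, w) $ (v, z)) * ED [i, a] [u, p] else 0)" for u v
      by (intro sum.cong refl) (simp add: ent_lf)
    then have "ent (lf 3 ED * rf 3 (Suc 0) * rf 3 0 * mf 3) [i, a, k] [l, y, z] =
      (\<Sum>e\<in>UNIV. (\<Sum>u\<in>UNIV. \<Sum>v\<in>UNIV. cst (R $ (u, v) $ (e, y)) *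
        (\<Sum>p\<in>UNIV. cst (R $ (p, k) $ (v, z)) * ED [i, a] [u, p])) * gM e l)"
      by (simp add: ent_mult_mf ent_mult_rf)
    also have "\<dots> = (\<Sum>e\<in>UNIV. \<Sum>u\<in>UNIV. \<Sum>v\<in>UNIV. \<Sum>p\<in>UNIV.
        cst (R $ (p, k) $ (v, z)) * (cst (R $ (u, v) $ (e, y)) * (ED [i, a] [u, p] * gM e l)))"
      by (simp add: sum_distrib_left sum_distrib_right cst_swap mult.assoc)
    also have "\<dots> = (\<Sum>v\<in>UNIV. \<Sum>p\<in>UNIV. \<Sum>e\<in>UNIV. \<Sum>u\<in>UNIV.
        cst (R $ (p, k) $ (v, z)) * (cst (R $ (u, v) $ (e, y)) * (ED [i, a] [u, p] * gM e l)))"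
      by (rule sum_swap4)
    also have "\<dots> = (\<Sum>p\<in>UNIV. \<Sum>v\<in>UNIV. \<Sum>e\<in>UNIV. \<Sum>u\<in>UNIV.
        cst (R $ (p, k) $ (v, z)) * (cst (R $ (u, v) $ (e, y)) * (ED [i, a] [u, p] * gM e l)))"
      by (rule sum.swap)
    also have "\<dots> = (\<Sum>p\<in>UNIV. \<Sum>v\<in>UNIV. \<Sum>u\<in>UNIV. \<Sum>e\<in>UNIV.
        cst (R $ (p, k) $ (v, z)) * (cst (R $ (u, v) $ (e, y)) * (ED [i, a] [u, p] * gM e l)))"
      by (intro sum.cong refl sum.swap)
    finally show ?thesis by (simp add: sum_distrib_left)
  qed
  note ex = skew_extract_mem[where Z = ZD, OF ZD.add ZD_0 ZD_cst]
  have 1: "(\<Sum>u\<in>UNIV. \<Sum>e\<in>UNIV. cst (R $ (u, v) $ (e, y)) * (ED [i, a] [u, p] * gM e l)) \<in> ZD" for y v p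
    by (rule ex[where f = "\<lambda>p v. \<Sum>u\<in>UNIV. \<Sum>e\<in>UNIV. cst (R $ (u, v) $ (e, y)) * (ED [i, a] [u, p] * gM e l)"])
      (simp_all add: split[symmetric] mem)
  show ?thesis
    by (rule ex[where f = "\<lambda>u e. ED [i, a] [u, c] * gM e l"]) (simp_all add: 1)
qed

text \<open>Modulo P, D is exchanged with the M in front of x; each resulting term contains some D
  times x, to which the induction hypothesis applies. A relation in front is handled by
  \<open>D_rel_M\<close>.\<close>

lemma ZM_D: "x \<in> ZM \<Longrightarrow> gD i a * x \<in> ZM"
proof (induction arbitrary: i a rule: ZM.induct)
  case (rel x y)
  then obtain b c j l where "x = EM [b, c] [j, l]"
    by (auto simp: rels_entries entries_def length_2_conv)
  then show ?case using ZM_right[OF D_rel_M] by (simp add: mult.assoc)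
next
  case (mul x b j)
  let ?s = "\<Sum>t\<in>T. cst (cf i a b j t) * (Mt t * Dt t)"
  have "gD i a * (gM b j * x) = (gD i a * gM b j - ?s) * x + ?s * x"
    by (simp add: algebra_simps)
  also have "?s * x = (\<Sum>t\<in>T. cst (cf i a b j t) * (Mt t * (Dt t * x)))"
    by (simp add: sum_distrib_right mult.assoc)
  also have "(gD i a * gM b j - ?s) * x + \<dots> \<in> ZM"
    by (intro ZM.add ZM_sum ZM_cst ZM.mul mul ZM.P two_sided_idealD(4)[OF P_ideal] exchange_mem_P)
  finally show ?case .
qed (auto simp: distrib_left intro: ZM.intros two_sided_idealD(3)[OF P_ideal])

lemma ZD_M: "x \<in> ZD \<Longrightarrow> x * gM b j \<in> ZD"
proof (induction arbitrary: b j rule: ZD.induct)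
  case (rel x y)
  then obtain i a c l where "x = ED [i, a] [c, l]"
    by (auto simp: rels_entries entries_def length_2_conv)
  then show ?case using ZD_left[OF rel_D_M] by (simp add: mult.assoc)
next
  case (mul x i a)
  let ?s = "\<Sum>t\<in>T. cst (cf i a b j t) * (Mt t * Dt t)"
  have "x * gD i a * gM b j = x * (gD i a * gM b j - ?s) + x * ?s"
    by (simp add: algebra_simps)
  also have "x * ?s = (\<Sum>t\<in>T. cst (cf i a b j t) * (x * Mt t * Dt t))"
    by (simp add: sum_distrib_left mult.assoc cst_left_commute[of x])
  also have "x * (gD i a * gM b j - ?s) + \<dots> \<in> ZD"
    by (intro ZD.add ZD_sum ZD_cst ZD.mul mul ZD.P two_sided_idealD(3)[OF P_ideal] exchange_mem_P)
  finally show ?case .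
qed (auto simp: distrib_right intro: ZD.intros two_sided_idealD(4)[OF P_ideal])

lemma ZM_left:
  assumes "x \<in> ZM"
  shows "y * x \<in> ZM"
proof (induction y rule: free_alg_induct)
  case (word c w)
  have "wd w * x \<in> ZM"
  proof (induction w)
    case (Cons g w)
    then show ?case by (cases g) (simp_all add: wd_Cons mult.assoc ZM.mul ZM_D)
  qed (simp add: wd_Nil assms)
  then show ?case by (simp add: mult.assoc ZM_cst)
qed (simp add: distrib_right ZM.add)

lemma ZD_right:
  assumes "x \<in> ZD"
  shows "x * y \<in> ZD"
proof (induction y rule: free_alg_induct)
  case (word c w)
  have "x * wd w \<in> ZD"
  proof (induction w rule: rev_induct)
    case (snoc g w)
    then show ?case
      by (cases g) (simp_all add: wd_append wd_Cons wd_Nil ZD.mul ZD_M flip: mult.assoc)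
  qed (simp add: wd_Nil assms)
  then show ?case by (simp add: cst_left_commute[of x] ZD_cst)
qed (simp add: distrib_left ZD.add)

text \<open>\<open>ZM\<close> and \<open>ZD\<close> are kept apart because \<open>N\<close> respects
  left factors from M on the first and right factors from D on the second. Their sum is a two-sided
  ideal containing all generators.\<close>

lemma hom_ideal_subset:
  assumes "x \<in> hom_ideal R"
  shows "\<exists>y\<in>ZM. \<exists>z\<in>ZD. x = y + z"
proof -
  let ?K = "{x. \<exists>y\<in>ZM. \<exists>z\<in>ZD. x = y + z}"
  have "two_sided_ideal ?K"
    unfolding two_sided_ideal_def
  proof (intro conjI ballI allI)
    show "0 \<in> ?K" by (auto intro!: bexI[of _ 0])
    fix x assume "x \<in> ?K"
    then obtain y z where x: "x = y + z" "y \<in> ZM" "z \<in> ZD" by auto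
    show "a * x \<in> ?K" and "x * a \<in> ?K" for a
      using x by (auto simp: distrib_left distrib_right intro: ZM_left ZM_right ZD_left ZD_right)
    fix x' assume "x' \<in> ?K"
    then obtain y' z' where x': "x' = y' + z'" "y' \<in> ZM" "z' \<in> ZD" by auto
    have "x + x' = (y + y') + (z + z')" using x x' by (simp add: algebra_simps)
    then show "x + x' \<in> ?K" using x x' ZM.add ZD.add by blast
  qed
  moreover have "rels_M R \<union> rels_D R \<union> rels_perm_hom R \<subseteq> ?K"
  proof
    fix x assume "x \<in> rels_M R \<union> rels_D R \<union> rels_perm_hom R"
    then have "x \<in> ZM \<or> x \<in> ZD"
      using ZM.rel[of x 1] ZD.rel[of x 1] ZM.P[of x] subset_genideal[of "rels_perm_hom R"] by auto
    then show "x \<in> ?K" using ZM_0 ZD_0 by force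
  qed
  ultimately show ?thesis
    using genideal_least assms unfolding hom_ideal_def by blast
qed

text \<open>Entries of polynomial expressions in scalar matrices and one of \<open>mf\<close>,
  \<open>df\<close> lie in every subalgebra that contains the entries of that matrix. Both the
  relations and the ordered factors are treated this way without expanding their entries.\<close>

definition subalg :: "'n free_alg set \<Rightarrow> bool" where
  "subalg A \<longleftrightarrow> (\<forall>c. cst c \<in> A) \<and> (\<forall>x\<in>A. \<forall>y\<in>A. x + y \<in> A \<and> x * y \<in> A)"

lemma subalg_ents:
  assumes A: "subalg A"
  shows "\<lbrakk>\<And>I J. ent S I J \<in> A; \<And>I J. ent S' I J \<in> A\<rbrakk> \<Longrightarrow> ent (S * S') I J \<in> A"
    and "\<lbrakk>\<And>I J. ent S I J \<in> A; \<And>I J. ent S' I J \<in> A\<rbrakk> \<Longrightarrow> ent (S - S') I J \<in> A"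
    and "ent (rf n i) I J \<in> A" and "ent (sf n i) I J \<in> A" and "ent 1 I J \<in> A"
    and "(\<And>i j. gM i j \<in> A) \<Longrightarrow> ent (mf n) I J \<in> A"
    and "(\<And>i j. gD i j \<in> A) \<Longrightarrow> ent (df n) I J \<in> A"
proof -
  have c: "cst c \<in> A" for c using A by (simp add: subalg_def)
  have 0: "0 \<in> A" and 1: "1 \<in> A" using c[of 0] c[of 1] by simp_all
  have add: "x + y \<in> A" and mult: "x * y \<in> A" if "x \<in> A" "y \<in> A" for x y
    using A that by (auto simp: subalg_def)
  have sum: "(\<And>x. x \<in> B \<Longrightarrow> f x \<in> A) \<Longrightarrow> sum f B \<in> A" for f :: "'n list \<Rightarrow> _" and B
    by (induction B rule: infinite_finite_induct) (auto intro: 0 add)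
  show "ent (S * S') I J \<in> A" if "\<And>I J. ent S I J \<in> A" "\<And>I J. ent S' I J \<in> A"
    using that by (auto simp: ent_mult intro!: sum mult)
  have "cst (- 1) = (- 1 :: 'n free_alg)"
    using cst_diff[of 0 1] by simp
  then have "x - y \<in> A" if "x \<in> A" "y \<in> A" for x y
    using add[OF that(1) mult[OF c[of "- 1"] that(2)]] by simp
  then show "ent (S - S') I J \<in> A" if "\<And>I J. ent S I J \<in> A" "\<And>I J. ent S' I J \<in> A"
    using that by simp
  show "ent (rf n i) I J \<in> A" "ent (sf n i) I J \<in> A"
    using c by (simp_all add: rf_def sf_def)
  show "ent 1 I J \<in> A" using 0 1 by simp
  show "ent (mf n) I J \<in> A" if "\<And>i j. gM i j \<in> A"
    using that 0 by (auto simp: mf_def blk.rep_eq emb1_def Mmat_def)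
  show "ent (df n) I J \<in> A" if "\<And>i j. gD i j \<in> A"
    using that 0 by (auto simp: df_def blk.rep_eq emb1_def Dmat_def)
qed

lemma subalg_rels:
  assumes "subalg A"
  shows "(\<And>i j. gM i j \<in> A) \<Longrightarrow> rels_M R \<subseteq> A" and "(\<And>i j. gD i j \<in> A) \<Longrightarrow> rels_D R \<subseteq> A"
proof -
  have "EM I J = ent (lf 2 EM) I J" "ED I J = ent (lf 2 ED) I J" if "length I = 2" "length J = 2" for I J
    using that by (simp_all add: ent_lf)
  moreover have "ent (lf 2 EM) I J \<in> A" if "\<And>i j. gM i j \<in> A" for I J
    unfolding lf_rels(1)[OF order_refl] using that by (intro subalg_ents[OF assms])
  moreover have "ent (lf 2 ED) I J \<in> A" if "\<And>i j. gD i j \<in> A" for I J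
    unfolding lf_rels(2)[OF order_refl] using that by (intro subalg_ents[OF assms])
  ultimately show "(\<And>i j. gM i j \<in> A) \<Longrightarrow> rels_M R \<subseteq> A" "(\<And>i j. gD i j \<in> A) \<Longrightarrow> rels_D R \<subseteq> A"
    by (auto simp: rels_entries entries_def)
qed

text \<open>\<open>N\<close> is left linear over the entries of M by \<open>N_M\<close>, and the
  elements over which it is left linear form a subalgebra.\<close>

lemma N_rels_M: "x \<in> rels_M R \<Longrightarrow> N (x * y) = x * N y"
proof -
  have "subalg {x. \<forall>y. N (x * y) = x * N y}"
    by (auto simp: subalg_def N_cst N_add distrib_right mult.assoc)
  from subalg_rels(1)[OF this] show "x \<in> rels_M R \<Longrightarrow> N (x * y) = x * N y"
    by (auto simp: N_M)
qed

lemma N_rels_D: "x \<in> rels_D R \<Longrightarrow> N (y * x) = N y * x"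
proof -
  have "subalg {x. \<forall>y. N (y * x) = N y * x}"
    by (auto simp: subalg_def N_cst N_add distrib_left simp flip: cst_central mult.assoc)
  from subalg_rels(2)[OF this] show "x \<in> rels_D R \<Longrightarrow> N (y * x) = N y * x"
    by (auto simp: N_right_D)
qed

text \<open>E is left general because it will be \<open>double_ideal R\<close>, whereas x comes from
  a different ideal: the relations of M and of D are what the two ideals share.\<close>

lemma N_hom_ideal:
  assumes E: "two_sided_ideal E" "rels_M R \<subseteq> E" "rels_D R \<subseteq> E" and "x \<in> hom_ideal R"
  shows "N x \<in> E"
proof -
  note ideal = two_sided_idealD[OF E(1)]
  have "N y \<in> E" if "y \<in> ZM" for y
    using that
  proof (induction rule: ZM.induct)
    case (rel x y)
    then show ?case using E(2) by (auto simp: N_rels_M intro: ideal)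
  qed (auto simp: N_P N_add N_M intro: ideal)
  moreover have "N z \<in> E" if "z \<in> ZD" for z
    using that
  proof (induction rule: ZD.induct)
    case (rel x y)
    then show ?case using E(3) by (auto simp: N_rels_D intro: ideal)
  qed (auto simp: N_P N_add N_right_D intro: ideal)
  ultimately show ?thesis
    using hom_ideal_subset[OF assms(4)] ideal(2) by (auto simp: N_add)
qed

end

section \<open>Ordered expressions and the projection to the quantum double\<close>

lemma ordered_add: "ordered_expr x \<Longrightarrow> ordered_expr y \<Longrightarrow> ordered_expr (x + y)"
  unfolding ordered_expr_def using keys_add[of x y] by blast

lemma ordered_mult:
  assumes "\<And>u v. u \<in> Poly_Mapping.keys x \<Longrightarrow> v \<in> Poly_Mapping.keys y \<Longrightarrow> \<exists>ms ds.
     letters u @ letters v = map (\<lambda>(i, j). GenM i j) ms @ map (\<lambda>(i, j). GenD i j) ds"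
  shows "ordered_expr (x * y)"
  unfolding ordered_expr_def
proof
  fix w assume "w \<in> Poly_Mapping.keys (x * y)"
  then obtain u v where "w = u + v" "u \<in> Poly_Mapping.keys x" "v \<in> Poly_Mapping.keys y"
    using keys_mult[of x y] by auto
  then show "\<exists>ms ds. letters w = map (\<lambda>(i, j). GenM i j) ms @ map (\<lambda>(i, j). GenD i j) ds"
    using assms by (simp add: plus_gen_word_def)
qed

lemma ordered_cst: "ordered_expr x \<Longrightarrow> ordered_expr (cst c * x)"
  by (rule ordered_mult) (auto simp: ordered_expr_def cst_def zero_gen_word_def split: if_splits)

lemma ordered_gM: "ordered_expr x \<Longrightarrow> ordered_expr (gen_elem (GenM i j) * x)"
proof (rule ordered_mult)
  fix u v assume x: "ordered_expr x" and u: "u \<in> Poly_Mapping.keys (gen_elem (GenM i j))"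
    and v: "v \<in> Poly_Mapping.keys x"
  obtain ms ds where "letters v = map (\<lambda>(i, j). GenM i j) ms @ map (\<lambda>(i, j). GenD i j) ds"
    using x v unfolding ordered_expr_def by blast
  then have "letters u @ letters v = map (\<lambda>(i, j). GenM i j) ((i, j) # ms) @ map (\<lambda>(i, j). GenD i j) ds"
    using u by (simp add: gen_elem_def)
  then show "\<exists>ms ds. letters u @ letters v = map (\<lambda>(i, j). GenM i j) ms @ map (\<lambda>(i, j). GenD i j) ds"
    by blast
qed

lemma ordered_gD: "ordered_expr x \<Longrightarrow> ordered_expr (x * gen_elem (GenD i j))"
proof (rule ordered_mult)
  fix u v assume x: "ordered_expr x" and v: "v \<in> Poly_Mapping.keys (gen_elem (GenD i j))"
    and u: "u \<in> Poly_Mapping.keys x"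
  obtain ms ds where "letters u = map (\<lambda>(i, j). GenM i j) ms @ map (\<lambda>(i, j). GenD i j) ds"
    using x u unfolding ordered_expr_def by blast
  then have "letters u @ letters v = map (\<lambda>(i, j). GenM i j) ms @ map (\<lambda>(i, j). GenD i j) (ds @ [(i, j)])"
    using v by (simp add: gen_elem_def)
  then show "\<exists>ms ds. letters u @ letters v = map (\<lambda>(i, j). GenM i j) ms @ map (\<lambda>(i, j). GenD i j) ds"
    by blast
qed

lemma ordered_1: "ordered_expr 1" and ordered_0: "ordered_expr 0"
  by (auto simp: ordered_expr_def zero_gen_word_def)

lemma in_double_ring_hom:
  "in_double R \<in> ring_hom ring_of_type_algebra (quantum_double R)"
  and quantum_double_ring: "ring (quantum_double R)"
  and in_double_eq_iff: "in_double R x = in_double R y \<longleftrightarrow> x - y \<in> double_ideal R"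
proof -
  have ideal: "ideal (double_ideal R) ring_of_type_algebra"
    unfolding double_ideal_def by (simp add: two_sided_ideal_genideal flip: two_sided_ideal_iff_ideal)
  interpret ideal "double_ideal R" ring_of_type_algebra by (rule ideal)
  have "in_double R = (+>\<^bsub>ring_of_type_algebra\<^esub>) (double_ideal R)"
    by (simp add: in_double_def fun_eq_iff)
  then show "in_double R \<in> ring_hom ring_of_type_algebra (quantum_double R)"
    using rcos_ring_hom by (simp add: quantum_double_def)
  show "ring (quantum_double R)"
    unfolding quantum_double_def by (rule quotient_is_ring)
  have "x \<ominus>\<^bsub>ring_of_type_algebra\<^esub> y = x - y"
  proof -
    have "\<ominus>\<^bsub>ring_of_type_algebra\<^esub> y = - y" by (rule minus_equality) simp_all
    then show ?thesis by (simp add: a_minus_def)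
  qed
  then show "in_double R x = in_double R y \<longleftrightarrow> x - y \<in> double_ideal R"
    using quotient_eq_iff_same_a_r_cos[OF ideal, of x y] by (simp add: in_double_def)
qed

lemma in_double_mult: "in_double R x \<otimes>\<^bsub>quantum_double R\<^esub> in_double R y = in_double R (x * y)"
  and in_double_add: "in_double R x \<oplus>\<^bsub>quantum_double R\<^esub> in_double R y = in_double R (x + y)"
  and in_double_closed: "in_double R x \<in> carrier (quantum_double R)"
  using ring_hom_mult[OF in_double_ring_hom[of R]] ring_hom_add[OF in_double_ring_hom[of R]]
    ring_hom_closed[OF in_double_ring_hom[of R]] by simp_all

lemma in_double_sum:
  "finite A \<Longrightarrow> in_double R (sum f A) = (\<Oplus>\<^bsub>quantum_double R\<^esub>x\<in>A. in_double R (f x))"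
proof (induction A rule: finite_induct)
  interpret ring "quantum_double R" by (rule quantum_double_ring)
  have 0: "in_double R 0 = \<zero>\<^bsub>quantum_double R\<^esub>"
    using ring_hom_zero[OF in_double_ring_hom ring_type_algebra quantum_double_ring] by simp
  case empty
  show ?case by (simp add: 0)
next
  interpret ring "quantum_double R" by (rule quantum_double_ring)
  case (insert x A)
  then show ?case by (simp add: in_double_closed flip: in_double_add)
qed

lemma dmul_in_double:
  assumes "\<And>K. length K = n \<Longrightarrow> A I K = in_double R (A' I K)" "\<And>K. length K = n \<Longrightarrow> B K J = in_double R (B' K J)"
  shows "dmul R n A B I J = in_double R (mmul n A' B' I J)"
proof -
  interpret ring "quantum_double R" by (rule quantum_double_ring)
  have "dmul R n A B I J = (\<Oplus>\<^bsub>quantum_double R\<^esub>K\<in>{K. length K = n}. in_double R (A' I K * B' K J))"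
    unfolding dmul_def
    by (intro finsum_cong') (auto simp: assms in_double_mult in_double_closed)
  then show ?thesis
    by (simp add: mmul_def in_double_sum)
qed

context braiding
begin

lemma normal_ordering_eq:
  assumes "ordered_expr u" "w - u \<in> hom_ideal R"
  shows "normal_ordering R w = in_double R u"
  unfolding normal_ordering_def
proof (rule the_equality)
  show "is_normal_ordering R w (in_double R u)"
    using assms by (auto simp: is_normal_ordering_def)
  fix x assume "is_normal_ordering R w x"
  then obtain v where v: "ordered_expr v" "w - v \<in> hom_ideal R" "x = in_double R v"
    by (auto simp: is_normal_ordering_def)
  have "two_sided_ideal (hom_ideal R)" "two_sided_ideal (double_ideal R)"
    by (simp_all add: hom_ideal_def double_ideal_def two_sided_ideal_genideal)
  note ideals = this
  \<comment> \<open>This difference equals \<open>v - u\<close>, which \<open>N\<close> fixes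
    because u and v are ordered.\<close>
  have "(w - u) - (w - v) \<in> hom_ideal R"
    by (intro two_sided_ideal_diff ideals assms v)
  then have "N (v - u) \<in> double_ideal R"
    using subset_genideal[of "rels_M R \<union> rels_D R \<union> rels_perm R"]
    by (intro N_hom_ideal[OF ideals(2)]) (auto simp: double_ideal_def)
  then have "v - u \<in> double_ideal R"
    by (simp add: N_diff N_ordered assms v)
  then show "x = in_double R u"
    by (simp add: v in_double_eq_iff)
qed

end

section \<open>The quantum Wick formula\<close>

text \<open>A matrix given as a function is represented by a block matrix that agrees with it on the
  n-th block. The \<open>rep\<close> lemmas carry this through the recursive definitions, after
  which the abstract results apply.\<close>

lemma rep_mmul:
  assumes "meq n S (ent A)" "meq n S' (ent A')"
  shows "meq n (mmul n S S') (ent (A * A'))"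
  using assms by (auto simp: meq_def mmul_def ent_mult)

lemma rep_mid: "meq n mid (ent (1 :: ('n::finite, 'a::ring_1) bmat))"
  by (simp add: meq_def mid_def)

text \<open>\<open>hecke\<close> is the quadratic relation of the Hecke symmetry, solved for the
  inverse of R.\<close>

locale hecke_braiding = braiding R Ri Psi for R Ri Psi :: "'n::finite op2" +
  fixes q :: complex
  assumes hecke: "R - Ri = mat (q - inverse q)" and q: "q \<noteq> inverse q"
begin

lemma rep_opn: "meq n (cmat (opn n (Suc i) R)) (ent (rf n i))"
  "meq n (cmat (opn n (Suc i) Ri)) (ent (sf n i))"
  by (simp_all add: meq_def rf_def sf_def rc_def sc_def cmat_def cst_def)

lemma rep_minv:
  assumes "Suc i < n"
  shows "meq n (cmat (minv n (opn n (Suc i) R))) (ent (sf n i))"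
  using cmat_cong[OF minv_R[OF assms]] rep_opn(2) by (rule meq_trans)

lemma rep_emb1_L:
  assumes "0 < n"
  shows "meq n (emb1 Lmat) (ent (mf n * df n))"
  unfolding meq_def
proof (intro allI impI)
  fix I J :: "'n list" assume l: "length I = n" "length J = n"
  obtain a I' where I: "I = a # I'" using l assms by (cases I) auto
  have "ent (mf n * df n) I J = (\<Sum>K | length K = n. emb1 Mmat I K * emb1 Dmat K J)"
    using l by (simp add: ent_mult mf_def df_def)
  also have "\<dots> = (\<Sum>x\<in>UNIV. emb1 Mmat I (x # I') * emb1 Dmat (x # I') J)"
  proof (rule sum_words_single)
    fix K :: "'n list" assume "length K = n" "K \<notin> range (\<lambda>x. x # I')"
    then have "tl K \<noteq> I'" using assms by (cases K) auto
    then show "emb1 Mmat I K * emb1 Dmat K J = 0" by (auto simp: emb1_def I)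
  qed (use l I in \<open>auto simp: inj_on_def\<close>)
  also have "\<dots> = emb1 Lmat I J"
    by (simp add: emb1_def I Lmat_def matrix_matrix_mult_def)
  finally show "emb1 Lmat I J = ent (mf n * df n) I J" by simp
qed

lemma rep_bar:
  assumes "i < n"
  shows "meq n (bar n R Lmat (Suc i)) (ent (orbit (rf n) (sf n) (mf n) i * orbit (rf n) (sf n) (df n) i))"
  using assms
proof (induction i)
  case 0
  then show ?case using rep_emb1_L[of n] by simp
next
  case (Suc i)
  interpret braid_rep n "rf n" "sf n" by (rule braid_rep_f)
  have eq: "rf n i * (orbit (rf n) (sf n) (mf n) i * orbit (rf n) (sf n) (df n) i) * sf n i =
      orbit (rf n) (sf n) (mf n) (Suc i) * orbit (rf n) (sf n) (df n) (Suc i)"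
    using Suc.prems by (simp add: mult.assoc sr')
  have "meq n (bar n R Lmat (Suc (Suc i))) (ent (rf n i *
      (orbit (rf n) (sf n) (mf n) i * orbit (rf n) (sf n) (df n) i) * sf n i))"
    unfolding bar.simps using Suc by (intro rep_mmul rep_opn rep_minv) auto
  then show ?case by (simp only: eq)
qed

lemma rep_jm:
  assumes "i < n"
  shows "meq n (jm n R (Suc i)) (ent (orbit (rc n) (rc n) 1 i))"
  using assms
proof (induction i)
  case 0
  show ?case using rep_mid[of n] by simp
next
  case (Suc i)
  have "meq n (opn n (Suc i) R) (ent (rc n i))"
    by (simp add: meq_def rc_def)
  then show ?case
    using rep_mmul[OF rep_mmul] Suc by simp
qed

lemma rep_C:
  assumes "i < n"
  shows "meq n (\<lambda>I J. (mid I J - minv n (jm n R (Suc i)) I J) / (q - inverse q))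
    (ent (braid_rep.C (sc n) i))"
proof -
  interpret braid_rep n "rc n" "sc n" by (rule braid_rep_c)
  \<comment> \<open>The scalar q - 1/q is supported on the n-th block only, since
    \<open>rc n i - sc n i\<close> vanishes on the others.\<close>
  define c :: "('n, complex) bmat" where "c = blk n (\<lambda>I J. (q - inverse q) * mid I J)"
  have c_ent: "ent (c * A) I J = (if length I = n then (q - inverse q) * ent A I J else 0)"
    and ent_c: "ent (A * c) I J = (if length J = n then (q - inverse q) * ent A I J else 0)"
    if "length I = length J" for A :: "('n, complex) bmat" and I J
  proof -
    have "ent (c * A) I J = (\<Sum>K | length K = length I. if K = I then
        (if length I = n then (q - inverse q) * ent A I J else 0) else 0)"
      unfolding ent_mult by (intro sum.cong) (auto simp: c_def blk.rep_eq mid_def)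
    then show "ent (c * A) I J = (if length I = n then (q - inverse q) * ent A I J else 0)" by simp
    have "ent (A * c) I J = (\<Sum>K | length K = length I. if K = J then
        (if length J = n then (q - inverse q) * ent A I J else 0) else 0)"
      unfolding ent_mult by (intro sum.cong) (auto simp: c_def blk.rep_eq mid_def)
    then show "ent (A * c) I J = (if length J = n then (q - inverse q) * ent A I J else 0)"
      using that by simp
  qed
  have central: "c * A = A * c" for A
    by (rule bmat_eqI) (simp add: c_ent ent_c)
  have rs_c: "rc n i - sc n i = c" if i: "Suc i < n" for i
  proof (rule bmat_eqI)
    fix I J :: "'n list" assume l: "length I = length J"
    show "ent (rc n i - sc n i) I J = ent c I J"
    proof (cases "length I = n")
      case True
      have eq: "(\<forall>p<n. p \<noteq> i \<and> p \<noteq> Suc i \<longrightarrow> I ! p = J ! p) \<and> I ! i = J ! i \<and> I ! Suc i = J ! Suc i \<longleftrightarrow> I = J"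
        using True l i by (auto simp: list_eq_iff_nth_eq)
      have "opn n (Suc i) R I J - opn n (Suc i) Ri I J = opn n (Suc i) (R - Ri) I J"
        by (auto simp: opn_def)
      also have "\<dots> = (q - inverse q) * mid I J"
        using eq by (auto simp: hecke opn_def mat_def mid_def)
      finally show ?thesis
        using True l by (simp add: rc_def sc_def c_def)
    next
      case False
      then show ?thesis using l by (simp add: rc_def sc_def c_def ub.rep_eq blk.rep_eq)
    qed
  qed
  have "c * sc n i = 1 - sc n i * sc n i" if "Suc i < n" for i
    using rs_c[OF that] rs[OF that] by (auto simp: algebra_simps)
  then have C: "c * C i = 1 - Ji i"
    using C_eq[of c i] central assms by blast
  have "meq n (minv n (jm n R (Suc i))) (ent (Ji i))"
  proof (rule meq_minv)
    have j: "meq n (jm n R (Suc i)) (ent (J i))"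
      using rep_jm[OF assms] by (simp add: J_def)
    show "meq n (mmul n (jm n R (Suc i)) (ent (Ji i))) mid"
      using rep_mmul[OF j meq_refl[of n "ent (Ji i)"]] meq_sym[OF rep_mid]
      unfolding J_Ji[OF assms] by (rule meq_trans)
    show "meq n (mmul n (ent (Ji i)) (jm n R (Suc i))) mid"
      using rep_mmul[OF meq_refl[of n "ent (Ji i)"] j] meq_sym[OF rep_mid]
      unfolding Ji_J[OF assms] by (rule meq_trans)
  qed
  then show ?thesis
    unfolding meq_def
  proof (intro allI impI)
    fix I K :: "'n list" assume l: "length I = n" "length K = n"
    assume "\<forall>I J. length I = n \<longrightarrow> length J = n \<longrightarrow> minv n (jm n R (Suc i)) I J = ent (Ji i) I J"
    then have "mid I K - minv n (jm n R (Suc i)) I K = (q - inverse q) * ent (C i) I K"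
      using l C c_ent[of I K "C i"] by (simp add: mid_def)
    then show "(mid I K - minv n (jm n R (Suc i)) I K) / (q - inverse q) = ent (C i) I K"
      using q by simp
  qed
qed

lemma cbm_C: "cbm (braid_rep.C (sc n) i) = braid_rep.C (sf n) i"
proof -
  interpret c: braid_rep n "rc n" "sc n" by (rule braid_rep_c)
  interpret f: braid_rep n "rf n" "sf n" by (rule braid_rep_f)
  show ?thesis
    by (induction i) (simp_all add: cbm_add cbm_mult flip: sf_def)
qed

lemma quantum_wick:
  assumes "1 \<le> k"
  shows "meq (k + 1)
    (dmul R (k + 1)
      (normal_mat R (barprod (k + 1) R Lmat k))
      (in_double_mat R (bar (k + 1) R Lmat (k + 1))))
    (dadd R
      (normal_mat R (barprod (k + 1) R Lmat (k + 1)))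
      (dmul R (k + 1)
        (normal_mat R (barprod (k + 1) R Lmat k))
        (in_double_mat R (cmat (\<lambda>I J.
          (mid I J - minv (k + 1) (jm (k + 1) R (k + 1)) I J) / (q - inverse q))))))"
proof -
  define n where "n = k + 1"
  then have nk: "n = Suc k" by simp
  have HI: "two_sided_ideal (hom_ideal R)" and DI: "two_sided_ideal (double_ideal R)"
    by (simp_all add: hom_ideal_def double_ideal_def two_sided_ideal_genideal)
  interpret H: double_rep n "rf n" "sf n" "block_ideal n (hom_ideal R)" "mf n" "df n" 0
    using subset_genideal[of "rels_M R \<union> rels_D R \<union> rels_perm_hom R"]
    by (intro double_rep_hom HI) (auto simp: hom_ideal_def)
  interpret D: double_rep n "rf n" "sf n" "block_ideal n (double_ideal R)" "mf n" "df n" 1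
    using subset_genideal[of "rels_M R \<union> rels_D R \<union> rels_perm R"]
    by (intro double_rep_double DI) (auto simp: double_ideal_def)
  define U where "U j = H.MM j * H.DD j" for j
  have bar: "meq n (bar n R Lmat (Suc j)) (ent (H.mb j * H.db j))" if "j < n" for j
    using rep_bar[OF that] by (simp add: H.mb_def H.db_def)
  have normal: "\<exists>A. meq n (barprod n R Lmat j) (ent A) \<and> H.cong A (U j)" if "j \<le> n" for j
    using that
  proof (induction j)
    case 0
    show ?case
      using rep_mid[of n] by (intro exI[of _ 1]) (simp add: U_def del: one_bmat.rep_eq)
  next
    case (Suc j)
    then obtain A where A: "meq n (barprod n R Lmat j) (ent A)" "H.cong A (U j)" by auto
    have "H.cong (A * (H.mb j * H.db j)) (U j * (H.mb j * H.db j))"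
      by (intro H.cong_mult A(2) H.cong_refl)
    also have "H.cong \<dots> (U (Suc j))"
      unfolding U_def using Suc.prems by (intro H.product_normal_form) auto
    finally show ?case
      using rep_mmul[OF A(1) bar[of j]] Suc.prems by auto
  qed
  have ordered: "ordered_expr (ent (U j) I J)" for j I J
  proof -
    \<comment> \<open>Ordered expressions are not closed under products. Instead, the left
      multipliers and the right multipliers that preserve orderedness form subalgebras, containing
      the entries of M and of D respectively.\<close>
    have O: "subalg {x. \<forall>y. ordered_expr y \<longrightarrow> ordered_expr (x * y)}"
      "subalg {x. \<forall>y. ordered_expr y \<longrightarrow> ordered_expr (y * x)}"
      by (auto simp: subalg_def distrib_left distrib_right mult.assoc ordered_add ordered_cst
          simp flip: cst_central)
    have mb: "ent (H.mb i) I J \<in> {x. \<forall>y. ordered_expr y \<longrightarrow> ordered_expr (x * y)}" for i I J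
    proof (induction i arbitrary: I J)
      case 0
      show ?case unfolding H.mb_0 by (rule subalg_ents(6)[OF O(1)]) (simp add: ordered_gM)
    next
      case (Suc i)
      show ?case unfolding H.mb_Suc by (intro subalg_ents[OF O(1)] Suc)
    qed
    have M: "ent (H.MM j) I J \<in> {x. \<forall>y. ordered_expr y \<longrightarrow> ordered_expr (x * y)}" for j I J
    proof (induction j arbitrary: I J)
      case 0
      show ?case unfolding H.MM.simps by (rule subalg_ents(5)[OF O(1)])
    next
      case (Suc j)
      show ?case unfolding H.MM.simps by (intro subalg_ents(1)[OF O(1)] Suc mb)
    qed
    have dd: "ent (H.dd i) I J \<in> {x. \<forall>y. ordered_expr y \<longrightarrow> ordered_expr (y * x)}" for i I J
    proof (induction i arbitrary: I J)
      case 0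
      show ?case unfolding H.dd_0 by (rule subalg_ents(7)[OF O(2)]) (simp add: ordered_gD)
    next
      case (Suc i)
      show ?case unfolding H.dd_Suc by (intro subalg_ents[OF O(2)] Suc)
    qed
    have DD: "ent (H.DD j) I J \<in> {x. \<forall>y. ordered_expr y \<longrightarrow> ordered_expr (y * x)}" for j I J
    proof (induction j arbitrary: I J)
      case 0
      show ?case unfolding H.DD.simps by (rule subalg_ents(5)[OF O(2)])
    next
      case (Suc j)
      show ?case unfolding H.DD.simps by (intro subalg_ents(1)[OF O(2)] Suc dd)
    qed
    have sum: "ordered_expr (sum f B)" if "\<And>x. ordered_expr (f x)" for f :: "'n list \<Rightarrow> _" and B
      using that by (induction B rule: infinite_finite_induct) (auto intro: ordered_0 ordered_add)
    have "ordered_expr (ent (H.MM j) I K * ent (H.DD j) K J)" for K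
    proof -
      have "ordered_expr (ent (H.MM j) I K * 1)" using M[of j I K] ordered_1 by blast
      then show ?thesis using DD[of j K J] by simp
    qed
    then show ?thesis unfolding U_def ent_mult by (rule sum)
  qed
  have no: "normal_mat R (barprod n R Lmat j) I J = in_double R (ent (U j) I J)"
    if "j \<le> n" "length I = n" "length J = n" for j I J
  proof -
    obtain A where A: "meq n (barprod n R Lmat j) (ent A)" "A - U j \<in> block_ideal n (hom_ideal R)"
      using normal[OF \<open>j \<le> n\<close>] unfolding H.cong_def by blast
    have "ent (A - U j) I J \<in> hom_ideal R"
      using A(2) that unfolding block_ideal_def by blast
    then have "barprod n R Lmat j I J - ent (U j) I J \<in> hom_ideal R"
      using A(1) that by (simp add: meq_def)
    then show ?thesis
      unfolding normal_mat_def by (intro normal_ordering_eq ordered)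
  qed
  define Cm where "Cm = cmat (\<lambda>I J. (mid I J - minv n (jm n R n) I J) / (q - inverse q))"
  have Cm: "meq n Cm (ent (H.C k))"
    using rep_C[of k n] unfolding cbm_C[symmetric]
    by (simp add: meq_def Cm_def cmat_def cst_def n_def)
  have wick: "U k * (H.mb k * H.db k) - (U (Suc k) + U k * H.C k) \<in> block_ideal n (double_ideal R)"
    unfolding U_def D.cong_def[symmetric] by (rule D.wick) (simp_all add: n_def)
  show ?thesis
    unfolding n_def[symmetric] Cm_def[symmetric] unfolding meq_def
  proof (intro allI impI)
    fix I J :: "'n list" assume l: "length I = n" "length J = n"
    have dm: "dmul R n (normal_mat R (barprod n R Lmat k)) (in_double_mat R B) I J =
        in_double R (ent (U k * A) I J)" if "meq n B (ent A)" for A B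
    proof -
      have "dmul R n (normal_mat R (barprod n R Lmat k)) (in_double_mat R B) I J =
          in_double R (mmul n (ent (U k)) (ent A) I J)"
        using that l by (intro dmul_in_double no) (auto simp: n_def in_double_mat_def meq_def)
      then show ?thesis using l by (simp add: mmul_def ent_mult)
    qed
    have "ent (U k * (H.mb k * H.db k) - (U (Suc k) + U k * H.C k)) I J \<in> double_ideal R"
      using wick l unfolding block_ideal_def by blast
    then have "in_double R (ent (U k * (H.mb k * H.db k)) I J) =
        in_double R (ent (U (Suc k)) I J) \<oplus>\<^bsub>quantum_double R\<^esub> in_double R (ent (U k * H.C k) I J)"
      by (simp add: in_double_eq_iff in_double_add)
    moreover have "dmul R n (normal_mat R (barprod n R Lmat k)) (in_double_mat R (bar n R Lmat n)) I J =
        in_double R (ent (U k * (H.mb k * H.db k)) I J)"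
      using dm[OF bar[of k]] nk by simp
    ultimately show "dmul R n (normal_mat R (barprod n R Lmat k)) (in_double_mat R (bar n R Lmat n)) I J =
        dadd R (normal_mat R (barprod n R Lmat n))
          (dmul R n (normal_mat R (barprod n R Lmat k)) (in_double_mat R Cm)) I J"
      unfolding dadd_def dm[OF Cm] no[OF order_refl l] using nk by simp
  qed
qed

end

lemma hecke_braiding_exists:
  assumes "hecke_symmetry q R" "skew_invertible R"
  shows "\<exists>Ri Psi. hecke_braiding R Ri Psi q"
proof -
  have q: "q \<noteq> 0" "q ^ 2 \<noteq> 1" and poly: "(mat q - R) ** (mat (inverse q) + R) = 0"
    using assms(1) by (auto simp: hecke_symmetry_def)
  obtain Psi where Psi: "ptrace2 (mmul 3 (opn 3 1 R) (opn 3 2 Psi)) = flip"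
    "ptrace2 (mmul 3 (opn 3 1 Psi) (opn 3 2 R)) = flip"
    using assms(2) by (auto simp: skew_invertible_def)
  \<comment> \<open>The Hecke relation expands to R^2 = 1 + (q - 1/q) R.\<close>
  define Ri where "Ri = R - mat (q - inverse q)"
  have matl: "(\<Sum>k\<in>UNIV. (if i = k then c else 0) * f k) = c * f i"
    and matr: "(\<Sum>k\<in>UNIV. f k * (if k = i then c else 0)) = f i * (c :: complex)"
    for c and f :: "'a \<times> 'a \<Rightarrow> complex" and i
  proof -
    have "(\<Sum>k\<in>UNIV. (if i = k then c else 0) * f k) = (\<Sum>k\<in>UNIV. if k = i then c * f k else 0)"
      "(\<Sum>k\<in>UNIV. f k * (if k = i then c else 0)) = (\<Sum>k\<in>UNIV. if k = i then f k * c else 0)"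
      by (intro sum.cong refl; simp)+
    then show "(\<Sum>k\<in>UNIV. (if i = k then c else 0) * f k) = c * f i"
      "(\<Sum>k\<in>UNIV. f k * (if k = i then c else 0)) = f i * c" by simp_all
  qed
  have sq: "(\<Sum>k\<in>UNIV. R $ i $ k * R $ k $ j) = (if i = j then 1 else 0) + (q - inverse q) * R $ i $ j" for i j
  proof -
    have "((mat q - R) ** (mat (inverse q) + R)) $ i $ j = 0"
      using poly by simp
    then show ?thesis
      using q by (simp add: matrix_matrix_mult_def mat_def left_diff_distrib distrib_left
          sum.distrib sum_subtractf matl matr) (cases "i = j"; simp add: algebra_simps)
  qed
  have "R ** Ri = mat 1" "Ri ** R = mat 1"
    unfolding vec_eq_iff Ri_def
    by (simp_all add: matrix_matrix_mult_def mat_def left_diff_distrib right_diff_distrib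
        sum_subtractf matl matr sq) 
  \<comment> \<open>Genericity of q with exponent 2 excludes q^2 = 1.\<close>
  moreover have "q \<noteq> inverse q"
    using q by (metis power2_eq_square right_inverse)
  ultimately have "hecke_braiding R Ri Psi q"
    using assms(1) Psi by unfold_locales (auto simp: hecke_symmetry_def Ri_def)
  then show ?thesis by blast
qed

theorem theorem20:
  fixes R :: "complex ^ ('n::finite \<times> 'n) ^ ('n \<times> 'n)" and q :: complex and k :: nat
    and Q :: "complex set" and F :: "complex \<Rightarrow> complex ^ ('n \<times> 'n) ^ ('n \<times> 'n)"
    and R0 :: "complex ^ ('n \<times> 'n) ^ ('n \<times> 'n)"
  assumes "hecke_symmetry q R"
    and "skew_invertible R"
    and "hecke_family Q F R0" and "q \<in> Q" and "R = F q"
    and "k \<ge> 1"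
  shows "meq (k + 1)
    (dmul R (k + 1)
      (normal_mat R (barprod (k + 1) R Lmat k))
      (in_double_mat R (bar (k + 1) R Lmat (k + 1))))
    (dadd R
      (normal_mat R (barprod (k + 1) R Lmat (k + 1)))
      (dmul R (k + 1)
        (normal_mat R (barprod (k + 1) R Lmat k))
        (in_double_mat R (cmat (\<lambda>I J.
          (mid I J - minv (k + 1) (jm (k + 1) R (k + 1)) I J) / (q - inverse q))))))"
proof -
  obtain Ri Psi where "hecke_braiding R Ri Psi q"
    using hecke_braiding_exists assms by blast
  then show ?thesis
    using assms by (intro hecke_braiding.quantum_wick)
qed

end
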